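(* Let $j+k<n$. If $f$ is a locally integrable function on $G(n,j)$ satisfying $$\int_{|\tau|>a}|f(\tau)|\,|\tau|^{k+j-n}\,d\tau<\infty\qquad( * )$$ for some $a>0$, then $(\mathcal R_{j,k}f)(\zeta)$ is finite for almost all $\zeta\in G(n,k)$. If $f$ is a nonnegative, radial, locally integrable function on $G(n,j)$ for which condition $( * )$ fails (i.e. $( * )$ holds for no $a>0$), then $(\mathcal R_{j,k}f)(\zeta)=\infty$ for all $\zeta\in G(n,k)$.
   Context: Throughout, $n,j,k$ are integers with $j>0$, $k>0$, $j+k<n$, and all integrals are Lebesgue integrals. $G_{n,j}$ is the Grassmannian of $j$-dimensional linear subspaces of $\mathbb R^n$; $G(n,j)$ is the manifold of $j$-dimensional unoriented affine planes in $\mathbb R^n$. Every $\tau\in G(n,j)$ is written uniquely as $\tau=\tau(\xi,u)=\xi+u$ with $\xi\in G_{n,j}$, $u\in\xi^\perp$; $|\tau|=|u|$ is the Euclidean distance from $\tau$ to the origin. $G(n,j)$ carries the measure $d\tau=d\xi\,du$, with $d\xi$ the $O(n)$-invariant probability measure on $G_{n,j}$ and $du$ Lebesgue measure on $\xi^\perp$. Similarly $\zeta=\zeta(\eta,v)=\eta+v\in G(n,k)$, $\eta\in G_{n,k}$, $v\in\eta^\perp$. A function $f$ on $G(n,j)$ is radial if $f(\tau)=f_0(|\tau|)$ for some function $f_0$ of one variable. The mixed Radon transform $\mathcal R_{j,k}$ takes $f$ on $G(n,j)$ to the function on $G(n,k)$ $$(\mathcal R_{j,k}f)(\eta+v)=\int_{G_j(\eta^\perp)}d\xi\int_\eta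 f(\xi+u+v)\,du,$$ where $G_j(\eta^\perp)$ is the Grassmannian of $j$-dimensional linear subspaces of $\eta^\perp$ with its invariant probability measure and $du$ is Lebesgue measure on $\eta$. *)

theory Defs
  imports "HOL-Analysis.Analysis"
begin

section \<open>Affine planes\<close>

text \<open>Affine planes are represented by their point sets. Throughout, \<open>\<real>\<^sup>n\<close> is a Euclidean space
  \<open>'a\<close> with \<open>n = DIM('a)\<close>.\<close>

definition grassmannian :: "nat \<Rightarrow> 'a::euclidean_space set \<Rightarrow> 'a set set" where
  "grassmannian j E = {\<xi>. subspace \<xi> \<and> \<xi> \<subseteq> E \<and> dim \<xi> = j}"

definition affine_grassmannian :: "nat \<Rightarrow> 'a::euclidean_space set set" where
  "affine_grassmannian j = {\<tau>. affine \<tau> \<and> aff_dim \<tau> = int j}"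

abbreviation plane :: "'a::euclidean_space set \<Rightarrow> 'a \<Rightarrow> 'a set" where
  "plane \<xi> u \<equiv> (+) u ` \<xi>"

definition direction :: "'a::euclidean_space set \<Rightarrow> 'a set" where
  "direction \<tau> = {x - y | x y. x \<in> \<tau> \<and> y \<in> \<tau>}"

definition foot :: "'a::euclidean_space set \<Rightarrow> 'a" where
  "foot \<tau> = closest_point \<tau> 0"

text \<open>The distance \<open>|\<tau>|\<close> from the plane to the origin.\<close>

abbreviation plane_norm :: "'a::euclidean_space set \<Rightarrow> real" where
  "plane_norm \<tau> \<equiv> infdist 0 \<tau>"

text \<open>The maps \<open>\<tau> \<mapsto> (direction \<tau>, foot \<tau>)\<close> and \<open>(\<xi>, u) \<mapsto> plane \<xi> u\<close> are the unique
  decomposition \<open>\<tau> = \<xi> + u\<close> with \<open>u \<in> \<xi>\<^sup>\<bottom>\<close>.\<close>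

lemma direction_plane:
  assumes "subspace \<xi>"
  shows "direction (plane \<xi> u) = \<xi>"
proof
  show "direction (plane \<xi> u) \<subseteq> \<xi>"
    using assms by (auto simp: direction_def subspace_diff)
  show "\<xi> \<subseteq> direction (plane \<xi> u)"
  proof
    fix x assume "x \<in> \<xi>"
    then have "u + x \<in> plane \<xi> u" "u + 0 \<in> plane \<xi> u" "x = (u + x) - (u + 0)"
      using assms subspace_0 by (blast, blast, simp)
    then show "x \<in> direction (plane \<xi> u)"
      unfolding direction_def by blast
  qed
qed

lemma foot_plane:
  assumes "subspace \<xi>" "u \<in> \<xi>\<^sup>\<bottom>"
  shows "foot (plane \<xi> u) = u"
proof -
  have "norm u \<le> norm (u + x)" if "x \<in> \<xi>" for x
  proof -
    have "orthogonal u x"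
      using assms(2) that by (auto simp: orthogonal_comp_def orthogonal_commute)
    then have "(norm (u + x))\<^sup>2 = (norm u)\<^sup>2 + (norm x)\<^sup>2"
      by (rule norm_add_Pythagorean)
    then have "(norm u)\<^sup>2 \<le> (norm (u + x))\<^sup>2"
      by simp
    then show ?thesis
      using norm_ge_zero power2_le_imp_le by blast
  qed
  then have "\<forall>z\<in>plane \<xi> u. dist 0 u \<le> dist 0 z"
    by auto
  moreover have "u \<in> plane \<xi> u"
    using assms(1) subspace_0 by force
  moreover have "convex (plane \<xi> u)" "closed (plane \<xi> u)"
    using assms(1) by (simp_all add: subspace_imp_convex convex_translation_eq
        closed_subspace closed_translation)
  ultimately show ?thesis
    unfolding foot_def by (metis closest_point_unique)
qed

lemma plane_norm_plane:
  assumes "subspace \<xi>" "u \<in> \<xi>\<^sup>\<bottom>"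
  shows "plane_norm (plane \<xi> u) = norm u"
proof -
  have "closed (plane \<xi> u)" "plane \<xi> u \<noteq> {}"
    using assms(1) subspace_0 by (auto simp: closed_subspace closed_translation)
  then have "plane_norm (plane \<xi> u) = dist 0 (closest_point (plane \<xi> u) 0)"
    by (metis infdist_eq_setdist setdist_closest_point)
  then show ?thesis
    using foot_plane[OF assms] by (simp add: foot_def)
qed

lemma affine_grassmannian_iff:
  "\<tau> \<in> affine_grassmannian j \<longleftrightarrow>
     (\<exists>\<xi>\<in>grassmannian j UNIV. \<exists>u\<in>\<xi>\<^sup>\<bottom>. \<tau> = plane \<xi> u)"
proof
  assume "\<tau> \<in> affine_grassmannian j"
  then have aff: "affine \<tau>" and d: "aff_dim \<tau> = int j"
    by (auto simp: affine_grassmannian_def)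
  from d have ne: "\<tau> \<noteq> {}"
    by auto
  then obtain a where a: "a \<in> \<tau>"
    by blast
  define \<xi> where "\<xi> = (+) (- a) ` \<tau>"
  have \<tau>: "\<tau> = plane \<xi> a"
    by (auto simp: \<xi>_def image_image)
  have sub: "subspace \<xi>"
    unfolding \<xi>_def using a aff affine_diffs_subspace by blast
  have "dim \<xi> = j"
    using d sub by (simp add: \<tau> aff_dim_translation_eq aff_dim_subspace)
  then have \<xi>: "\<xi> \<in> grassmannian j UNIV"
    using sub by (simp add: grassmannian_def)
  obtain y z where yz: "y \<in> span \<xi>" "\<And>w. w \<in> span \<xi> \<Longrightarrow> orthogonal z w" "a = y + z"
    using orthogonal_subspace_decomp_exists by metis
  have span: "span \<xi> = \<xi>"
    using sub by (metis span_eq_iff)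
  have "y \<in> \<xi>" "z \<in> \<xi>\<^sup>\<bottom>"
    using yz(1,2)[unfolded span] by (auto simp: orthogonal_comp_def orthogonal_commute)
  moreover have "plane \<xi> a = plane \<xi> z"
  proof -
    have "plane \<xi> y = \<xi>"
    proof
      show "plane \<xi> y \<subseteq> \<xi>"
        using \<open>y \<in> \<xi>\<close> sub subspace_add by blast
      show "\<xi> \<subseteq> plane \<xi> y"
      proof
        fix x assume "x \<in> \<xi>"
        then have "x - y \<in> \<xi>" "x = y + (x - y)"
          using \<open>y \<in> \<xi>\<close> sub subspace_diff by auto
        then show "x \<in> plane \<xi> y"
          by blast
      qed
    qed
    moreover have "plane \<xi> a = (+) z ` plane \<xi> y"
      by (simp add: yz(3) image_image add.assoc add.left_commute)
    ultimately show ?thesis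
      by simp
  qed
  ultimately show "\<exists>\<xi>\<in>grassmannian j UNIV. \<exists>u\<in>\<xi>\<^sup>\<bottom>. \<tau> = plane \<xi> u"
    using \<xi> \<tau> by blast
next
  assume "\<exists>\<xi>\<in>grassmannian j UNIV. \<exists>u\<in>\<xi>\<^sup>\<bottom>. \<tau> = plane \<xi> u"
  then show "\<tau> \<in> affine_grassmannian j"
    by (auto simp: affine_grassmannian_def grassmannian_def aff_dim_translation_eq
        aff_dim_subspace subspace_imp_affine affine_translation[symmetric])
qed


section \<open>Measures\<close>

text \<open>A subspace is identified with its orthogonal projection, which embeds a Grassmannian into the
  normed space of linear maps; its topology and Borel sets are the induced ones.\<close>

definition orth_proj :: "'a::euclidean_space set \<Rightarrow> ('a \<Rightarrow>\<^sub>L 'a)" where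
  "orth_proj \<xi> = Blinfun (closest_point \<xi>)"

definition grassmannian_borel :: "nat \<Rightarrow> 'a::euclidean_space set \<Rightarrow> 'a set measure" where
  "grassmannian_borel j E = vimage_algebra (grassmannian j E) orth_proj borel"

text \<open>Every isometry of \<open>E\<close> extends to an element of \<open>O(n)\<close>, so the invariance below is that
  under the full orthogonal group of \<open>E\<close>.\<close>

definition invariant_prob :: "nat \<Rightarrow> 'a::euclidean_space set \<Rightarrow> 'a set measure \<Rightarrow> bool" where
  "invariant_prob j E M \<longleftrightarrow>
     sets M = sets (grassmannian_borel j E) \<and> emeasure M (space M) = 1 \<and>
     (\<forall>T. orthogonal_transformation T \<longrightarrow> T ` E = E \<longrightarrow>
        (\<forall>A\<in>sets M. emeasure M ((`) T ` A) = emeasure M A))"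

definition grassmannian_measure :: "nat \<Rightarrow> 'a::euclidean_space set \<Rightarrow> 'a set measure" where
  "grassmannian_measure j E = (THE M. invariant_prob j E M)"

text \<open>Lebesgue measure (on Borel sets) of a linear subspace, in the coordinates of an orthonormal
  basis; it does not depend on the basis. Compare the definition of \<^const>\<open>lborel\<close>.\<close>

definition subspace_lborel :: "'a::euclidean_space set \<Rightarrow> 'a measure" where
  "subspace_lborel E =
     (let B = (SOME B. B \<subseteq> E \<and> span B = E \<and> pairwise orthogonal B \<and> (\<forall>b\<in>B. norm b = 1))
      in distr (\<Pi>\<^sub>M b\<in>B. lborel) (restrict_space borel E) (\<lambda>c. \<Sum>b\<in>B. c b *\<^sub>R b))"

text \<open>The topology of \<open>G(n,j)\<close> is induced by the following injective map, i.e. by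
  \<open>\<xi> + u \<mapsto> (P\<^sub>\<xi>, u)\<close>.\<close>

definition plane_coord :: "'a::euclidean_space set \<Rightarrow> ('a \<Rightarrow>\<^sub>L 'a) \<times> 'a" where
  "plane_coord \<tau> = (orth_proj (direction \<tau>), foot \<tau>)"

definition plane_borel :: "nat \<Rightarrow> 'a::euclidean_space set measure" where
  "plane_borel j = vimage_algebra (affine_grassmannian j) plane_coord borel"

text \<open>\<open>d\<tau> = d\<xi> du\<close>, completed, so that measurability means Lebesgue measurability.\<close>

definition plane_measure :: "nat \<Rightarrow> 'a::euclidean_space set measure" where
  "plane_measure j = completion
     (measure_of (affine_grassmannian j) (sets (plane_borel j))
       (\<lambda>A. \<integral>\<^sup>+ \<xi>. emeasure (subspace_lborel (\<xi>\<^sup>\<bottom>)) {u \<in> \<xi>\<^sup>\<bottom>. plane \<xi> u \<in> A}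
              \<partial>grassmannian_measure j UNIV))"


section \<open>Function classes and the mixed Radon transform\<close>

definition locally_integrable :: "nat \<Rightarrow> ('a::euclidean_space set \<Rightarrow> real) \<Rightarrow> bool" where
  "locally_integrable j f \<longleftrightarrow>
     (\<forall>K. K \<subseteq> affine_grassmannian j \<and> compact (plane_coord ` K) \<longrightarrow>
        set_integrable (plane_measure j) K f)"

definition radial :: "nat \<Rightarrow> ('a::euclidean_space set \<Rightarrow> real) \<Rightarrow> bool" where
  "radial j f \<longleftrightarrow> (\<exists>f\<^sub>0. \<forall>\<tau>\<in>affine_grassmannian j. f \<tau> = f\<^sub>0 (plane_norm \<tau>))"

definition tail_condition :: "nat \<Rightarrow> nat \<Rightarrow> ('a::euclidean_space set \<Rightarrow> real) \<Rightarrow> real \<Rightarrow> bool" where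
  "tail_condition j k f a \<longleftrightarrow>
     (\<integral>\<^sup>+ \<tau>\<in>{\<tau>. plane_norm \<tau> > a}.
        ennreal (\<bar>f \<tau>\<bar> * plane_norm \<tau> powi (int k + int j - int DIM('a))) \<partial>plane_measure j) < \<infinity>"

text \<open>The Lebesgue integral of an extended real function, as a relation: it has no value for
  non-measurable integrands and for those whose positive and negative parts both have infinite
  integral.\<close>

definition has_lebesgue_integral :: "'b measure \<Rightarrow> ('b \<Rightarrow> ereal) \<Rightarrow> ereal \<Rightarrow> bool" where
  "has_lebesgue_integral M g x \<longleftrightarrow>
     g \<in> borel_measurable M \<and>
     ((\<integral>\<^sup>+ t. e2ennreal (g t) \<partial>M) < \<infinity> \<or> (\<integral>\<^sup>+ t. e2ennreal (- g t) \<partial>M) < \<infinity>) \<and>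
     x = enn2ereal (\<integral>\<^sup>+ t. e2ennreal (g t) \<partial>M) - enn2ereal (\<integral>\<^sup>+ t. e2ennreal (- g t) \<partial>M)"

text \<open>\<open>has_mixed_radon j f \<zeta> x\<close> states \<open>(R\<^sub>j\<^sub>,\<^sub>k f)(\<zeta>) = x\<close>, where \<open>k\<close> is the dimension of \<open>\<zeta> = \<eta> + v\<close>.
  The inner integral \<open>h \<xi>\<close> over \<open>\<eta>\<close> is required to exist for almost all \<open>\<xi>\<close>.\<close>

definition has_mixed_radon ::
    "nat \<Rightarrow> ('a::euclidean_space set \<Rightarrow> real) \<Rightarrow> 'a set \<Rightarrow> ereal \<Rightarrow> bool" where
  "has_mixed_radon j f \<zeta> x \<longleftrightarrow>
     (let \<eta> = direction \<zeta>; v = foot \<zeta>; G = completion (grassmannian_measure j (\<eta>\<^sup>\<bottom>)) in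
      \<exists>h. (AE \<xi> in G. has_lebesgue_integral (completion (subspace_lborel \<eta>))
                         (\<lambda>u. ereal (f (plane \<xi> (u + v)))) (h \<xi>)) \<and>
          has_lebesgue_integral G h x)"

lemma has_mixed_radon_plane:
  assumes "\<eta> \<in> grassmannian k UNIV" "v \<in> \<eta>\<^sup>\<bottom>"
  shows "has_mixed_radon j f (plane \<eta> v) x \<longleftrightarrow>
    (\<exists>h. (AE \<xi> in completion (grassmannian_measure j (\<eta>\<^sup>\<bottom>)).
            has_lebesgue_integral (completion (subspace_lborel \<eta>))
              (\<lambda>u. ereal (f (plane \<xi> (u + v)))) (h \<xi>)) \<and>
         has_lebesgue_integral (completion (grassmannian_measure j (\<eta>\<^sup>\<bottom>))) h x)"
  using assms by (simp add: has_mixed_radon_def Let_def grassmannian_def direction_plane foot_plane)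

lemma has_lebesgue_integral_real_iff:
  "has_lebesgue_integral M (\<lambda>t. ereal (g t)) (ereal r) \<longleftrightarrow> has_bochner_integral M g r"
proof -
  let ?P = "\<integral>\<^sup>+ t. ennreal (g t) \<partial>M" and ?N = "\<integral>\<^sup>+ t. ennreal (- g t) \<partial>M"
  have abs: "(\<integral>\<^sup>+ t. ennreal \<bar>g t\<bar> \<partial>M) = ?P + ?N" if "g \<in> borel_measurable M"
  proof -
    have "ennreal \<bar>g t\<bar> = ennreal (g t) + ennreal (- g t)" for t
      by (cases "g t \<ge> 0") (auto simp: ennreal_neg)
    then show ?thesis
      using that by (simp add: nn_integral_add)
  qed
  have int: "integrable M g \<longleftrightarrow> g \<in> borel_measurable M \<and> ?P < \<infinity> \<and> ?N < \<infinity>"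
    using abs by (auto simp: integrable_iff_bounded)
  have e: "enn2ereal p - enn2ereal n = ereal r \<and> (p < \<infinity> \<or> n < \<infinity>) \<longleftrightarrow>
      p < \<infinity> \<and> n < \<infinity> \<and> r = enn2real p - enn2real n" for p n
    by (cases p; cases n) (auto simp: enn2ereal_ennreal)
  have "has_bochner_integral M g r \<longleftrightarrow> integrable M g \<and> r = enn2real ?P - enn2real ?N"
    using real_lebesgue_integral_def[of M g] by (auto simp: has_bochner_integral_iff)
  then show ?thesis
    unfolding has_lebesgue_integral_def int using e[of ?P ?N]
    by (auto simp: borel_measurable_ereal_iff)
qed

end

theory Submission
  imports Defs "HOL-Probability.Giry_Monad"
begin

text \<open>Two measures for which balls of equal radius have equal mass are proportional (Christensen).
  Hence invariant probability measures on Grassmannians and on pairs of orthogonal subspaces are unique,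
  and it does not matter whether \<open>\<xi>\<close> or \<open>\<eta>\<close> is chosen first in an orthogonal pair. Since \<open>\<real>\<^sup>n\<close> is the sum of
  \<open>\<eta>\<close> and \<open>\<eta>\<^sup>\<bottom>\<close>, this gives the duality
  \<open>\<integral> \<phi>(\<zeta>) (R\<^sub>j\<^sub>,\<^sub>k f)(\<zeta>) d\<zeta> = \<integral> d\<xi> \<integral> d\<eta> \<integral> \<phi>(\<eta> + x) f(\<xi> + x) dx\<close>, where \<open>\<eta>\<close> ranges over the \<open>k\<close>-dimensional subspaces
  of \<open>\<xi>\<^sup>\<bottom>\<close> and \<open>x\<close> over \<open>\<real>\<^sup>n\<close>. For \<open>\<phi>\<close> the indicator function of \<open>|\<zeta>| \<le> R\<close>, integrating \<open>x\<close> along \<open>\<xi>\<close> leaves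
  at most a multiple of \<open>\<integral> |f(\<tau>)| p(\<tau>) d\<tau>\<close>, where \<open>p(\<tau>)\<close> is the probability that \<open>\<eta>\<close> passes within distance \<open>R\<close> of the
  foot of \<open>\<tau>\<close>. As \<open>p(\<tau>) \<le> C (R / |\<tau>|)\<^sup>n\<^sup>-\<^sup>j\<^sup>-\<^sup>k\<close>, the transform of \<open>|f|\<close> is integrable over \<open>|\<zeta>| \<le> R\<close>.

  If \<open>f(\<tau>) = f\<^sub>0(|\<tau>|)\<close>, the inner integral of the transform is a multiple of
  \<open>\<integral> f\<^sub>0(t) (t\<^sup>2 - w\<^sup>2)\<^sup>k\<^sup>/\<^sup>2\<^sup>-\<^sup>1 t dt\<close> over \<open>t > w\<close> for some \<open>w\<close>, while the condition on \<open>f\<close> is finiteness of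
  \<open>\<integral> f\<^sub>0(t) t\<^sup>k\<^sup>-\<^sup>1 dt\<close> near infinity; so the inner integral diverges for every \<open>\<xi>\<close> if the condition fails.\<close>

text \<open>The invariant measure on a Grassmannian is given by a definite description, so it has to
  be constructed, and it has to depend measurably on the ambient space: in a pair (\<xi>, \<eta>)
  the space \<open>\<eta>\<^sup>\<bottom>\<close> that contains \<xi> is itself random. This is why
  subspaces of all dimensions form one measurable space, why subspaces are built vector by vector
  through a Markov kernel, and why an integral over a varying subspace is rewritten as one over R^n
  with the orthogonal component confined to the unit ball. The other obstacle is null sets. f is
  only Lebesgue measurable on G(n,j), and the planes that enter the transform at one \<zeta> may all
  lie in the null set where f differs from a Borel function. For the finiteness statement a Borel
  function that is infinite on that null set is transformed, and finiteness of the result excludes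
  the set. For radial f everything is moved to the single variable |\<tau>|, where a Borel version
  of \<open>f\<^sub>0\<close> has to be found first.\<close>

text \<open>Second countability makes pairs of Borel maps into the operators Borel, and it provides
  the countable subcovers in the uniqueness theorem. Closed balls are compact, so finite nets of
  mesh 1/(m+1) in the balls of radius n yield a countable base.\<close>

instance blinfun :: (euclidean_space, euclidean_space) second_countable_topology
proof
  have "\<exists>k. finite k \<and> cball (0::'a \<Rightarrow>\<^sub>L 'b) (real n) \<subseteq> (\<Union>x\<in>k. ball x (1 / Suc m))" for n m :: nat
  proof -
    have "compact (cball (0::'a \<Rightarrow>\<^sub>L 'b) (real n))" by simp
    from conjunct2[OF this[unfolded compact_eq_totally_bounded], rule_format, of "1 / Suc m"]
    show ?thesis by auto
  qed
  then obtain k where k: "\<And>n m. finite (k n m)"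
    "\<And>n m. cball (0::'a \<Rightarrow>\<^sub>L 'b) (real n) \<subseteq> (\<Union>x\<in>k n m. ball x (1 / Suc m))"
    by metis
  define D where "D = (\<Union>n m. k n m)"
  define B where "B = (\<Union>d\<in>D. range (\<lambda>m::nat. ball d (1 / Suc m)))"
  have "countable D"
    unfolding D_def using k(1) by (auto intro!: countable_UN simp: countable_finite)
  then have "countable B"
    unfolding B_def by auto
  moreover have "topological_basis B"
  proof (rule topological_basisI)
    show "open S" if "S \<in> B" for S using that by (auto simp: B_def)
    fix S :: "('a \<Rightarrow>\<^sub>L 'b) set" and x assume "open S" "x \<in> S"
    then obtain e where e: "e > 0" "ball x e \<subseteq> S" by (meson openE)
    obtain m :: nat where m: "1 / Suc m < e / 2"
      by (metis e(1) half_gt_zero nat_approx_posE)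
    obtain n :: nat where "norm x \<le> n" using real_arch_simple by blast
    then obtain d where d: "d \<in> k n m" "x \<in> ball d (1 / Suc m)"
      using k(2)[of n m] by (auto simp: subset_iff)
    have "ball d (1 / Suc m) \<subseteq> ball x e"
    proof
      fix y assume "y \<in> ball d (1 / Suc m)"
      then have "dist x y < 1 / Suc m + 1 / Suc m"
        using d(2) dist_triangle[of x y d] by (simp add: dist_commute)
      then show "y \<in> ball x e" using m by simp
    qed
    moreover have "d \<in> D" using d(1) unfolding D_def by blast
    then have "ball d (1 / Suc m) \<in> B" unfolding B_def by blast
    ultimately show "\<exists>B'\<in>B. x \<in> B' \<and> B' \<subseteq> S"
      using d(2) e(2) by blast
  qed
  ultimately show "\<exists>B::('a \<Rightarrow>\<^sub>L 'b) set set. countable B \<and> open = generate_topology B"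
    using topological_basis_imp_subbasis by blast
qed

section \<open>Orthogonal projections\<close>

abbreviation proj :: "'a::euclidean_space set \<Rightarrow> 'a \<Rightarrow> 'a" where
  "proj E \<equiv> blinfun_apply (orth_proj E)"

lemma closest_point_eqI:
  fixes E :: "'a::euclidean_space set"
  assumes "subspace E" "y \<in> E" "x - y \<in> E\<^sup>\<bottom>"
  shows "closest_point E x = y"
proof -
  have "dist x y \<le> dist x z" if "z \<in> E" for z
  proof -
    have "y - z \<in> E" using assms that by (simp add: subspace_diff)
    then have "orthogonal (y - z) (x - y)"
      using assms(3) by (simp add: orthogonal_comp_def)
    then have "orthogonal (x - y) (y - z)"
      by (simp add: orthogonal_commute)
    from norm_add_Pythagorean[OF this] have "(norm (x - z))\<^sup>2 = (norm (x - y))\<^sup>2 + (norm (y - z))\<^sup>2" by simp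
    then show ?thesis
      by (simp add: dist_norm power2_le_imp_le)
  qed
  then show ?thesis
    using closest_point_unique[of E y x] assms
    by (metis closed_subspace subspace_imp_convex)
qed

lemma subspace_decomp:
  fixes E :: "'a::euclidean_space set"
  assumes "subspace E"
  obtains y where "y \<in> E" "x - y \<in> E\<^sup>\<bottom>"
proof -
  have "x \<in> E + E\<^sup>\<bottom>" using subspace_sum_orthogonal_comp[OF assms] by simp
  then show thesis using that by (elim set_plus_elim) auto
qed

lemma
  fixes E :: "'a::euclidean_space set"
  assumes "subspace E"
  shows closest_point_in: "closest_point E x \<in> E"
    and closest_point_diff: "x - closest_point E x \<in> E\<^sup>\<bottom>"
  using subspace_decomp[OF assms, of x] closest_point_eqI[OF assms] by metis+

lemma bounded_linear_closest_point:
  fixes E :: "'a::euclidean_space set"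
  assumes "subspace E"
  shows "bounded_linear (closest_point E)"
proof -
  note [simp] = closest_point_in[OF assms]
  have "closest_point E (x + y) = closest_point E x + closest_point E y" for x y
  proof (rule closest_point_eqI[OF assms])
    show "x + y - (closest_point E x + closest_point E y) \<in> E\<^sup>\<bottom>"
      using subspace_add[OF subspace_orthogonal_comp closest_point_diff[OF assms, of x] closest_point_diff[OF assms, of y]]
      by (simp add: algebra_simps)
  qed (simp add: assms subspace_add)
  moreover have "closest_point E (c *\<^sub>R x) = c *\<^sub>R closest_point E x" for c x
  proof (rule closest_point_eqI[OF assms])
    show "c *\<^sub>R x - c *\<^sub>R closest_point E x \<in> E\<^sup>\<bottom>"
      using subspace_scale[OF subspace_orthogonal_comp closest_point_diff[OF assms, of x]]
      by (simp add: algebra_simps)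
  qed (simp add: assms subspace_scale)
  ultimately have "linear (closest_point E)"
    by (rule linearI)
  then show ?thesis
    by (simp add: linear_conv_bounded_linear)
qed

lemma proj_closest_point: "subspace E \<Longrightarrow> proj E x = closest_point E x"
  by (simp add: orth_proj_def bounded_linear_Blinfun_apply bounded_linear_closest_point)

lemma
  assumes "subspace E"
  shows proj_in: "proj E x \<in> E" and proj_diff: "x - proj E x \<in> E\<^sup>\<bottom>"
  using assms by (simp_all add: proj_closest_point closest_point_in closest_point_diff)

text \<open>Explicit formulas for projections are verified by this criterion rather than by
  minimizing distances.\<close>

lemma proj_eqI: "subspace E \<Longrightarrow> y \<in> E \<Longrightarrow> x - y \<in> E\<^sup>\<bottom> \<Longrightarrow> proj E x = y"
  by (simp add: proj_closest_point closest_point_eqI)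

lemma orthogonal_compD: "x \<in> E\<^sup>\<bottom> \<Longrightarrow> y \<in> E \<Longrightarrow> x \<bullet> y = 0" "x \<in> E\<^sup>\<bottom> \<Longrightarrow> y \<in> E \<Longrightarrow> y \<bullet> x = 0"
  by (auto simp: orthogonal_comp_def orthogonal_def inner_commute)

lemma orthogonal_compI: "(\<And>y. y \<in> E \<Longrightarrow> x \<bullet> y = 0) \<Longrightarrow> x \<in> E\<^sup>\<bottom>"
  by (auto simp: orthogonal_comp_def orthogonal_def inner_commute)

lemma orthogonal_comp_swap: "E \<subseteq> F\<^sup>\<bottom> \<Longrightarrow> F \<subseteq> E\<^sup>\<bottom>"
  unfolding orthogonal_comp_def subset_eq mem_Collect_eq by (meson orthogonal_commute)

lemma proj_self: "subspace E \<Longrightarrow> x \<in> E \<Longrightarrow> proj E x = x"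
  by (rule proj_eqI) (auto simp: subspace_0 subspace_orthogonal_comp)

lemma proj_self_iff: "subspace E \<Longrightarrow> proj E x = x \<longleftrightarrow> x \<in> E"
  using proj_self proj_in by metis

lemma proj_perp: "subspace E \<Longrightarrow> x \<in> E\<^sup>\<bottom> \<Longrightarrow> proj E x = 0"
  by (rule proj_eqI) (auto simp: subspace_0)

lemma proj_comp: "subspace E \<Longrightarrow> proj (E\<^sup>\<bottom>) x = x - proj E x"
  by (rule proj_eqI) (auto simp: subspace_orthogonal_comp proj_diff orthogonal_comp_self proj_in)

lemma inner_proj: "subspace E \<Longrightarrow> proj E x \<bullet> y = proj E x \<bullet> proj E y"
  using orthogonal_compD(2)[OF proj_diff[of E y] proj_in[of E x]] by (simp add: inner_diff_right)

lemma inner_proj_commute: "subspace E \<Longrightarrow> proj E x \<bullet> y = x \<bullet> proj E y"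
  by (metis inner_commute inner_proj)

lemma norm_proj_Pythagorean:
  "subspace E \<Longrightarrow> (norm x)\<^sup>2 = (norm (proj E x))\<^sup>2 + (norm (x - proj E x))\<^sup>2"
  using norm_add_Pythagorean[of "proj E x" "x - proj E x"]
    orthogonal_compD(2)[OF proj_diff[of E x] proj_in[of E x]] by (simp add: orthogonal_def)

lemma norm_proj_le: "subspace E \<Longrightarrow> norm (proj E x) \<le> norm x"
  by (rule power2_le_imp_le) (simp_all add: norm_proj_Pythagorean[of E x])

lemma norm_diff_proj_le: "subspace E \<Longrightarrow> norm (x - proj E x) \<le> norm x"
  by (rule power2_le_imp_le) (simp_all add: norm_proj_Pythagorean[of E x])

lemma sum_Basis_inner_square: "(\<Sum>b\<in>Basis. (b \<bullet> x)\<^sup>2) = (norm (x::'a::euclidean_space))\<^sup>2"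
  unfolding power2_norm_eq_inner by (subst euclidean_inner) (simp add: power2_eq_square inner_commute)

lemma proj_basis:
  assumes "finite B" "pairwise orthogonal B" "\<And>x. x \<in> B \<Longrightarrow> norm x = 1" "span B = E"
  shows "proj E x = (\<Sum>e\<in>B. (x \<bullet> e) *\<^sub>R e)"
proof -
  have *: "\<forall>x\<in>B. \<forall>y\<in>B. x \<bullet> y = (if x=y then 1 else 0)"
    using assms norm_eq_1 by (auto simp: orthogonal_def pairwise_def)
  have sub: "subspace E" using assms(4) by auto
  show ?thesis
  proof (rule proj_eqI[OF sub])
    show "(\<Sum>e\<in>B. (x \<bullet> e) *\<^sub>R e) \<in> E"
      unfolding assms(4)[symmetric] by (intro span_sum span_mul span_base)
    show "x - (\<Sum>e\<in>B. (x \<bullet> e) *\<^sub>R e) \<in> E\<^sup>\<bottom>"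
    proof (rule orthogonal_compI)
      fix y assume "y \<in> E"
      then obtain u where u: "y = (\<Sum>b\<in>B. u b *\<^sub>R b)"
        using assms(4) span_finite[OF assms(1)] by auto
      have "(x - (\<Sum>e\<in>B. (x \<bullet> e) *\<^sub>R e)) \<bullet> b = 0" if "b \<in> B" for b
        using that assms(1) by (simp add: * inner_diff_left inner_sum_left if_distrib[of "(*)v" for v] cong: if_cong)
      then show "(x - (\<Sum>e\<in>B. (x \<bullet> e) *\<^sub>R e)) \<bullet> y = 0"
        by (simp add: u inner_sum_right)
    qed
  qed
qed

text \<open>Expand the projection in an orthonormal basis of \<open>E\<close> and apply Parseval to
  each basis vector. As a trace the dimension is linear in the projection: additive over orthogonal
  sums, Borel measurable, and prescribing its value is a closed condition on the operator.\<close>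

lemma trace_proj:
  fixes E :: "'a::euclidean_space set"
  assumes "subspace E"
  shows "(\<Sum>b\<in>Basis. proj E b \<bullet> b) = real (dim E)"
proof -
  obtain B where B: "pairwise orthogonal B" "\<And>x. x \<in> B \<Longrightarrow> norm x = 1"
    "independent B" "card B = dim E" "span B = E"
    using orthonormal_basis_subspace [OF assms] by metis
  then have fin: "finite B"
    by (simp add: indep_card_eq_dim_span)
  have "(\<Sum>b\<in>Basis. proj E b \<bullet> b) = (\<Sum>b\<in>Basis. \<Sum>e\<in>B. (b \<bullet> e)\<^sup>2)"
    by (simp add: proj_basis[OF fin B(1,2,5)] inner_sum_right power2_eq_square inner_commute)
  also have "\<dots> = (\<Sum>e\<in>B. (norm e)\<^sup>2)"
    by (subst sum.swap) (simp add: sum_Basis_inner_square)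
  finally show ?thesis using B by simp
qed

lemma dim_orthogonal_comp: "subspace (E :: 'a::euclidean_space set) \<Longrightarrow> dim (E\<^sup>\<bottom>) + dim E = DIM('a)"
proof -
  assume E: "subspace E"
  have "real (dim (E\<^sup>\<bottom>)) = real DIM('a) - real (dim E)"
    by (simp add: trace_proj[symmetric] E subspace_orthogonal_comp proj_comp inner_diff_left sum_subtractf norm_eq_1[symmetric])
  then show ?thesis by linarith
qed

text \<open>One Gram-Schmidt step. If \<open>a\<close> lies in \<open>E\<close>, then
  \<open>y = 0\<close> and division by zero makes the correction vanish, so a single formula,
  measurable in \<open>a\<close> and \<open>E\<close>, covers both cases.\<close>

lemma proj_span_insert:
  fixes a :: "'a::euclidean_space"
  assumes "subspace E"
  defines "y \<equiv> a - proj E a"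
  shows "proj (span (insert a E)) x = proj E x + ((x \<bullet> y) / (y \<bullet> y)) *\<^sub>R y"
proof (rule proj_eqI)
  have yE: "y \<in> E\<^sup>\<bottom>" by (simp add: y_def proj_diff assms)
  have ys: "y \<in> span (insert a E)"
    unfolding y_def using proj_in[OF assms(1), of a] by (intro span_diff span_base) auto
  show "proj E x + ((x \<bullet> y) / (y \<bullet> y)) *\<^sub>R y \<in> span (insert a E)"
    using proj_in[OF assms(1), of x] by (intro span_add span_mul ys span_base) auto
  show "x - (proj E x + ((x \<bullet> y) / (y \<bullet> y)) *\<^sub>R y) \<in> (span (insert a E))\<^sup>\<bottom>" (is "?d \<in> _")
  proof (rule orthogonal_compI)
    have dE: "?d \<bullet> e = 0" if "e \<in> E" for e
      using orthogonal_compD(1)[OF proj_diff[OF assms(1), of x] that] orthogonal_compD(1)[OF yE that]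
      by (simp add: inner_diff_left inner_add_left)
    have "y \<bullet> y = 0 \<Longrightarrow> x \<bullet> y = 0" by simp
    then have "?d \<bullet> y = 0"
      using orthogonal_compD(2)[OF yE proj_in[OF assms(1), of x]]
      by (simp add: inner_diff_left inner_add_left)
    then have "?d \<bullet> a = 0"
      using dE[OF proj_in[OF assms(1), of a]] by (simp add: y_def inner_diff_right)
    with dE have "insert a E \<subseteq> {e. ?d \<bullet> e = 0}" by auto
    moreover have "subspace {e. ?d \<bullet> e = 0}" by (rule subspace_hyperplane)
    ultimately show "?d \<bullet> z = 0" if "z \<in> span (insert a E)" for z
      using that span_minimal by blast
  qed
qed auto

subsection \<open>Orthogonal transformations\<close>

lemma orthogonal_transformation_image_comp:
  fixes T :: "'a::euclidean_space \<Rightarrow> 'a"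
  assumes T: "orthogonal_transformation T"
  shows "T ` (E\<^sup>\<bottom>) = (T ` E)\<^sup>\<bottom>"
proof
  show "T ` (E\<^sup>\<bottom>) \<subseteq> (T ` E)\<^sup>\<bottom>"
    using T by (auto simp: orthogonal_comp_def orthogonal_def orthogonal_transformation_def)
  show "(T ` E)\<^sup>\<bottom> \<subseteq> T ` (E\<^sup>\<bottom>)"
  proof
    fix x assume x: "x \<in> (T ` E)\<^sup>\<bottom>"
    obtain y where y: "x = T y" using surjD[OF orthogonal_transformation_surj[OF T], of x] by blast
    with x T have "y \<in> E\<^sup>\<bottom>"
      by (auto simp: orthogonal_comp_def orthogonal_def orthogonal_transformation_def)
    with y show "x \<in> T ` (E\<^sup>\<bottom>)" by simp
  qed
qed

lemma proj_image:
  fixes T :: "'a::euclidean_space \<Rightarrow> 'a"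
  assumes T: "orthogonal_transformation T" and E: "subspace E"
  shows "proj (T ` E) (T x) = T (proj E x)"
proof (rule proj_eqI)
  have lin: "linear T" using T by (simp add: orthogonal_transformation)
  show "subspace (T ` E)" by (simp add: lin E linear_subspace_image)
  show "T (proj E x) \<in> T ` E" by (simp add: proj_in E)
  have "T x - T (proj E x) = T (x - proj E x)" by (simp add: lin linear_diff)
  then show "T x - T (proj E x) \<in> (T ` E)\<^sup>\<bottom>"
    using proj_diff[OF E, of x] by (auto simp: orthogonal_transformation_image_comp[OF T, symmetric])
qed

text \<open>The projection onto the image is T P T^-1, and conjugation by an orthogonal map
  preserves the operator norm. So the orthogonal group acts on subspaces by isometries, which is how
  invariant measures acquire equal masses on balls of equal radius.\<close>

lemma dist_orth_proj_image:
  fixes T :: "'a::euclidean_space \<Rightarrow> 'a"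
  assumes T: "orthogonal_transformation T" and "subspace E" "subspace F"
  shows "dist (orth_proj (T ` E)) (orth_proj (T ` F)) = dist (orth_proj E) (orth_proj F)"
proof -
  have lin: "linear T" using T by (simp add: orthogonal_transformation)
  have eq: "norm ((orth_proj (T ` E) - orth_proj (T ` F)) (T x)) = norm ((orth_proj E - orth_proj F) x)" for x
  proof -
    have "(orth_proj (T ` E) - orth_proj (T ` F)) (T x) = T ((orth_proj E - orth_proj F) x)"
      by (simp add: minus_blinfun.rep_eq proj_image assms linear_diff[OF lin])
    then show ?thesis using T by (simp add: orthogonal_transformation_norm)
  qed
  have surj: "\<exists>y. x = T y" for x by (rule surjD[OF orthogonal_transformation_surj[OF T]])
  show ?thesis
    unfolding dist_norm
  proof (rule antisym)
    show "norm (orth_proj (T ` E) - orth_proj (T ` F)) \<le> norm (orth_proj E - orth_proj F)"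
    proof (rule norm_blinfun_bound)
      fix x obtain y where y: "x = T y" using surj by blast
      show "norm ((orth_proj (T ` E) - orth_proj (T ` F)) x) \<le> norm (orth_proj E - orth_proj F) * norm x"
        using norm_blinfun[of "orth_proj E - orth_proj F" y] T by (simp add: y eq orthogonal_transformation_norm)
    qed simp
    show "norm (orth_proj E - orth_proj F) \<le> norm (orth_proj (T ` E) - orth_proj (T ` F))"
    proof (rule norm_blinfun_bound)
      fix x
      show "norm ((orth_proj E - orth_proj F) x) \<le> norm (orth_proj (T ` E) - orth_proj (T ` F)) * norm x"
        using norm_blinfun[of "orth_proj (T ` E) - orth_proj (T ` F)" "T x"] T by (simp add: eq orthogonal_transformation_norm)
    qed simp
  qed
qed

text \<open>R^n is the orthogonal sum of \<xi>, \<eta> and a remainder \<open>W\<close>; the two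
  remainders have equal dimension, and isometries of the three summands are glued. With
  \<open>E\<^sup>\<bottom>\<close> in place of \<eta> and \<eta>' it moves \<xi> inside
  \<open>E\<close> by a map that preserves \<open>E\<close>.\<close>

lemma orthogonal_transformation_exists_pair:
  fixes \<xi> \<eta> \<xi>' \<eta>' :: "'a::euclidean_space set"
  assumes sub: "subspace \<xi>" "subspace \<eta>" "subspace \<xi>'" "subspace \<eta>'"
    and perp: "\<xi> \<subseteq> \<eta>\<^sup>\<bottom>" "\<xi>' \<subseteq> \<eta>'\<^sup>\<bottom>"
    and dims: "dim \<xi> = dim \<xi>'" "dim \<eta> = dim \<eta>'"
  obtains T where "orthogonal_transformation T" "T ` \<xi> = \<xi>'" "T ` \<eta> = \<eta>'"
proof -
  have key: "\<exists>W. subspace W \<and> W \<subseteq> \<xi>\<^sup>\<bottom> \<and> W \<subseteq> \<eta>\<^sup>\<bottom> \<and> (\<forall>x. x - proj \<xi> x - proj \<eta> x \<in> W) \<and> dim W + dim \<xi> + dim \<eta> = DIM('a)"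
    if "subspace \<xi>" "subspace \<eta>" "\<xi> \<subseteq> \<eta>\<^sup>\<bottom>" for \<xi> \<eta> :: "'a set"
  proof -
    note s = that(1,2)
    have perp2: "\<eta> \<subseteq> \<xi>\<^sup>\<bottom>" using that(3) by (rule orthogonal_comp_swap)
    let ?W = "\<xi>\<^sup>\<bottom> \<inter> \<eta>\<^sup>\<bottom>"
    have W: "subspace ?W" by (simp add: subspace_inter subspace_orthogonal_comp)
    have in1: "x - proj \<xi> x - proj \<eta> x \<in> ?W" for x
    proof
      show "x - proj \<xi> x - proj \<eta> x \<in> \<xi>\<^sup>\<bottom>"
        using proj_diff[OF s(1), of x] proj_in[OF s(2), of x] perp2 by (auto intro!: subspace_diff[OF subspace_orthogonal_comp])
      have "x - proj \<eta> x - proj \<xi> x \<in> \<eta>\<^sup>\<bottom>"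
        using proj_diff[OF s(2), of x] proj_in[OF s(1), of x] that(3) by (auto intro!: subspace_diff[OF subspace_orthogonal_comp])
      then show "x - proj \<xi> x - proj \<eta> x \<in> \<eta>\<^sup>\<bottom>" by (simp add: algebra_simps)
    qed
    \<comment> \<open>The formula for this projection is wanted for its trace, which gives the
      dimension of \<open>W\<close>.\<close>
    have pW: "proj ?W x = x - proj \<xi> x - proj \<eta> x" for x
    proof (rule proj_eqI[OF W in1])
      have "proj \<xi> x \<bullet> y = 0" "proj \<eta> x \<bullet> y = 0" if "y \<in> ?W" for y
        using that orthogonal_compD(2) proj_in[OF s(1), of x] proj_in[OF s(2), of x] by blast+
      then show "x - (x - proj \<xi> x - proj \<eta> x) \<in> ?W\<^sup>\<bottom>"
        by (intro orthogonal_compI) (auto simp: inner_add_left)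
    qed
    have "real (dim ?W) = real DIM('a) - real (dim \<xi>) - real (dim \<eta>)"
      by (simp add: trace_proj[symmetric] s W pW inner_diff_left sum_subtractf)
    then have "dim ?W + dim \<xi> + dim \<eta> = DIM('a)" by linarith
    with W in1 show ?thesis by blast
  qed
  obtain W where W: "subspace W" "W \<subseteq> \<xi>\<^sup>\<bottom>" "W \<subseteq> \<eta>\<^sup>\<bottom>" "\<And>x. x - proj \<xi> x - proj \<eta> x \<in> W" "dim W + dim \<xi> + dim \<eta> = DIM('a)"
    using key[OF sub(1,2) perp(1)] by blast
  obtain W' where W': "subspace W'" "W' \<subseteq> \<xi>'\<^sup>\<bottom>" "W' \<subseteq> \<eta>'\<^sup>\<bottom>" "dim W' + dim \<xi>' + dim \<eta>' = DIM('a)"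
    using key[OF sub(3,4) perp(2)] by blast
  obtain f1 where f1: "linear f1" "f1 ` \<xi> = \<xi>'" "\<And>x. x \<in> \<xi> \<Longrightarrow> norm (f1 x) = norm x"
    using isometry_subspaces[OF sub(1,3) dims(1)] by blast
  obtain f2 where f2: "linear f2" "f2 ` \<eta> = \<eta>'" "\<And>x. x \<in> \<eta> \<Longrightarrow> norm (f2 x) = norm x"
    using isometry_subspaces[OF sub(2,4) dims(2)] by blast
  have "dim W = dim W'" using W(5) W'(4) dims by linarith
  then obtain f3 where f3: "linear f3" "f3 ` W = W'" "\<And>x. x \<in> W \<Longrightarrow> norm (f3 x) = norm x"
    using isometry_subspaces[OF W(1) W'(1)] by blast
  define T where "T x = f1 (proj \<xi> x) + f2 (proj \<eta> x) + f3 (x - proj \<xi> x - proj \<eta> x)" for x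
  have lin: "linear T"
    by (rule linearI) (simp_all add: T_def blinfun.add_right blinfun.scaleR_right linear_add[OF f1(1)] linear_add[OF f2(1)]
      linear_add[OF f3(1)] linear_diff[OF f3(1)] linear_scale[OF f1(1)] linear_scale[OF f2(1)] linear_scale[OF f3(1)]
      linear_diff[OF f1(1)] linear_diff[OF f2(1)] algebra_simps)
  have nrm3: "(norm (a + b + c))\<^sup>2 = (norm a)\<^sup>2 + (norm b)\<^sup>2 + (norm c)\<^sup>2"
    if "a \<bullet> b = 0" "a \<bullet> c = 0" "b \<bullet> c = 0" for a b c :: 'a
    using that by (simp add: power2_norm_eq_inner inner_add_left inner_add_right inner_commute)
  have nT: "norm (T x) = norm x" for x
  proof -
    have m: "proj \<xi> x \<in> \<xi>" "proj \<eta> x \<in> \<eta>" "x - proj \<xi> x - proj \<eta> x \<in> W"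
      using W(4) by (auto simp: proj_in sub)
    have o: "proj \<xi> x \<bullet> proj \<eta> x = 0" "proj \<xi> x \<bullet> (x - proj \<xi> x - proj \<eta> x) = 0" "proj \<eta> x \<bullet> (x - proj \<xi> x - proj \<eta> x) = 0"
      using m perp(1) W(2,3) orthogonal_compD by blast+
    have m': "f1 (proj \<xi> x) \<in> \<xi>'" "f2 (proj \<eta> x) \<in> \<eta>'" "f3 (x - proj \<xi> x - proj \<eta> x) \<in> W'"
      using m f1 f2 f3 by auto
    have o': "f1 (proj \<xi> x) \<bullet> f2 (proj \<eta> x) = 0" "f1 (proj \<xi> x) \<bullet> f3 (x - proj \<xi> x - proj \<eta> x) = 0" 
      "f2 (proj \<eta> x) \<bullet> f3 (x - proj \<xi> x - proj \<eta> x) = 0"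
      using m' perp(2) W'(2,3) orthogonal_compD by blast+
    have "(norm (T x))\<^sup>2 = (norm (proj \<xi> x + proj \<eta> x + (x - proj \<xi> x - proj \<eta> x)))\<^sup>2"
      unfolding T_def using nrm3[OF o] nrm3[OF o'] f1(3)[OF m(1)] f2(3)[OF m(2)] f3(3)[OF m(3)] by simp
    then show ?thesis by simp
  qed
  have T: "orthogonal_transformation T"
    using lin nT by (simp add: orthogonal_transformation)
  have z: "f1 0 = 0" "f2 0 = 0" "f3 0 = 0" using f1 f2 f3 linear_0 by blast+
  have "T x = f1 x" if "x \<in> \<xi>" for x
  proof -
    have "proj \<eta> x = 0" by (rule proj_perp[OF sub(2)]) (use that perp in auto)
    then show ?thesis using that by (simp add: T_def proj_self sub z)
  qed
  then have 1: "T ` \<xi> = \<xi>'" using f1 by (metis image_cong)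
  have "T x = f2 x" if "x \<in> \<eta>" for x
  proof -
    have "proj \<xi> x = 0" 
      by (rule proj_perp[OF sub(1)]) (use that orthogonal_comp_swap[OF perp(1)] in auto)
    then show ?thesis using that by (simp add: T_def proj_self sub z)
  qed
  then have 2: "T ` \<eta> = \<eta>'" using f2 by (metis image_cong)
  show thesis using that T 1 2 by blast
qed

section \<open>Uniformly distributed measures\<close>

abbreviation vball :: "'b set \<Rightarrow> ('b \<Rightarrow> 'c::metric_space) \<Rightarrow> 'b \<Rightarrow> real \<Rightarrow> 'b set" where
  "vball Y \<phi> x r \<equiv> {z \<in> Y. dist (\<phi> z) (\<phi> x) \<le> r}"

text \<open>The differentiation argument of Christensen: \<open>N (ball x r \<inter> S) / N (ball x r)\<close> tends to \<open>1\<close> for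
  \<open>x\<close> in an open set \<open>S\<close>, so Fatou's lemma and Fubini's theorem compare \<open>M S\<close> with \<open>N S\<close>.\<close>

lemma uniformly_distributed_le:
  fixes \<phi> :: "'b \<Rightarrow> 'c::{metric_space, second_countable_topology}"
  assumes M: "sigma_finite_measure M" and N: "sigma_finite_measure N"
    and sets: "sets N = sets M" and \<phi>[measurable]: "\<phi> \<in> borel_measurable M"
    and X: "X \<in> sets M" "emeasure M (space M - X) = 0" "emeasure N (space M - X) = 0"
    and r: "\<And>m::nat. r m > 0" "r \<longlonglongrightarrow> 0"
    and Mb: "\<And>m x. x \<in> X \<Longrightarrow> emeasure M (vball (space M) \<phi> x (r m)) \<le> h m"
    and Nb: "\<And>m x. x \<in> X \<Longrightarrow> emeasure N (vball (space M) \<phi> x (r m)) = h m"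
    and h: "\<And>m. 0 < h m" "\<And>m. h m < \<infinity>"
    and S: "open S"
  shows "emeasure M (\<phi> -` S \<inter> space M) \<le> emeasure N (\<phi> -` S \<inter> space M)"
proof -
  interpret M: sigma_finite_measure M by fact
  interpret N: sigma_finite_measure N by fact
  interpret P: pair_sigma_finite M N ..
  have spN: "space N = space M" using sets by (rule sets_eq_imp_space_eq)
  have \<phi>N[measurable]: "\<phi> \<in> borel_measurable N" using \<phi> by (simp add: measurable_def spN sets)
  note X(1)[measurable]
  have XN[measurable]: "X \<in> sets N" using X(1) sets by simp
  have [measurable]: "S \<in> sets borel" using S by simp
  define U where "U = \<phi> -` S \<inter> space M \<inter> X"
  have "\<phi> -` S \<inter> space M \<in> sets M" by measurable
  then have U[measurable]: "U \<in> sets M" "U \<in> sets N"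
    unfolding U_def using X(1) sets by auto
  \<comment> \<open>The kernel of "distance at most \<open>r m\<close>", cut down to
    \<open>U\<close> in both variables. Integrated over z and divided by \<open>h m\<close> it is
    eventually at least 1 at each point of \<open>U\<close>; integrated over x first it is at most
    \<open>h m\<close> on \<open>U\<close> and 0 elsewhere.\<close>
  define k :: "nat \<Rightarrow> 'b \<Rightarrow> 'b \<Rightarrow> ennreal" where
    "k m x z = (if dist (\<phi> z) (\<phi> x) \<le> r m then 1 else 0) * indicator U x * indicator U z" for m x z
  have k[measurable]: "(\<lambda>(x, z). k m x z) \<in> borel_measurable (M \<Otimes>\<^sub>M N)" for m
    unfolding k_def by measurable
  have ball[measurable]: "{z \<in> space M. dist (\<phi> z) y \<le> t} \<in> sets M" "{z \<in> space M. dist (\<phi> z) y \<le> t} \<in> sets N" for y t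
    by (measurable, simp add: sets)
  have one: "indicator U x \<le> liminf (\<lambda>m. (\<integral>\<^sup>+ z. k m x z \<partial>N) / h m)" for x
  proof (cases "x \<in> U")
    case True
    then have "\<phi> x \<in> S" "x \<in> X" "x \<in> space M" by (auto simp: U_def)
    with S obtain e where e: "e > 0" "ball (\<phi> x) e \<subseteq> S" by (meson openE)
    have "eventually (\<lambda>m. r m < e) sequentially"
      using r(2) e(1) by (auto dest: order_tendstoD)
    \<comment> \<open>Once \<open>r m < e\<close>, the ball about \<open>x\<close> lies in
      \<open>U\<close> up to a null set, so nothing of its mass \<open>h m\<close> is cut
      off.\<close>
    then have "eventually (\<lambda>m. (\<integral>\<^sup>+ z. k m x z \<partial>N) / h m \<ge> 1) sequentially"
    proof eventually_elim
      case (elim m)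
      have "h m = emeasure N (vball (space M) \<phi> x (r m))"
        using Nb[OF \<open>x \<in> X\<close>] by simp
      also have "\<dots> = emeasure N ((vball (space M) \<phi> x (r m)) \<inter> X)"
      proof (rule emeasure_eq_AE)
        have "AE z in N. z \<notin> space M - X"
          using X(3) XN by (intro AE_not_in) (auto simp: null_sets_def spN[symmetric])
        then show "AE z in N. (z \<in> (vball (space M) \<phi> x (r m))) = (z \<in> (vball (space M) \<phi> x (r m)) \<inter> X)"
          by eventually_elim auto
      qed (use sets in auto)
      also have "\<dots> = (\<integral>\<^sup>+ z. indicator ((vball (space M) \<phi> x (r m)) \<inter> X) z \<partial>N)"
        by (subst nn_integral_indicator) auto
      also have "\<dots> \<le> (\<integral>\<^sup>+ z. k m x z \<partial>N)"
      proof (rule nn_integral_mono)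
        fix z assume "z \<in> space N"
        have "z \<in> U" if "dist (\<phi> z) (\<phi> x) \<le> r m" "z \<in> X" "z \<in> space M"
        proof -
          have "dist (\<phi> x) (\<phi> z) < e" using that elim by (simp add: dist_commute)
          then show ?thesis using that e(2) by (auto simp: U_def subset_iff)
        qed
        then show "indicator ((vball (space M) \<phi> x (r m)) \<inter> X) z \<le> k m x z"
          using True by (auto simp: k_def indicator_def)
      qed
      finally have "h m \<le> (\<integral>\<^sup>+ z. k m x z \<partial>N)" .
      then have "h m / h m \<le> (\<integral>\<^sup>+ z. k m x z \<partial>N) / h m"
        by (rule divide_right_mono_ennreal)
      moreover have "h m / h m = 1" using h[of m] by (intro ennreal_divide_self) auto
      ultimately show ?case by simp
    qed
    then have "1 \<le> liminf (\<lambda>m. (\<integral>\<^sup>+ z. k m x z \<partial>N) / h m)" by (rule Liminf_bounded)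
    then show ?thesis using True by simp
  qed simp
  have "emeasure M (\<phi> -` S \<inter> space M) = emeasure M U"
  proof (rule emeasure_eq_AE)
    have "AE z in M. z \<notin> space M - X"
      using X(1,2) by (intro AE_not_in) (auto simp: null_sets_def)
    then show "AE x in M. (x \<in> \<phi> -` S \<inter> space M) = (x \<in> U)"
      by eventually_elim (auto simp: U_def)
  qed auto
  also have "\<dots> = (\<integral>\<^sup>+ x. indicator U x \<partial>M)" by simp
  also have "\<dots> \<le> (\<integral>\<^sup>+ x. liminf (\<lambda>m. (\<integral>\<^sup>+ z. k m x z \<partial>N) / h m) \<partial>M)"
    by (intro nn_integral_mono one)
  also have "\<dots> \<le> liminf (\<lambda>m. \<integral>\<^sup>+ x. (\<integral>\<^sup>+ z. k m x z \<partial>N) / h m \<partial>M)"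
    by (intro nn_integral_liminf) measurable
  also have "\<dots> \<le> emeasure N U"
  proof -
    have le: "(\<integral>\<^sup>+ x. (\<integral>\<^sup>+ z. k m x z \<partial>N) / h m \<partial>M) \<le> emeasure N U" for m
    proof -
      have "(\<integral>\<^sup>+ x. (\<integral>\<^sup>+ z. k m x z \<partial>N) / h m \<partial>M) = (\<integral>\<^sup>+ x. (\<integral>\<^sup>+ z. k m x z \<partial>N) \<partial>M) / h m"
        by (rule nn_integral_divide) measurable
      also have "(\<integral>\<^sup>+ x. (\<integral>\<^sup>+ z. k m x z \<partial>N) \<partial>M) = (\<integral>\<^sup>+ z. (\<integral>\<^sup>+ x. k m x z \<partial>M) \<partial>N)"
        by (rule P.Fubini'[symmetric]) measurable
      also have "\<dots> \<le> (\<integral>\<^sup>+ z. h m * indicator U z \<partial>N)"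
      proof (rule nn_integral_mono)
        fix z assume "z \<in> space N"
        show "(\<integral>\<^sup>+ x. k m x z \<partial>M) \<le> h m * indicator U z"
        proof (cases "z \<in> U")
          case True
          have "(\<integral>\<^sup>+ x. k m x z \<partial>M) \<le> (\<integral>\<^sup>+ x. indicator (vball (space M) \<phi> z (r m)) x \<partial>M)"
            by (rule nn_integral_mono) (auto simp: k_def indicator_def dist_commute)
          also have "\<dots> = emeasure M (vball (space M) \<phi> z (r m))"
            by (rule nn_integral_indicator) simp
          also have "\<dots> \<le> h m" using Mb True by (auto simp: U_def)
          finally show ?thesis using True by simp
        qed (simp add: k_def)
      qed
      also have "\<dots> = h m * emeasure N U" by (simp add: nn_integral_cmult_indicator)
      also have "h m * emeasure N U / h m = emeasure N U"
        using h[of m] by (simp add: ennreal_mult_divide_eq mult.commute[of "h m"])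
      finally show ?thesis by (simp add: divide_right_mono_ennreal)
    qed
    have "liminf (\<lambda>m. \<integral>\<^sup>+ x. (\<integral>\<^sup>+ z. k m x z \<partial>N) / h m \<partial>M) \<le> liminf (\<lambda>m. emeasure N U)"
      by (intro Liminf_mono always_eventually allI le)
    then show ?thesis by (simp add: Liminf_const)
  qed
  also have "\<dots> \<le> emeasure N (\<phi> -` S \<inter> space M)"
    by (intro emeasure_mono) (auto simp: U_def sets)
  finally show ?thesis .
qed

lemma measure_eqI_open:
  fixes \<phi> :: "'b \<Rightarrow> 'c::{metric_space, second_countable_topology}"
  assumes sM: "sets M = sets (vimage_algebra Y \<phi> borel)" and sN: "sets N = sets M"
    and eq: "\<And>S. open S \<Longrightarrow> emeasure M (\<phi> -` S \<inter> Y) = emeasure N (\<phi> -` S \<inter> Y)"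
    and fin: "\<And>n::nat. open (C n)" "\<And>n. emeasure M (\<phi> -` C n \<inter> Y) \<noteq> \<infinity>" "(\<Union>n. C n) = UNIV"
  shows "M = N"
proof (rule measure_eqI_generator_eq[where E="{\<phi> -` S \<inter> Y | S. open S}" and \<Omega>=Y and A="\<lambda>n. \<phi> -` C n \<inter> Y"])
  show "Int_stable {\<phi> -` S \<inter> Y |S. open S}"
  proof (rule Int_stableI, clarsimp)
    fix S S' :: "'c set" assume "open S" "open S'"
    then show "\<exists>Sa. \<phi> -` S \<inter> Y \<inter> (\<phi> -` S' \<inter> Y) = \<phi> -` Sa \<inter> Y \<and> open Sa"
      by (intro exI[of _ "S \<inter> S'"]) auto
  qed
  have "sets (vimage_algebra Y \<phi> borel) = {\<phi> -` A \<inter> Y | A. A \<in> sigma_sets UNIV {S. open S}}"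
    by (subst sets_vimage_algebra2) (auto simp: borel_def)
  also have "\<dots> = sigma_sets Y {\<phi> -` S \<inter> Y | S. S \<in> {S. open S}}"
    by (rule sigma_sets_vimage_commute) auto
  finally have "sets (vimage_algebra Y \<phi> borel) = sigma_sets Y {\<phi> -` S \<inter> Y |S. open S}"
    by simp
  then show "sets M = sigma_sets Y {\<phi> -` S \<inter> Y |S. open S}" "sets N = sigma_sets Y {\<phi> -` S \<inter> Y |S. open S}"
    using sM sN by simp_all
  show "(\<Union>n. \<phi> -` C n \<inter> Y) = Y" using fin(3) by blast
qed (use eq fin(1,2) in auto)

text \<open>Here both measures have the same prescribed ball masses, so the comparison applies in
  both directions, and the total mass may be infinite. It identifies Lebesgue measures computed in
  different bases or after a rotation.\<close>

lemma uniformly_distributed_eqI: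
  fixes \<phi> :: "'b \<Rightarrow> 'c::{metric_space, second_countable_topology}"
  assumes sM: "sets M = sets (vimage_algebra Y \<phi> borel)" and sN: "sets N = sets M"
    and Mb: "\<And>x r. x \<in> Y \<Longrightarrow> r > 0 \<Longrightarrow> emeasure M (vball Y \<phi> x r) = h r"
    and Nb: "\<And>x r. x \<in> Y \<Longrightarrow> r > 0 \<Longrightarrow> emeasure N (vball Y \<phi> x r) = h r"
    and h: "\<And>r. r > 0 \<Longrightarrow> 0 < h r" "\<And>r. r > 0 \<Longrightarrow> h r < \<infinity>"
    and Y: "Y \<noteq> {}"
  shows "M = N"
proof -
  have sp: "space L = Y" if "sets L = sets M" for L using sets_eq_imp_space_eq[OF trans[OF that sM]] by simp
  have \<phi>: "\<phi> \<in> borel_measurable L" if "sets L = sets M" for L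
    using measurable_vimage_algebra1[of \<phi> Y borel] sM that by (simp add: measurable_def sp)
  obtain y where y: "y \<in> Y" using Y by blast
  define C where "C n = ball (\<phi> y) (real (Suc n))" for n
  have "\<exists>n. dist (\<phi> y) x < real (Suc n)" for x
    by (metis less_trans of_nat_less_iff lessI reals_Archimedean2)
  then have U: "(\<Union>n. C n) = UNIV" by (auto simp: C_def)
  have Cs: "\<phi> -` C n \<inter> Y \<in> sets L" if "sets L = sets M" for L n
    using measurable_sets[OF \<phi>[OF that], of "C n"] by (simp add: C_def sp[OF that])
  have Cf: "emeasure L (\<phi> -` C n \<inter> Y) \<noteq> \<infinity>"
    if L: "sets L = sets M" and b: "\<And>r. r > 0 \<Longrightarrow> emeasure L (vball Y \<phi> y r) = h r" for L n
  proof -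
    have "vball (space L) \<phi> y (real (Suc n)) \<in> sets L" using \<phi>[OF L] by measurable
    then have "emeasure L (\<phi> -` C n \<inter> Y) \<le> emeasure L (vball Y \<phi> y (real (Suc n)))"
      by (intro emeasure_mono) (auto simp: C_def dist_commute sp[OF L])
    also have "\<dots> < \<infinity>" by (subst b) (simp_all add: h(2)[simplified] del: of_nat_Suc)
    finally show ?thesis by simp
  qed
  have sf: "sigma_finite_measure L"
    if L: "sets L = sets M" and b: "\<And>r. r > 0 \<Longrightarrow> emeasure L (vball Y \<phi> y r) = h r" for L
  proof
    have "(\<Union>n. \<phi> -` C n \<inter> Y) = Y" using U by blast
    then show "\<exists>A. countable A \<and> A \<subseteq> sets L \<and> \<Union> A = space L \<and> (\<forall>a\<in>A. emeasure L a \<noteq> \<infinity>)"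
      using Cs[OF L] Cf[OF L b] by (intro exI[of _ "range (\<lambda>n. \<phi> -` C n \<inter> Y)"]) (auto simp: sp[OF L])
  qed
  have le: "emeasure A (\<phi> -` S \<inter> Y) \<le> emeasure B (\<phi> -` S \<inter> Y)"
    if A: "sets A = sets M" "\<And>x r. x \<in> Y \<Longrightarrow> r > 0 \<Longrightarrow> emeasure A (vball Y \<phi> x r) = h r"
      and B: "sets B = sets M" "\<And>x r. x \<in> Y \<Longrightarrow> r > 0 \<Longrightarrow> emeasure B (vball Y \<phi> x r) = h r"
      and S: "open S" for A B S
  proof -
    have "emeasure A (\<phi> -` S \<inter> space A) \<le> emeasure B (\<phi> -` S \<inter> space A)"
    proof (rule uniformly_distributed_le[where X=Y and r="\<lambda>m. 1 / real (Suc m)" and h="\<lambda>m. h (1 / real (Suc m))"])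
      show "(\<lambda>m. 1 / real (Suc m)) \<longlonglongrightarrow> 0" by (rule LIMSEQ_Suc[OF lim_1_over_n])
      show "Y \<in> sets A" using sets.top[of A] by (simp add: sp[OF A(1)])
      show "sigma_finite_measure A" "sigma_finite_measure B"
        by (rule sf[OF A(1)], erule A(2)[OF y], rule sf[OF B(1)], erule B(2)[OF y])
    qed (use that h \<phi>[OF A(1)] in \<open>simp_all add: sp[OF A(1)] del: of_nat_Suc\<close>)
    then show ?thesis by (simp add: sp[OF A(1)])
  qed
  show ?thesis
  proof (rule measure_eqI_open[OF sM sN _ _ _ U])
    show "open (C n)" "emeasure M (\<phi> -` C n \<inter> Y) \<noteq> \<infinity>" for n
      using Cf[OF refl Mb[OF y]] by (simp_all add: C_def)
    show "emeasure M (\<phi> -` S \<inter> Y) = emeasure N (\<phi> -` S \<inter> Y)" if "open S" for S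
      using le[OF refl Mb sN Nb that] le[OF sN Nb refl Mb that] by (rule antisym)
  qed
qed

text \<open>For equal finite total masses one inequality on open sets is enough: it passes to complements,
  hence to the closed sets exhausting an open set.\<close>

lemma open_le_imp_eq:
  fixes \<phi> :: "'b \<Rightarrow> 'c::metric_space"
  assumes M: "finite_measure M" and N: "finite_measure N"
    and sets: "sets N = sets M" and \<phi>[measurable]: "\<phi> \<in> borel_measurable M"
    and tot: "emeasure M (space M) = emeasure N (space M)"
    and le: "\<And>S. open S \<Longrightarrow> emeasure M (\<phi> -` S \<inter> space M) \<le> emeasure N (\<phi> -` S \<inter> space M)"
    and S: "open S"
  shows "emeasure M (\<phi> -` S \<inter> space M) = emeasure N (\<phi> -` S \<inter> space M)"
proof (rule antisym[OF le[OF S]])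
  interpret M: finite_measure M by fact
  interpret N: finite_measure N by fact
  have spN: "space N = space M" using sets by (rule sets_eq_imp_space_eq)
  have closed: "emeasure N (\<phi> -` C \<inter> space M) \<le> emeasure M (\<phi> -` C \<inter> space M)" if "closed C" for C
  proof -
    have [measurable]: "C \<in> sets borel" "- C \<in> sets borel" using that by auto
    have m: "\<phi> -` (-C) \<inter> space M \<in> sets M" "\<phi> -` C \<inter> space M \<in> sets M" by measurable
    have e: "\<phi> -` C \<inter> space M = space M - (\<phi> -` (-C) \<inter> space M)" by auto
    have "emeasure N (\<phi> -` C \<inter> space M) = emeasure N (space M) - emeasure N (\<phi> -` (-C) \<inter> space M)"
      using emeasure_compl[of "\<phi> -` (-C) \<inter> space M" N] m(1) unfolding e by (simp add: spN sets)
    also have "\<dots> \<le> emeasure M (space M) - emeasure M (\<phi> -` (-C) \<inter> space M)"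
      unfolding tot using le[of "-C"] that by (intro ennreal_minus_mono) auto
    also have "\<dots> = emeasure M (\<phi> -` C \<inter> space M)"
      using m(1) unfolding e by (intro emeasure_compl[symmetric]) auto
    finally show ?thesis .
  qed
  show "emeasure N (\<phi> -` S \<inter> space M) \<le> emeasure M (\<phi> -` S \<inter> space M)"
  \<comment> \<open>\<open>infdist\<close> to the empty set is 0, so for the full space the sets
    \<open>C n\<close> below would be empty.\<close>
  proof (cases "S = UNIV")
    case True then show ?thesis using tot by simp
  next
    case False
    define C where "C n = {x. infdist x (- S) \<ge> 1 / Suc n}" for n :: nat
    have C: "closed (C n)" for n
      unfolding C_def by (intro closed_Collect_le continuous_intros)
    have [measurable]: "C n \<in> sets borel" for n using C by simp
    have CS: "(\<Union>n. C n) = S"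
    proof
      show "(\<Union>n. C n) \<subseteq> S"
      proof
        fix x assume "x \<in> (\<Union>n. C n)"
        then obtain n where n: "infdist x (-S) \<ge> 1 / Suc n" by (auto simp: C_def)
        have "0 < 1 / real (Suc n)" by simp
        with n have "infdist x (-S) > 0" by (rule less_le_trans[rotated])
        then show "x \<in> S" by (metis ComplI infdist_zero less_irrefl)
      qed
      show "S \<subseteq> (\<Union>n. C n)"
      proof
        fix x assume x: "x \<in> S"
        have "infdist x (-S) > 0"
          using S x False by (intro infdist_pos_not_in_closed) auto
        then obtain n where "1 / real (Suc n) < infdist x (-S)" by (metis nat_approx_posE)
        then show "x \<in> (\<Union>n. C n)" unfolding C_def by (intro UN_I[of n]) auto
      qed
    qed
    have "emeasure N (\<phi> -` S \<inter> space M) = (SUP n. emeasure N (\<phi> -` C n \<inter> space M))"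
    proof -
      have inc: "incseq (\<lambda>n. \<phi> -` C n \<inter> space M)"
      proof (intro incseq_SucI subsetI)
        fix n x assume "x \<in> \<phi> -` C n \<inter> space M"
        moreover have "1 / real (Suc (Suc n)) \<le> 1 / real (Suc n)" by (simp add: frac_le)
        ultimately show "x \<in> \<phi> -` C (Suc n) \<inter> space M" unfolding C_def by auto
      qed
      have "range (\<lambda>n. \<phi> -` C n \<inter> space M) \<subseteq> sets N" unfolding sets by auto
      moreover have "(\<Union>n. \<phi> -` C n \<inter> space M) = \<phi> -` S \<inter> space M" using CS by blast
      ultimately show ?thesis using SUP_emeasure_incseq[of "\<lambda>n. \<phi> -` C n \<inter> space M" N] inc by simp
    qed
    also have "\<dots> \<le> emeasure M (\<phi> -` S \<inter> space M)"
    proof (rule SUP_least)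
      fix n
      have "emeasure N (\<phi> -` C n \<inter> space M) \<le> emeasure M (\<phi> -` C n \<inter> space M)" by (rule closed[OF C])
      also have "\<dots> \<le> emeasure M (\<phi> -` S \<inter> space M)"
        using CS S by (intro emeasure_mono) auto
      finally show "emeasure N (\<phi> -` C n \<inter> space M) \<le> emeasure M (\<phi> -` S \<inter> space M)" .
    qed
    finally show ?thesis .
  qed
qed

text \<open>The ball masses of \<open>M\<close> and of \<open>N\<close> are each constant over the
  centres but not related to each other. Along radii tending to 0 one of them is infinitely often at
  most the other; comparison along that subsequence and equality of the total masses give equality.
  The centres are restricted to a set \<open>X\<close> of full measure because orthogonal pairs of
  subspaces sit in the larger space of all pairs.\<close>

lemma uniformly_distributed_unique:
  fixes \<phi> :: "'b \<Rightarrow> 'c::{metric_space, second_countable_topology}"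
  assumes fM: "finite_measure M" and fN: "finite_measure N"
    and sM: "sets M = sets (vimage_algebra Y \<phi> borel)" and sN: "sets N = sets M"
    and tot: "emeasure M Y = emeasure N Y" "emeasure M Y \<noteq> 0"
    and X: "X \<in> sets M" "emeasure M (Y - X) = 0" "emeasure N (Y - X) = 0"
    and Mb: "\<And>r x y. x \<in> X \<Longrightarrow> y \<in> X \<Longrightarrow>
      emeasure M (vball Y \<phi> x r) = emeasure M (vball Y \<phi> y r)"
    and Nb: "\<And>r x y. x \<in> X \<Longrightarrow> y \<in> X \<Longrightarrow>
      emeasure N (vball Y \<phi> x r) = emeasure N (vball Y \<phi> y r)"
  shows "M = N"
proof -
  have spM: "space M = Y" using sets_eq_imp_space_eq[OF sM] by simp
  have spN: "space N = Y" using sets_eq_imp_space_eq[OF sN] spM by simp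
  have \<phi>M: "\<phi> \<in> borel_measurable M"
    using measurable_vimage_algebra1[of \<phi> Y borel] sM by (simp add: measurable_def spM)
  have ball_sets: "{z \<in> Y. dist (\<phi> z) x \<le> r} \<in> sets M" for x r
    using \<phi>M unfolding spM[symmetric] by measurable
  have XY: "X \<subseteq> Y" using sets.sets_into_space[OF X(1)] spM by simp
  have total: "emeasure L X = emeasure L Y"
    if "sets L = sets M" "emeasure L (Y - X) = 0" for L
  proof -
    have "emeasure L X + emeasure L (Y - X) = emeasure L (X \<union> (Y - X))"
      using X(1) that(1) spM by (intro plus_emeasure) auto
    moreover have "X \<union> (Y - X) = Y" using XY by auto
    ultimately show ?thesis using that(2) by simp
  qed
  \<comment> \<open>One null ball makes all balls of that radius about points of \<open>X\<close>
    null, and by Lindelof countably many of them cover \<open>X\<close>.\<close>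
  have pos: "emeasure L (vball Y \<phi> x r) > 0"
    if L: "sets L = sets M" "emeasure L (Y - X) = 0" "emeasure L Y \<noteq> 0"
      and b: "\<And>r x y. x \<in> X \<Longrightarrow> y \<in> X \<Longrightarrow>
        emeasure L (vball Y \<phi> x r) = emeasure L (vball Y \<phi> y r)"
      and "x \<in> X" "r > 0" for L x r
  proof (rule ccontr)
    assume "\<not> ?thesis"
    then have z: "emeasure L (vball Y \<phi> y r) = 0" if "y \<in> X" for y
      using b[OF that \<open>x \<in> X\<close>, of r] by simp
    obtain F where F: "F \<subseteq> (\<lambda>y. ball (\<phi> y) r) ` X" "countable F" "\<Union>F = (\<Union>y\<in>X. ball (\<phi> y) r)"
      by (rule Lindelof[of "(\<lambda>y. ball (\<phi> y) r) ` X"]) auto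
    have "(\<Union>B\<in>F. \<phi> -` B \<inter> Y) \<in> null_sets L"
    proof (rule null_sets_UN')
      fix B assume "B \<in> F"
      then obtain y where y: "y \<in> X" "B = ball (\<phi> y) r" using F(1) by auto
      have "\<phi> -` B \<inter> Y = {z \<in> space M. dist (\<phi> z) (\<phi> y) < r}" by (auto simp: y dist_commute spM)
      also have "\<dots> \<in> sets M" using \<phi>M by measurable
      finally have "\<phi> -` B \<inter> Y \<in> sets L" by (simp only: L(1))
      moreover have "\<phi> -` B \<inter> Y \<subseteq> vball Y \<phi> y r" by (auto simp: y dist_commute)
      moreover have "vball Y \<phi> y r \<in> null_sets L"
        using z[OF y(1)] ball_sets L(1) by (simp add: null_sets_def)
      ultimately show "\<phi> -` B \<inter> Y \<in> null_sets L" by (rule null_sets_subset[rotated])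
    qed fact
    moreover have "X \<subseteq> (\<Union>B\<in>F. \<phi> -` B \<inter> Y)"
    proof
      fix y assume "y \<in> X"
      moreover have "\<phi> y \<in> ball (\<phi> y) r" using \<open>r > 0\<close> by simp
      ultimately have "\<phi> y \<in> \<Union>F" unfolding F(3) by blast
      then show "y \<in> (\<Union>B\<in>F. \<phi> -` B \<inter> Y)" using \<open>y \<in> X\<close> XY by auto
    qed
    ultimately have "emeasure L X = 0"
      using emeasure_mono[of X "\<Union>B\<in>F. \<phi> -` B \<inter> Y" L] by (auto simp: null_sets_def)
    then show False using total[OF L(1,2)] L(3) by simp
  qed
  have "X \<noteq> {}" using total[OF refl X(2)] tot(2) by auto
  then obtain x0 where x0: "x0 \<in> X" by blast
  define r where "r m = 1 / real (Suc m)" for m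
  have r: "r m > 0" for m by (simp add: r_def)
  have r0: "r \<longlonglongrightarrow> 0" unfolding r_def by (rule LIMSEQ_Suc[OF lim_1_over_n])
  have main: "A = B"
    if A: "finite_measure A" "sets A = sets M" "emeasure A (Y - X) = 0" "emeasure A Y \<noteq> 0"
      and B: "finite_measure B" "sets B = sets M" "emeasure B (Y - X) = 0" "emeasure B Y = emeasure A Y"
      and Ab: "\<And>r x y. x \<in> X \<Longrightarrow> y \<in> X \<Longrightarrow>
        emeasure A (vball Y \<phi> x r) = emeasure A (vball Y \<phi> y r)"
      and Bb: "\<And>r x y. x \<in> X \<Longrightarrow> y \<in> X \<Longrightarrow>
        emeasure B (vball Y \<phi> x r) = emeasure B (vball Y \<phi> y r)"
      and inf: "infinite {m. emeasure A (vball Y \<phi> x0 (r m)) \<le> emeasure B (vball Y \<phi> x0 (r m))}"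
    for A B
  proof -
    interpret A: finite_measure A by fact
    interpret B: finite_measure B by fact
    have sp: "space A = Y" "space B = Y" using A(2) B(2) spM by (auto dest: sets_eq_imp_space_eq)
    have \<phi>A: "\<phi> \<in> borel_measurable A" using \<phi>M by (simp add: measurable_def sp spM A(2))
    obtain s :: "nat \<Rightarrow> nat" where s: "strict_mono s"
      "\<And>m. emeasure A (vball Y \<phi> x0 (r (s m))) \<le> emeasure B (vball Y \<phi> x0 (r (s m)))"
      using infinite_enumerate[OF inf] by auto
    have le: "emeasure A (\<phi> -` S \<inter> space A) \<le> emeasure B (\<phi> -` S \<inter> space A)" if "open S" for S
    proof (rule uniformly_distributed_le[where X=X and r="r \<circ> s" and h="\<lambda>m. emeasure B (vball Y \<phi> x0 (r (s m)))"])
      show "(r \<circ> s) \<longlonglongrightarrow> 0" using LIMSEQ_subseq_LIMSEQ[OF r0 s(1)] .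
      show "emeasure A (vball (space A) \<phi> x ((r \<circ> s) m)) \<le> emeasure B (vball Y \<phi> x0 (r (s m)))"
        if "x \<in> X" for m x
        using Ab[OF that x0] s(2)[of m] sp by simp
      show "emeasure B (vball (space A) \<phi> x ((r \<circ> s) m)) = emeasure B (vball Y \<phi> x0 (r (s m)))"
        if "x \<in> X" for m x
        using Bb[OF that x0] sp by simp
      show "0 < emeasure B (vball Y \<phi> x0 (r (s m)))" for m
        by (rule pos[OF B(2,3) _ Bb x0 r]) (use B(4) A(4) in auto)
      show "sigma_finite_measure A" "sigma_finite_measure B" by unfold_locales
    qed (use A B X \<phi>A that r sp in \<open>auto simp: less_top[symmetric]\<close>)
    have eq: "emeasure A (\<phi> -` S \<inter> space A) = emeasure B (\<phi> -` S \<inter> space A)" if "open S" for S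
      by (rule open_le_imp_eq[OF A(1) B(1) _ \<phi>A _ le that]) (use A B sp in auto)
    show "A = B"
      by (rule measure_eqI_open[where \<phi>=\<phi> and Y=Y and C="\<lambda>_. UNIV"]) (use A B sM eq sp in auto)
  qed
  let ?g = "\<lambda>L m. emeasure L (vball Y \<phi> x0 (r m))"
  have "{m. ?g M m \<le> ?g N m} \<union> {m. ?g N m \<le> ?g M m} = UNIV" by (auto simp: linear)
  then have "infinite ({m. ?g M m \<le> ?g N m} \<union> {m. ?g N m \<le> ?g M m})"
    using infinite_UNIV_nat by (simp only: not_False_eq_True)
  then have "infinite {m. ?g M m \<le> ?g N m} \<or> infinite {m. ?g N m \<le> ?g M m}"
    by (simp only: finite_Un de_Morgan_conj)
  then show ?thesis
  proof
    assume "infinite {m. ?g M m \<le> ?g N m}"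
    then show ?thesis
      by (intro main[OF fM refl X(2) tot(2) fN sN X(3) tot(1)[symmetric] Mb Nb])
  next
    assume "infinite {m. ?g N m \<le> ?g M m}"
    then have "N = M"
      using tot by (intro main[OF fN sN X(3) _ fM refl X(2) tot(1) Nb Mb]) auto
    then show ?thesis by simp
  qed
qed

section \<open>Lebesgue measure on subspaces\<close>

lemma
  fixes E :: "'a::real_normed_vector set"
  shows sets_restrict_space_cball: "{x \<in> E. norm x \<le> r} \<in> sets (restrict_space borel E)"
    and sets_restrict_space_vball: "vball E (\<lambda>x. x) a r \<in> sets (restrict_space borel E)"
proof -
  have "E \<inter> cball 0 r \<in> sets (restrict_space borel E)" "E \<inter> cball a r \<in> sets (restrict_space borel E)"
    unfolding sets_restrict_space by (intro imageI; simp)+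
  moreover have "E \<inter> cball 0 r = {x \<in> E. norm x \<le> r}" "E \<inter> cball a r = vball E (\<lambda>x. x) a r"
    by (simp_all add: set_eq_iff dist_commute)
  ultimately show "{x \<in> E. norm x \<le> r} \<in> sets (restrict_space borel E)"
    "vball E (\<lambda>x. x) a r \<in> sets (restrict_space borel E)" by simp_all
qed

definition orthonormal_basis :: "'a::euclidean_space set \<Rightarrow> 'a set \<Rightarrow> bool" where
  "orthonormal_basis B E \<longleftrightarrow> B \<subseteq> E \<and> span B = E \<and> pairwise orthogonal B \<and> (\<forall>b\<in>B. norm b = 1)"

text \<open>The measure inside \<open>subspace_lborel\<close> for a prescribed basis, so that its
  independence of the choice made by \<open>SOME\<close> can be stated.\<close>

definition basis_lborel :: "'a::euclidean_space set \<Rightarrow> 'a measure" where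
  "basis_lborel B = distr (\<Pi>\<^sub>M b\<in>B. lborel) (restrict_space borel (span B)) (\<lambda>c. \<Sum>b\<in>B. c b *\<^sub>R b)"

lemma orthonormal_basis_exists:
  assumes "subspace (E :: 'a::euclidean_space set)"
  obtains B where "orthonormal_basis B E"
  using orthonormal_basis_subspace[OF assms] unfolding orthonormal_basis_def by metis

lemma
  assumes "orthonormal_basis B (E :: 'a::euclidean_space set)"
  shows orthonormal_basis_finite: "finite B" and orthonormal_basis_card: "card B = dim E"
proof -
  have "0 \<notin> B" using assms by (auto simp: orthonormal_basis_def)
  then have i: "independent B"
    using assms pairwise_orthogonal_independent by (auto simp: orthonormal_basis_def)
  then show "finite B" by (rule independent_imp_finite)
  show "card B = dim E"
    using indep_card_eq_dim_span[OF i] assms by (auto simp: orthonormal_basis_def simp del: dim_span)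
qed

lemma norm_sum_orthonormal:
  assumes "finite B" "pairwise orthogonal B" "\<And>b. b \<in> B \<Longrightarrow> norm b = 1"
  shows "norm (\<Sum>b\<in>B. c b *\<^sub>R b) = sqrt (\<Sum>b\<in>B. (c b)\<^sup>2)"
proof -
  have "(norm (\<Sum>b\<in>B. c b *\<^sub>R b))\<^sup>2 = (\<Sum>b\<in>B. (norm (c b *\<^sub>R b))\<^sup>2)"
    by (rule norm_sum_Pythagorean[OF assms(1)])
       (use assms(2) in \<open>auto simp: pairwise_def orthogonal_clauses\<close>)
  also have "\<dots> = (\<Sum>b\<in>B. (c b)\<^sup>2)" using assms(3) by simp
  finally show ?thesis by (metis norm_ge_zero real_sqrt_unique)
qed

text \<open>Translation invariance in each coordinate, checked on boxes. It makes the mass of a ball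
  under \<open>basis_lborel\<close> independent of the centre.\<close>

lemma distr_PiM_lborel_translate:
  assumes "finite I"
  shows "distr (\<Pi>\<^sub>M i\<in>I. lborel) (\<Pi>\<^sub>M i\<in>I. lborel) (\<lambda>f. \<lambda>i\<in>I. a i + f i) = (\<Pi>\<^sub>M i\<in>I. (lborel :: real measure))"
proof -
  interpret product_sigma_finite "\<lambda>i. lborel :: real measure" ..
  have m[measurable]: "(\<lambda>f. \<lambda>i\<in>I. a i + f i) \<in> (\<Pi>\<^sub>M i\<in>I. lborel) \<rightarrow>\<^sub>M (\<Pi>\<^sub>M i\<in>I. (lborel :: real measure))"
    by measurable
  show ?thesis
  proof (rule PiM_eqI[OF assms])
    fix A assume A: "\<And>i. i \<in> I \<Longrightarrow> A i \<in> sets (lborel :: real measure)"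
    have t: "emeasure lborel ((+) (a i) -` A i) = emeasure lborel (A i)"
      and ts: "(+) (a i) -` A i \<in> sets lborel" if "i \<in> I" for i
    proof -
      have "emeasure lborel (A i) = emeasure (distr lborel borel ((+) (a i))) (A i)"
        by (simp add: lborel_distr_plus)
      also have "\<dots> = emeasure lborel ((+) (a i) -` A i)"
        using A[OF that] by (subst emeasure_distr) auto
      finally show "emeasure lborel ((+) (a i) -` A i) = emeasure lborel (A i)" ..
      have "(+) (a i) -` A i \<inter> space borel \<in> sets borel"
        by (rule measurable_sets[of _ _ borel]) (use A[OF that] in auto)
      then show "(+) (a i) -` A i \<in> sets lborel" by simp
    qed
    have "emeasure (distr (\<Pi>\<^sub>M i\<in>I. lborel) (\<Pi>\<^sub>M i\<in>I. lborel) (\<lambda>f. \<lambda>i\<in>I. a i + f i)) (Pi\<^sub>E I A)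
      = emeasure (\<Pi>\<^sub>M i\<in>I. lborel) ((\<lambda>f. \<lambda>i\<in>I. a i + f i) -` Pi\<^sub>E I A \<inter> space (\<Pi>\<^sub>M i\<in>I. (lborel::real measure)))"
      using A assms by (intro emeasure_distr m sets_PiM_I_finite) auto
    also have "(\<lambda>f. \<lambda>i\<in>I. a i + f i) -` Pi\<^sub>E I A \<inter> space (\<Pi>\<^sub>M i\<in>I. (lborel::real measure)) = Pi\<^sub>E I (\<lambda>i. (+) (a i) -` A i)"
      by (auto simp: space_PiM PiE_iff)
    also have "emeasure (\<Pi>\<^sub>M i\<in>I. lborel) \<dots> = (\<Prod>i\<in>I. emeasure lborel (A i))"
      using ts assms t by (simp add: emeasure_PiM)
    finally show "emeasure (distr (\<Pi>\<^sub>M i\<in>I. lborel) (\<Pi>\<^sub>M i\<in>I. lborel) (\<lambda>f. \<lambda>i\<in>I. a i + f i)) (Pi\<^sub>E I A) = \<dots>" .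
  qed simp
qed

context
  fixes B E :: "'a::euclidean_space set"
  assumes B: "orthonormal_basis B E"
begin

private lemma sp: "span B = E" using B by (simp add: orthonormal_basis_def)

lemma measurable_basis_sum[measurable]:
  "(\<lambda>c. \<Sum>b\<in>B. c b *\<^sub>R b) \<in> (\<Pi>\<^sub>M b\<in>B. lborel) \<rightarrow>\<^sub>M restrict_space borel E"
  unfolding sp[symmetric]
proof (rule measurable_restrict_space2)
  show "(\<lambda>c. \<Sum>b\<in>B. c b *\<^sub>R b) \<in> space (\<Pi>\<^sub>M b\<in>B. lborel) \<rightarrow> span B"
    by (intro Pi_I span_sum span_mul span_base)
qed measurable

lemma sets_basis_lborel: "sets (basis_lborel B) = sets (restrict_space borel E)"
  by (simp add: basis_lborel_def sp)

lemma space_basis_lborel: "space (basis_lborel B) = E"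
  by (simp add: basis_lborel_def sp space_restrict_space)

lemma nn_integral_basis_lborel:
  assumes "g \<in> borel_measurable (restrict_space borel E)"
  shows "(\<integral>\<^sup>+ x. g x \<partial>basis_lborel B) = (\<integral>\<^sup>+ c. g (\<Sum>b\<in>B. c b *\<^sub>R b) \<partial>(\<Pi>\<^sub>M b\<in>B. lborel))"
  unfolding basis_lborel_def sp by (rule nn_integral_distr) (use assms in measurable)

lemma emeasure_basis_lborel_cball:
  assumes "r > 0"
  shows "emeasure (basis_lborel B) {x \<in> E. norm x \<le> r} = ennreal (unit_ball_vol (dim E) * r ^ dim E)"
proof -
  have s: "{x \<in> E. norm x \<le> r} \<in> sets (restrict_space borel E)"
    by (rule sets_restrict_space_cball)
  have "emeasure (basis_lborel B) {x \<in> E. norm x \<le> r} =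
    emeasure (\<Pi>\<^sub>M b\<in>B. lborel) ((\<lambda>c. \<Sum>b\<in>B. c b *\<^sub>R b) -` {x \<in> E. norm x \<le> r} \<inter> space (\<Pi>\<^sub>M b\<in>B. lborel))"
    unfolding basis_lborel_def sp by (rule emeasure_distr[OF measurable_basis_sum s])
  also have "(\<lambda>c. \<Sum>b\<in>B. c b *\<^sub>R b) -` {x \<in> E. norm x \<le> r} = {f. sqrt (\<Sum>b\<in>B. (f b)\<^sup>2) \<le> r}"
  proof -
    have "(\<Sum>b\<in>B. c b *\<^sub>R b) \<in> E" for c unfolding sp[symmetric] by (intro span_sum span_mul span_base)
    moreover have "norm (\<Sum>b\<in>B. c b *\<^sub>R b) = sqrt (\<Sum>b\<in>B. (c b)\<^sup>2)" for c
      by (rule norm_sum_orthonormal) (use B orthonormal_basis_finite[OF B] in \<open>auto simp: orthonormal_basis_def\<close>)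
    ultimately show ?thesis by auto
  qed
  finally show ?thesis
    by (simp add: emeasure_cball_aux[OF orthonormal_basis_finite[OF B] assms] orthonormal_basis_card[OF B])
qed

lemma sigma_finite_basis_lborel: "sigma_finite_measure (basis_lborel B)"
proof
  let ?A = "range (\<lambda>n::nat. {x \<in> E. norm x \<le> real (Suc n)})"
  have "{x \<in> E. norm x \<le> r} \<in> sets (restrict_space borel E)" for r
    by (rule sets_restrict_space_cball)
  moreover have "(\<Union>n. {x \<in> E. norm x \<le> real (Suc n)}) = E"
  proof safe
    fix x assume "x \<in> E"
    obtain n where "norm x \<le> real n" using real_arch_simple by blast
    then show "x \<in> (\<Union>n. {x \<in> E. norm x \<le> real (Suc n)})"
      using \<open>x \<in> E\<close> by (intro UN_I[of n]) auto
  qed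
  ultimately show "\<exists>A. countable A \<and> A \<subseteq> sets (basis_lborel B) \<and> \<Union> A = space (basis_lborel B) \<and>
        (\<forall>a\<in>A. emeasure (basis_lborel B) a \<noteq> \<infinity>)"
    by (intro exI[of _ ?A]) (auto simp: sets_basis_lborel space_basis_lborel emeasure_basis_lborel_cball simp del: of_nat_Suc)
qed

lemma emeasure_basis_lborel_vball:
  assumes a: "a \<in> E"
  shows "emeasure (basis_lborel B) (vball E (\<lambda>x. x) a r) = emeasure (basis_lborel B) {x \<in> E. norm x \<le> r}"
proof -
  have s: "vball E (\<lambda>x. x) a r \<in> sets (restrict_space borel E)" for a
    by (rule sets_restrict_space_vball)
  have s0: "{x \<in> E. norm x \<le> r} \<in> sets (restrict_space borel E)" by (rule sets_restrict_space_cball)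
  have fin: "finite B" by (rule orthonormal_basis_finite[OF B])
  obtain u where u: "a = (\<Sum>b\<in>B. u b *\<^sub>R b)"
    using a sp span_finite[OF fin] by auto
  let ?S = "\<lambda>c. \<Sum>b\<in>B. c b *\<^sub>R b" and ?P = "\<Pi>\<^sub>M b\<in>B. (lborel :: real measure)"
  let ?t = "\<lambda>f. \<lambda>i\<in>B. u i + f i"
  have inE: "?S c \<in> E" for c unfolding sp[symmetric] by (intro span_sum span_mul span_base)
  have m: "?t \<in> ?P \<rightarrow>\<^sub>M ?P" by measurable
  have St: "?S (?t c) = a + ?S c" for c
    by (simp add: u algebra_simps sum.distrib)
  have mS: "?S -` (vball E (\<lambda>x. x) a r) \<inter> space ?P \<in> sets ?P"
    by (rule measurable_sets[OF measurable_basis_sum s])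
  have "emeasure (basis_lborel B) (vball E (\<lambda>x. x) a r) = emeasure ?P (?S -` (vball E (\<lambda>x. x) a r) \<inter> space ?P)"
    unfolding basis_lborel_def sp by (rule emeasure_distr[OF measurable_basis_sum s])
  also have "\<dots> = emeasure (distr ?P ?P ?t) (?S -` (vball E (\<lambda>x. x) a r) \<inter> space ?P)"
    by (simp add: distr_PiM_lborel_translate[OF fin])
  also have "\<dots> = emeasure ?P (?t -` (?S -` (vball E (\<lambda>x. x) a r) \<inter> space ?P) \<inter> space ?P)"
    by (rule emeasure_distr[OF m mS])
  also have "?t -` (?S -` (vball E (\<lambda>x. x) a r) \<inter> space ?P) \<inter> space ?P = ?S -` {x \<in> E. norm x \<le> r} \<inter> space ?P"
  proof (rule set_eqI)
    fix c
    have "c \<in> space ?P \<Longrightarrow> ?t c \<in> space ?P" by (rule measurable_space[OF m])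
    then show "c \<in> ?t -` (?S -` (vball E (\<lambda>x. x) a r) \<inter> space ?P) \<inter> space ?P \<longleftrightarrow> c \<in> ?S -` {x \<in> E. norm x \<le> r} \<inter> space ?P"
      using inE[of c] subspace_add[OF _ a inE[of c]] subspace_span[of B]
      unfolding vimage_eq Int_iff mem_Collect_eq St sp by (auto simp: dist_norm)
  qed
  also have "emeasure ?P \<dots> = emeasure (basis_lborel B) {x \<in> E. norm x \<le> r}"
    unfolding basis_lborel_def sp by (rule emeasure_distr[OF measurable_basis_sum s0, symmetric])
  finally show ?thesis .
qed

end

text \<open>In either basis every closed ball of radius r has the volume of a Euclidean ball of
  dimension \<open>dim E\<close>, and these masses determine the measure.\<close>

lemma basis_lborel_unique:
  assumes B: "orthonormal_basis B E" and B': "orthonormal_basis B' E"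
  shows "basis_lborel B = basis_lborel B'"
proof (rule uniformly_distributed_eqI[where Y=E and \<phi>="\<lambda>x. x" and h="\<lambda>r. ennreal (unit_ball_vol (dim E) * r ^ dim E)"])
  show "sets (basis_lborel B) = sets (vimage_algebra E (\<lambda>x. x) borel)"
    unfolding sets_basis_lborel[OF B] by (subst sets_vimage_algebra2) (auto simp: sets_restrict_space)
  show "E \<noteq> {}" using B by (auto simp: orthonormal_basis_def)
qed (simp_all only: sets_basis_lborel[OF B] sets_basis_lborel[OF B'] emeasure_basis_lborel_vball[OF B]
      emeasure_basis_lborel_vball[OF B'] emeasure_basis_lborel_cball[OF B] emeasure_basis_lborel_cball[OF B'], simp_all)

lemma subspace_lborel_eq:
  assumes "orthonormal_basis B E"
  shows "subspace_lborel E = basis_lborel B"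
proof -
  let ?B = "SOME B. B \<subseteq> E \<and> span B = E \<and> pairwise orthogonal B \<and> (\<forall>b\<in>B. norm b = 1)"
  have "orthonormal_basis ?B E"
    unfolding orthonormal_basis_def by (rule someI[of _ B]) (use assms in \<open>simp add: orthonormal_basis_def\<close>)
  then show ?thesis
    using basis_lborel_unique[OF _ assms, of ?B]
    by (simp add: subspace_lborel_def basis_lborel_def Let_def orthonormal_basis_def)
qed

lemma subspace_lborel_UNIV: "subspace_lborel UNIV = (lborel :: 'a::euclidean_space measure)"
proof -
  have "orthonormal_basis (Basis :: 'a set) UNIV"
    by (auto simp: orthonormal_basis_def pairwise_def orthogonal_def inner_Basis)
  then show ?thesis
    by (simp add: subspace_lborel_eq basis_lborel_def)
       (rule trans[OF distr_cong lborel_eq[symmetric]], auto simp: sets_restrict_space)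
qed

context
  fixes E :: "'a::euclidean_space set"
  assumes E: "subspace E"
begin

lemma sets_subspace_lborel[measurable_cong]: "sets (subspace_lborel E) = sets (restrict_space borel E)"
  using orthonormal_basis_exists[OF E] subspace_lborel_eq sets_basis_lborel by metis

lemma space_subspace_lborel: "space (subspace_lborel E) = E"
  using sets_eq_imp_space_eq[OF sets_subspace_lborel] by (simp add: space_restrict_space)

lemma sigma_finite_subspace_lborel: "sigma_finite_measure (subspace_lborel E)"
  using orthonormal_basis_exists[OF E] subspace_lborel_eq sigma_finite_basis_lborel by metis

lemma emeasure_subspace_lborel_cball:
  "r > 0 \<Longrightarrow> emeasure (subspace_lborel E) {x \<in> E. norm x \<le> r} = ennreal (unit_ball_vol (dim E) * r ^ dim E)"
  using orthonormal_basis_exists[OF E] subspace_lborel_eq emeasure_basis_lborel_cball by metis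

text \<open>Orthonormal bases of \<open>E\<close> and of its complement unite to one of R^n, and the
  product over the united index set splits by Fubini.\<close>

lemma nn_integral_lborel_decomp:
  assumes g[measurable]: "g \<in> borel_measurable borel"
  shows "(\<integral>\<^sup>+ x. g x \<partial>lborel) = (\<integral>\<^sup>+ u. \<integral>\<^sup>+ v. g (u + v) \<partial>subspace_lborel (E\<^sup>\<bottom>) \<partial>subspace_lborel E)"
proof -
  interpret product_sigma_finite "\<lambda>i::'a. lborel :: real measure" ..
  obtain B where B: "orthonormal_basis B E" using orthonormal_basis_exists[OF E] .
  obtain B' where B': "orthonormal_basis B' (E\<^sup>\<bottom>)" using orthonormal_basis_exists[OF subspace_orthogonal_comp] .
  interpret S': sigma_finite_measure "basis_lborel B'" by (rule sigma_finite_basis_lborel[OF B'])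
  note fin = orthonormal_basis_finite[OF B] orthonormal_basis_finite[OF B']
  have disj: "B \<inter> B' = {}"
  proof (rule ccontr)
    assume "B \<inter> B' \<noteq> {}"
    then obtain b where b: "b \<in> B" "b \<in> B'" by blast
    then have "b \<bullet> b = 0" using B B' orthogonal_compD(1)[of b E b] by (auto simp: orthonormal_basis_def)
    then have "b = 0" by simp
    then show False using b B by (auto simp: orthonormal_basis_def)
  qed
  have U: "orthonormal_basis (B \<union> B') UNIV"
    unfolding orthonormal_basis_def
  proof (intro conjI)
    show "span (B \<union> B') = UNIV"
    proof -
      have "x \<in> span (B \<union> B')" for x
      proof -
        have "proj E x \<in> span B" "x - proj E x \<in> span B'"
          using B B' proj_in[OF E] proj_diff[OF E] by (auto simp: orthonormal_basis_def)
        then have "proj E x + (x - proj E x) \<in> span (B \<union> B')"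
          by (intro span_add) (meson Un_upper1 Un_upper2 span_mono subsetD)+
        then show ?thesis by simp
      qed
      then show ?thesis by auto
    qed
    show "pairwise orthogonal (B \<union> B')"
      using B B' unfolding pairwise_def orthonormal_basis_def
      by (auto simp: orthogonal_def orthogonal_compD subset_iff)
  qed (use B B' in \<open>auto simp: orthonormal_basis_def\<close>)
  have g': "g \<in> borel_measurable (restrict_space borel UNIV)" by simp
  have "lborel = basis_lborel (B \<union> B')"
    using subspace_lborel_eq[OF U] subspace_lborel_UNIV by metis
  then have "(\<integral>\<^sup>+ x. g x \<partial>lborel) = (\<integral>\<^sup>+ x. g x \<partial>basis_lborel (B \<union> B'))"
    by simp
  also have "\<dots> = (\<integral>\<^sup>+ c. g (\<Sum>b\<in>B \<union> B'. c b *\<^sub>R b) \<partial>(\<Pi>\<^sub>M b\<in>B \<union> B'. lborel))"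
    by (rule nn_integral_basis_lborel[OF U g'])
  also have "\<dots> = (\<integral>\<^sup>+ x. \<integral>\<^sup>+ y. g (\<Sum>b\<in>B \<union> B'. merge B B' (x, y) b *\<^sub>R b) \<partial>(\<Pi>\<^sub>M b\<in>B'. lborel) \<partial>(\<Pi>\<^sub>M b\<in>B. lborel))"
    by (rule product_nn_integral_fold[OF disj fin]) measurable
  also have "\<dots> = (\<integral>\<^sup>+ x. \<integral>\<^sup>+ y. g ((\<Sum>b\<in>B. x b *\<^sub>R b) + (\<Sum>b\<in>B'. y b *\<^sub>R b)) \<partial>(\<Pi>\<^sub>M b\<in>B'. lborel) \<partial>(\<Pi>\<^sub>M b\<in>B. lborel))"
  proof -
    have "(\<Sum>b\<in>B \<union> B'. merge B B' (x, y) b *\<^sub>R b) = (\<Sum>b\<in>B. x b *\<^sub>R b) + (\<Sum>b\<in>B'. y b *\<^sub>R b)" for x y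
    proof -
      have "(\<Sum>b\<in>B'. merge B B' (x, y) b *\<^sub>R b) = (\<Sum>b\<in>B'. y b *\<^sub>R b)"
        by (intro sum.cong) (use disj in \<open>auto simp: merge_def\<close>)
      moreover have "(\<Sum>b\<in>B. merge B B' (x, y) b *\<^sub>R b) = (\<Sum>b\<in>B. x b *\<^sub>R b)"
        by (intro sum.cong) (auto simp: merge_def)
      ultimately show ?thesis by (simp add: sum.union_disjoint fin disj)
    qed
    then show ?thesis by simp
  qed
  also have "\<dots> = (\<integral>\<^sup>+ x. \<integral>\<^sup>+ v. g ((\<Sum>b\<in>B. x b *\<^sub>R b) + v) \<partial>basis_lborel B' \<partial>(\<Pi>\<^sub>M b\<in>B. lborel))"
    by (intro nn_integral_cong nn_integral_basis_lborel[OF B', symmetric] measurable_restrict_space1) measurable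
  also have "\<dots> = (\<integral>\<^sup>+ u. \<integral>\<^sup>+ v. g (u + v) \<partial>basis_lborel B' \<partial>basis_lborel B)"
  proof (rule nn_integral_basis_lborel[OF B, symmetric])
    have [measurable_cong]: "sets (basis_lborel B') = sets (restrict_space borel (E\<^sup>\<bottom>))"
      by (rule sets_basis_lborel[OF B'])
    have [measurable]: "(\<lambda>x. x) \<in> restrict_space borel E \<rightarrow>\<^sub>M (borel :: 'a measure)" "(\<lambda>x. x) \<in> restrict_space borel (E\<^sup>\<bottom>) \<rightarrow>\<^sub>M (borel :: 'a measure)"
      by (auto intro: measurable_restrict_space1)
    show "(\<lambda>u. \<integral>\<^sup>+ v. g (u + v) \<partial>basis_lborel B') \<in> borel_measurable (restrict_space borel E)"
      by measurable
  qed
  finally show ?thesis by (simp add: subspace_lborel_eq[OF B] subspace_lborel_eq[OF B'])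
qed

end

lemma measurable_proj[measurable]: "proj E \<in> borel_measurable borel"
  by (intro borel_measurable_continuous_onI linear_continuous_on blinfun.bounded_linear_right)

lemma measurable_proj_restrict:
  "subspace E \<Longrightarrow> proj E \<in> borel \<rightarrow>\<^sub>M restrict_space borel E"
  by (rule measurable_restrict_space2) (auto simp: proj_in)

text \<open>In this form the dependence on the subspace is measurable.\<close>

lemma nn_integral_subspace_lborel:
  fixes E :: "'a::euclidean_space set"
  assumes E: "subspace E" and g[measurable]: "g \<in> borel_measurable (restrict_space borel E)"
  shows "(\<integral>\<^sup>+ x. indicator (cball 0 1) (x - proj E x) * g (proj E x) \<partial>lborel) =
    ennreal (unit_ball_vol (DIM('a) - dim E)) * (\<integral>\<^sup>+ u. g u \<partial>subspace_lborel E)"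
proof -
  note [measurable] = measurable_proj_restrict[OF E]
  have [measurable]: "(\<lambda>x. g (proj E x)) \<in> borel_measurable borel" "cball (0::'a) 1 \<in> sets borel"
    by (auto intro: measurable_compose[OF measurable_proj_restrict[OF E] g])
  have d: "DIM('a) - dim E = dim (E\<^sup>\<bottom>)" using dim_orthogonal_comp[OF E] by simp
  have sE: "space (subspace_lborel E) = E" "space (subspace_lborel (E\<^sup>\<bottom>)) = E\<^sup>\<bottom>"
    by (simp_all add: space_subspace_lborel E subspace_orthogonal_comp)
  have [measurable_cong]: "sets (subspace_lborel E) = sets (restrict_space borel E)"
    by (rule sets_subspace_lborel[OF E])
  have c: "(\<integral>\<^sup>+ v. indicator (cball 0 1) v \<partial>subspace_lborel (E\<^sup>\<bottom>)) = ennreal (unit_ball_vol (DIM('a) - dim E))"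
  proof -
    have "(\<integral>\<^sup>+ v. indicator (cball 0 1) v \<partial>subspace_lborel (E\<^sup>\<bottom>)) = (\<integral>\<^sup>+ v. indicator {x \<in> E\<^sup>\<bottom>. norm x \<le> 1} v \<partial>subspace_lborel (E\<^sup>\<bottom>))"
      by (rule nn_integral_cong) (auto simp: sE indicator_def)
    also have "\<dots> = emeasure (subspace_lborel (E\<^sup>\<bottom>)) {x \<in> E\<^sup>\<bottom>. norm x \<le> 1}"
      by (rule nn_integral_indicator)
         (simp add: sets_subspace_lborel subspace_orthogonal_comp sets_restrict_space_cball)
    finally show ?thesis
      using emeasure_subspace_lborel_cball[OF subspace_orthogonal_comp[of E], of 1] by (simp add: d)
  qed
  have "(\<integral>\<^sup>+ x. indicator (cball 0 1) (x - proj E x) * g (proj E x) \<partial>lborel) =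
    (\<integral>\<^sup>+ u. \<integral>\<^sup>+ v. indicator (cball 0 1) (u + v - proj E (u + v)) * g (proj E (u + v)) \<partial>subspace_lborel (E\<^sup>\<bottom>) \<partial>subspace_lborel E)"
    by (rule nn_integral_lborel_decomp[OF E]) measurable
  also have "\<dots> = (\<integral>\<^sup>+ u. \<integral>\<^sup>+ v. g u * indicator (cball 0 1) v \<partial>subspace_lborel (E\<^sup>\<bottom>) \<partial>subspace_lborel E)"
    by (intro nn_integral_cong) (simp add: sE blinfun.add_right proj_self proj_perp E mult.commute)
  also have "\<dots> = (\<integral>\<^sup>+ u. g u * ennreal (unit_ball_vol (DIM('a) - dim E)) \<partial>subspace_lborel E)"
  proof (intro nn_integral_cong)
    fix u
    have [measurable_cong]: "sets (subspace_lborel (E\<^sup>\<bottom>)) = sets (restrict_space borel (E\<^sup>\<bottom>))"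
      by (rule sets_subspace_lborel[OF subspace_orthogonal_comp])
    have [measurable]: "(\<lambda>x. x) \<in> restrict_space borel (E\<^sup>\<bottom>) \<rightarrow>\<^sub>M (borel :: 'a measure)"
      by (auto intro: measurable_restrict_space1)
    have "indicator (cball 0 1) \<in> borel_measurable (subspace_lborel (E\<^sup>\<bottom>))"
      by (rule measurable_compose[of "\<lambda>x. x" _ borel, unfolded comp_def]) measurable
    then show "(\<integral>\<^sup>+ v. g u * indicator (cball 0 1) v \<partial>subspace_lborel (E\<^sup>\<bottom>)) = g u * ennreal (unit_ball_vol (DIM('a) - dim E))"
      by (simp add: nn_integral_cmult c)
  qed
  also have "\<dots> = ennreal (unit_ball_vol (DIM('a) - dim E)) * (\<integral>\<^sup>+ u. g u \<partial>subspace_lborel E)"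
    by (subst nn_integral_multc) (auto simp: mult.commute)
  finally show ?thesis .
qed

section \<open>The space of subspaces\<close>

text \<open>All dimensions together, so that adding a vector, taking complements and rotating are
  maps of one measurable space into itself; each Grassmannian is a measurable subset.\<close>

definition subspace_borel :: "'a::euclidean_space set measure" where
  "subspace_borel = vimage_algebra {\<xi>. subspace \<xi>} orth_proj borel"

lemma space_subspace_borel[simp]: "space subspace_borel = {\<xi>. subspace \<xi>}"
  by (simp add: subspace_borel_def)

lemma measurable_orth_proj[measurable]: "orth_proj \<in> borel_measurable subspace_borel"
  unfolding subspace_borel_def by (rule measurable_vimage_algebra1) simp

text \<open>An operator is the finite sum of the rank-one operators built from its values at basis
  vectors, and each summand depends linearly on that value.\<close>

lemma borel_measurable_blinfunI:
  fixes f :: "'b \<Rightarrow> 'a::euclidean_space \<Rightarrow>\<^sub>L 'c::euclidean_space"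
  assumes "\<And>b. b \<in> Basis \<Longrightarrow> (\<lambda>x. blinfun_apply (f x) b) \<in> borel_measurable N"
  shows "f \<in> borel_measurable N"
proof -
  have "f x = (\<Sum>b\<in>Basis. blinfun_scaleR_left (f x b) o\<^sub>L blinfun_inner_left b)" for x
  proof (rule blinfun_eqI)
    fix y :: 'a
    have "f x y = f x (\<Sum>b\<in>Basis. (y \<bullet> b) *\<^sub>R b)" by (simp add: euclidean_representation)
    also have "\<dots> = (\<Sum>b\<in>Basis. blinfun_scaleR_left (f x b) o\<^sub>L blinfun_inner_left b) y"
      by (simp add: blinfun.sum_right blinfun.sum_left blinfun.scaleR_right inner_commute)
    finally show "f x y = (\<Sum>b\<in>Basis. blinfun_scaleR_left (f x b) o\<^sub>L blinfun_inner_left b) y" .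
  qed
  moreover have "(\<lambda>x. \<Sum>b\<in>Basis. blinfun_scaleR_left (f x b) o\<^sub>L blinfun_inner_left b) \<in> borel_measurable N"
  proof (intro borel_measurable_sum)
    fix b :: 'a assume b: "b \<in> Basis"
    have "(\<lambda>y. blinfun_scaleR_left y o\<^sub>L blinfun_inner_left b) \<in> borel_measurable (borel :: 'c measure)"
      by (intro borel_measurable_continuous_onI linear_continuous_on
          bounded_linear_compose[OF bounded_bilinear.bounded_linear_left[OF bounded_bilinear_blinfun_compose]
            bounded_linear_blinfun_scaleR_left])
    from measurable_compose[OF assms[OF b] this]
    show "(\<lambda>x. blinfun_scaleR_left (f x b) o\<^sub>L blinfun_inner_left b) \<in> borel_measurable N" .
  qed
  ultimately show ?thesis by (simp cong: measurable_cong)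
qed

lemma measurable_subspace_borelI:
  assumes "\<And>x. x \<in> space N \<Longrightarrow> subspace (g x)"
    and "\<And>b. b \<in> Basis \<Longrightarrow> (\<lambda>x. proj (g x) b) \<in> borel_measurable N"
  shows "g \<in> N \<rightarrow>\<^sub>M subspace_borel"
  unfolding subspace_borel_def
  by (intro measurable_vimage_algebra2 borel_measurable_blinfunI assms) (use assms(1) in auto)

lemma measurable_proj2[measurable (raw)]:
  fixes f :: "'b \<Rightarrow> 'a::euclidean_space set"
  assumes [measurable]: "f \<in> N \<rightarrow>\<^sub>M subspace_borel" "g \<in> borel_measurable N"
  shows "(\<lambda>x. proj (f x) (g x)) \<in> borel_measurable N"
proof (rule borel_measurable_continuous_Pair[where H=blinfun_apply])
  show "(\<lambda>x. orth_proj (f x)) \<in> borel_measurable N" by measurable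
  show "continuous_on UNIV (\<lambda>x. blinfun_apply (fst x :: 'a \<Rightarrow>\<^sub>L 'a) (snd x))"
    by (intro continuous_intros)
qed fact

lemma measurable_subspaceD: "f \<in> N \<rightarrow>\<^sub>M subspace_borel \<Longrightarrow> x \<in> space N \<Longrightarrow> subspace (f x)"
  using measurable_space[of f N subspace_borel x] by simp

lemma measurable_span_insert[measurable (raw)]:
  fixes f :: "'b \<Rightarrow> 'a::euclidean_space set"
  assumes f[measurable]: "f \<in> N \<rightarrow>\<^sub>M subspace_borel" and [measurable]: "g \<in> borel_measurable N"
  shows "(\<lambda>x. span (insert (g x) (f x))) \<in> N \<rightarrow>\<^sub>M subspace_borel"
proof (rule measurable_subspace_borelI)
  fix b :: 'a
  have "(\<lambda>x. proj (span (insert (g x) (f x))) b) \<in> borel_measurable N \<longleftrightarrow>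
    (\<lambda>x. proj (f x) b + ((b \<bullet> (g x - proj (f x) (g x))) /
      ((g x - proj (f x) (g x)) \<bullet> (g x - proj (f x) (g x)))) *\<^sub>R (g x - proj (f x) (g x))) \<in> borel_measurable N"
    by (intro measurable_cong proj_span_insert measurable_subspaceD[OF f])
  also have "\<dots>" by measurable
  finally show "(\<lambda>x. proj (span (insert (g x) (f x))) b) \<in> borel_measurable N" .
qed auto

lemma measurable_orthogonal_comp[measurable (raw)]:
  fixes f :: "'b \<Rightarrow> 'a::euclidean_space set"
  assumes f[measurable]: "f \<in> N \<rightarrow>\<^sub>M subspace_borel"
  shows "(\<lambda>x. (f x)\<^sup>\<bottom>) \<in> N \<rightarrow>\<^sub>M subspace_borel"
proof (rule measurable_subspace_borelI)
  fix b :: 'a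
  have "(\<lambda>x. proj ((f x)\<^sup>\<bottom>) b) \<in> borel_measurable N \<longleftrightarrow> (\<lambda>x. b - proj (f x) b) \<in> borel_measurable N"
    by (intro measurable_cong proj_comp measurable_subspaceD[OF f])
  also have "\<dots>" by measurable
  finally show "(\<lambda>x. proj ((f x)\<^sup>\<bottom>) b) \<in> borel_measurable N" .
qed (rule subspace_orthogonal_comp)

lemma measurable_image_orthogonal:
  fixes T :: "'a::euclidean_space \<Rightarrow> 'a"
  assumes T: "orthogonal_transformation T"
  shows "(`) T \<in> subspace_borel \<rightarrow>\<^sub>M subspace_borel"
proof (rule measurable_subspace_borelI)
  have lin: "linear T" using T by (simp add: orthogonal_transformation)
  have [measurable]: "T \<in> borel_measurable borel"
    by (intro borel_measurable_continuous_onI linear_continuous_on) (simp add: lin linear_conv_bounded_linear[symmetric])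
  fix b :: 'a
  obtain c where c: "b = T c" using surjD[OF orthogonal_transformation_surj[OF T], of b] by blast
  have "(\<lambda>\<xi>. proj (T ` \<xi>) b) \<in> borel_measurable subspace_borel \<longleftrightarrow> (\<lambda>\<xi>. T (proj \<xi> c)) \<in> borel_measurable subspace_borel"
    unfolding c by (intro measurable_cong proj_image[OF T]) simp
  also have "\<dots>" by measurable
  finally show "(\<lambda>\<xi>. proj (T ` \<xi>) b) \<in> borel_measurable subspace_borel" .
  show "subspace (T ` x)" if "x \<in> space subspace_borel" for x
    using that lin linear_subspace_image by auto
qed

text \<open>The dimension is a trace, hence a measurable real; the floor only converts it to a
  natural number.\<close>

lemma measurable_dim[measurable]: "dim \<in> subspace_borel \<rightarrow>\<^sub>M count_space UNIV"
proof -
  have "(\<lambda>\<xi>. nat \<lfloor>\<Sum>b\<in>Basis. proj \<xi> b \<bullet> b\<rfloor>) \<in> subspace_borel \<rightarrow>\<^sub>M count_space UNIV"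
    by measurable
  moreover have "nat \<lfloor>\<Sum>b\<in>Basis. proj \<xi> b \<bullet> b\<rfloor> = dim \<xi>" if "\<xi> \<in> space subspace_borel" for \<xi> :: "'a set"
    using that by (simp add: trace_proj)
  ultimately show ?thesis by (subst measurable_cong[symmetric])
qed

text \<open>Inclusion means that projecting to \<xi> and then to \<open>E\<close> is the same as
  projecting to \<xi>. This is an identity of linear maps and therefore a finite conjunction of
  measurable conditions.\<close>

lemma subset_iff_proj:
  assumes "subspace \<xi>" "subspace E"
  shows "\<xi> \<subseteq> E \<longleftrightarrow> (\<forall>b\<in>Basis. proj E (proj \<xi> b) = proj \<xi> b)"
proof
  assume *: "\<forall>b\<in>Basis. proj E (proj \<xi> b) = proj \<xi> b"
  have "(orth_proj E o\<^sub>L orth_proj \<xi>) = orth_proj \<xi>"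
    by (rule blinfun_euclidean_eqI) (use * in \<open>simp add: blinfun_compose.rep_eq\<close>)
  then have "proj E (proj \<xi> x) = proj \<xi> x" for x by (metis blinfun_apply_blinfun_compose)
  then show "\<xi> \<subseteq> E" using assms by (metis proj_self_iff subsetI)
qed (use assms in \<open>auto intro!: proj_self intro: proj_in subsetD\<close>)

lemma measurable_subset_pred[measurable (raw)]:
  fixes f :: "'b \<Rightarrow> 'a::euclidean_space set"
  assumes f[measurable]: "f \<in> N \<rightarrow>\<^sub>M subspace_borel" and g[measurable]: "g \<in> N \<rightarrow>\<^sub>M subspace_borel"
  shows "Measurable.pred N (\<lambda>x. f x \<subseteq> g x)"
proof -
  have "Measurable.pred N (\<lambda>x. f x \<subseteq> g x) \<longleftrightarrow> Measurable.pred N (\<lambda>x. \<forall>b\<in>Basis. proj (g x) (proj (f x) b) = proj (f x) b)"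
    by (intro measurable_cong subset_iff_proj measurable_subspaceD[OF f] measurable_subspaceD[OF g])
  also have "\<dots>" by measurable
  finally show ?thesis .
qed

lemma grassmannian_in_sets[measurable]:
  assumes "subspace E"
  shows "grassmannian j E \<in> sets (subspace_borel :: 'a::euclidean_space set measure)"
proof -
  have [measurable]: "(\<lambda>_::'a set. E) \<in> subspace_borel \<rightarrow>\<^sub>M subspace_borel" using assms by simp
  have "{\<xi> \<in> space subspace_borel. \<xi> \<subseteq> E \<and> dim \<xi> = j} \<in> sets subspace_borel" by measurable
  moreover have "{\<xi> \<in> space subspace_borel. \<xi> \<subseteq> E \<and> dim \<xi> = j} = grassmannian j E"
    by (auto simp: grassmannian_def)
  ultimately show ?thesis by simp
qed

lemma sets_grassmannian_borel:
  "sets (grassmannian_borel j E) = sets (restrict_space subspace_borel (grassmannian j E))"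
proof -
  have "grassmannian j E \<subseteq> {\<xi>. subspace \<xi>}" by (auto simp: grassmannian_def)
  then have e: "grassmannian j E \<inter> (orth_proj -` A \<inter> {\<xi>. subspace \<xi>}) = orth_proj -` A \<inter> grassmannian j E" for A
    by auto
  have "sets (subspace_borel :: 'a set measure) = (\<lambda>A. orth_proj -` A \<inter> {\<xi>. subspace \<xi>}) ` sets borel"
    unfolding subspace_borel_def by (subst sets_vimage_algebra2) auto
  moreover have "sets (grassmannian_borel j E) = (\<lambda>A. orth_proj -` A \<inter> grassmannian j E) ` sets borel"
    unfolding grassmannian_borel_def by (subst sets_vimage_algebra2) auto
  ultimately show ?thesis
    by (simp only: sets_restrict_space image_image e)
qed

section \<open>Random subspaces\<close>

text \<open>An orthogonal map carries balls to balls of the same radius, and ball masses determine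
  the measure.\<close>

lemma distr_lborel_orthogonal:
  fixes T :: "'a::euclidean_space \<Rightarrow> 'a"
  assumes T: "orthogonal_transformation T"
  shows "distr lborel borel T = lborel"
proof (rule uniformly_distributed_eqI[where Y=UNIV and \<phi>="\<lambda>x. x" and h="\<lambda>r. ennreal (unit_ball_vol DIM('a) * r ^ DIM('a))"])
  have lin: "linear T" using T by (simp add: orthogonal_transformation)
  have Tm: "T \<in> borel_measurable borel"
    by (intro borel_measurable_continuous_onI linear_continuous_on) (simp add: lin linear_conv_bounded_linear[symmetric])
  have dT: "dist (T x) (T y) = dist x y" for x y
    using T by (simp add: dist_norm linear_diff[OF lin, symmetric] orthogonal_transformation_norm)
  have v: "vball UNIV (\<lambda>x. x) x r = cball x r" for x :: 'a and r by (auto simp: dist_commute)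
  show "sets (distr lborel borel T) = sets (vimage_algebra UNIV (\<lambda>x. x) borel)"
    by (subst sets_vimage_algebra2) auto
  fix x :: 'a and r :: real assume "r > 0"
  then show "emeasure lborel (vball UNIV (\<lambda>x. x) x r) = ennreal (unit_ball_vol DIM('a) * r ^ DIM('a))"
    unfolding v by (simp add: emeasure_cball)
  obtain y where y: "x = T y" using surjD[OF orthogonal_transformation_surj[OF T], of x] by blast
  have "T -` cball x r = cball y r" by (auto simp: y dT)
  then show "emeasure (distr lborel borel T) (vball UNIV (\<lambda>x. x) x r) = ennreal (unit_ball_vol DIM('a) * r ^ DIM('a))"
    unfolding v using Tm \<open>r > 0\<close> by (simp add: emeasure_distr emeasure_cball)
qed simp_all

text \<open>The source of random vectors: rotation invariant, of total mass 1, and absolutely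
  continuous, so that proper subspaces are null.\<close>

definition ball_measure :: "'a::euclidean_space measure" where
  "ball_measure = uniform_measure lborel (cball 0 1)"

lemma emeasure_unit_cball:
  "emeasure lborel (cball (0::'a::euclidean_space) 1) = ennreal (unit_ball_vol DIM('a))"
  by (simp add: emeasure_cball)

lemma prob_space_ball_measure: "prob_space (ball_measure :: 'a::euclidean_space measure)"
  unfolding ball_measure_def
  by (rule prob_space_uniform_measure) (auto simp: emeasure_unit_cball unit_ball_vol_pos less_imp_neq[OF unit_ball_vol_pos, symmetric] ennreal_eq_0_iff not_le)

lemma sets_ball_measure[simp, measurable_cong]: "sets ball_measure = sets borel"
  by (simp add: ball_measure_def)

lemma space_ball_measure[simp]: "space ball_measure = UNIV"
  by (simp add: ball_measure_def)

lemma nn_integral_ball_measure: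
  fixes g :: "'a::euclidean_space \<Rightarrow> ennreal"
  assumes "g \<in> borel_measurable borel"
  shows "(\<integral>\<^sup>+ x. g x \<partial>ball_measure) = (\<integral>\<^sup>+ x. g x * indicator (cball 0 1) x \<partial>lborel) / ennreal (unit_ball_vol DIM('a))"
  unfolding ball_measure_def
  by (subst nn_integral_uniform_measure) (use assms in \<open>simp_all add: emeasure_unit_cball\<close>)

lemma nn_integral_ball_measure_orthogonal:
  fixes g :: "'a::euclidean_space \<Rightarrow> ennreal" and T :: "'a \<Rightarrow> 'a"
  assumes T: "orthogonal_transformation T" and g[measurable]: "g \<in> borel_measurable borel"
  shows "(\<integral>\<^sup>+ x. g (T x) \<partial>ball_measure) = (\<integral>\<^sup>+ x. g x \<partial>ball_measure)"
proof -
  have lin: "linear T" using T by (simp add: orthogonal_transformation)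
  have Tm[measurable]: "T \<in> borel_measurable borel" "cball (0::'a) 1 \<in> sets borel"
    by (intro borel_measurable_continuous_onI linear_continuous_on) (simp_all add: lin linear_conv_bounded_linear[symmetric])
  have "(\<integral>\<^sup>+ x. g x * indicator (cball 0 1) x \<partial>lborel) = (\<integral>\<^sup>+ x. g x * indicator (cball 0 1) x \<partial>distr lborel borel T)"
    by (simp add: distr_lborel_orthogonal[OF T])
  also have "\<dots> = (\<integral>\<^sup>+ x. g (T x) * indicator (cball 0 1) (T x) \<partial>lborel)"
    by (rule nn_integral_distr) measurable
  also have "\<dots> = (\<integral>\<^sup>+ x. g (T x) * indicator (cball 0 1) x \<partial>lborel)"
    using T by (simp add: indicator_def orthogonal_transformation_norm)
  finally show ?thesis by (simp add: nn_integral_ball_measure)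
qed

text \<open>A step may fail to raise the dimension, but as long as \<open>j < dim E\<close> only with probability \<open>0\<close>.\<close>

primrec random_subspace :: "nat \<Rightarrow> 'a::euclidean_space set \<Rightarrow> 'a set measure" where
  "random_subspace 0 E = return subspace_borel {0}"
| "random_subspace (Suc j) E =
     bind (random_subspace j E) (\<lambda>\<xi>. distr ball_measure subspace_borel (\<lambda>x. span (insert (proj E x) \<xi>)))"

lemma ball_measure_in_subprob[measurable]: "ball_measure \<in> space (subprob_algebra borel)"
  by (simp add: space_subprob_algebra prob_space_imp_subprob_space prob_space_ball_measure)

lemma measurable_random_subspace_step:
  "(\<lambda>(E, \<xi>). distr ball_measure subspace_borel (\<lambda>x. span (insert (proj E x) \<xi>)))
    \<in> subspace_borel \<Otimes>\<^sub>M subspace_borel \<rightarrow>\<^sub>M subprob_algebra (subspace_borel :: 'a::euclidean_space set measure)"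
proof -
  have "(\<lambda>p. distr ball_measure subspace_borel ((\<lambda>p x. span (insert (proj (fst p) x) (snd p))) p))
    \<in> subspace_borel \<Otimes>\<^sub>M subspace_borel \<rightarrow>\<^sub>M subprob_algebra (subspace_borel :: 'a::euclidean_space set measure)"
    by (rule measurable_distr2[where M=borel]) (measurable; simp)+
  then show ?thesis by (simp add: case_prod_beta')
qed

text \<open>\<open>E\<close> must be a variable here: a random pair draws \<xi> in the complement of
  a random \<eta>, and \<open>bind\<close> asks for a measurable kernel.\<close>

lemma measurable_random_subspace[measurable]:
  "random_subspace j \<in> subspace_borel \<rightarrow>\<^sub>M subprob_algebra (subspace_borel :: 'a::euclidean_space set measure)"
proof (induction j)
  case 0
  have "subspace {0::'a}" by simp
  then show ?case
    by (simp add: space_subprob_algebra prob_space_imp_subprob_space prob_space_return)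
next
  case (Suc j)
  note [measurable] = Suc
  show ?case
    unfolding random_subspace.simps
    by (rule measurable_bind[OF Suc]) (use measurable_random_subspace_step in \<open>simp add: case_prod_beta'\<close>)
qed

lemma measurable_random_subspace_step1:
  assumes "subspace E"
  shows "(\<lambda>\<xi>. distr ball_measure subspace_borel (\<lambda>x. span (insert (proj E x) \<xi>)))
    \<in> subspace_borel \<rightarrow>\<^sub>M subprob_algebra (subspace_borel :: 'a::euclidean_space set measure)"
  using measurable_Pair2[OF measurable_random_subspace_step, of E] assms by simp

lemma prob_space_random_subspace:
  assumes E: "subspace (E::'a::euclidean_space set)"
  shows "prob_space (random_subspace j E)"
proof (induction j)
  case 0 show ?case by (simp add: prob_space_return)
next
  case (Suc j)
  interpret prob_space "random_subspace j E" by fact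
  show ?case
    unfolding random_subspace.simps
  proof (rule prob_space_bind)
    show "AE \<xi> in random_subspace j E. prob_space (distr ball_measure subspace_borel (\<lambda>x. span (insert (proj E x) \<xi>)))"
    proof (rule AE_I2)
      fix \<xi> assume "\<xi> \<in> space (random_subspace j E)"
      then have "subspace \<xi>"
        using subprob_measurableD(1)[OF measurable_random_subspace, of E j] E by simp
      then show "prob_space (distr ball_measure subspace_borel (\<lambda>x. span (insert (proj E x) \<xi>)))"
        by (intro prob_space.prob_space_distr[OF prob_space_ball_measure] measurable_span_insert) (auto simp: ball_measure_def)
    qed
    show "(\<lambda>\<xi>. distr ball_measure subspace_borel (\<lambda>x. span (insert (proj E x) \<xi>)))
        \<in> random_subspace j E \<rightarrow>\<^sub>M subprob_algebra subspace_borel"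
      using measurable_random_subspace_step1[OF E] subprob_measurableD(2)[OF measurable_random_subspace, of E j] E
      by (simp cong: measurable_cong_sets)
  qed
qed

context
  fixes E :: "'a::euclidean_space set"
  assumes E: "subspace E"
begin

lemma sets_random_subspace[measurable_cong]: "sets (random_subspace j E) = sets subspace_borel"
  using subprob_measurableD(2)[OF measurable_random_subspace, of E j] E by simp

lemma space_random_subspace: "space (random_subspace j E) = {\<xi>. subspace \<xi>}"
  using sets_eq_imp_space_eq[OF sets_random_subspace] by simp

lemma measurable_insert_proj:
  assumes "subspace \<xi>"
  shows "(\<lambda>x. span (insert (proj E x) \<xi>)) \<in> borel \<rightarrow>\<^sub>M subspace_borel"
  by (rule measurable_span_insert) (use assms in auto)

lemma nn_integral_random_subspace_Suc:
  assumes F[measurable]: "F \<in> borel_measurable subspace_borel"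
  shows "(\<integral>\<^sup>+ \<xi>. F \<xi> \<partial>random_subspace (Suc j) E) =
    (\<integral>\<^sup>+ \<xi>. \<integral>\<^sup>+ x. F (span (insert (proj E x) \<xi>)) \<partial>ball_measure \<partial>random_subspace j E)"
proof -
  have "(\<integral>\<^sup>+ \<xi>. F \<xi> \<partial>random_subspace (Suc j) E) =
    (\<integral>\<^sup>+ \<xi>. \<integral>\<^sup>+ \<zeta>. F \<zeta> \<partial>distr ball_measure subspace_borel (\<lambda>x. span (insert (proj E x) \<xi>)) \<partial>random_subspace j E)"
    unfolding random_subspace.simps
    by (rule nn_integral_bind[OF F]) (simp add: measurable_random_subspace_step1 E sets_random_subspace cong: measurable_cong_sets)
  also have "\<dots> = (\<integral>\<^sup>+ \<xi>. \<integral>\<^sup>+ x. F (span (insert (proj E x) \<xi>)) \<partial>ball_measure \<partial>random_subspace j E)"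
    by (intro nn_integral_cong nn_integral_distr)
       (auto simp: space_random_subspace measurable_insert_proj cong: measurable_cong_sets)
  finally show ?thesis .
qed

text \<open>If \<xi> has dimension \<open>j < dim E\<close>, the vectors whose projection to
  \<open>E\<close> falls into \<xi> form a proper subspace of R^n, a null set; so almost surely each
  step raises the dimension by one.\<close>

lemma AE_random_subspace_grassmannian:
  "j \<le> dim E \<Longrightarrow> AE \<xi> in random_subspace j E. \<xi> \<in> grassmannian j E"
proof (induction j)
  case 0
  have "{0} \<in> grassmannian 0 E" using E by (auto simp: grassmannian_def subspace_0)
  moreover have "Measurable.pred subspace_borel (\<lambda>\<xi>. \<xi> \<in> grassmannian 0 E)"
    using grassmannian_in_sets[OF E] by (rule pred_sets2) simp
  ultimately show ?case unfolding random_subspace.simps by (subst AE_return) auto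
next
  case (Suc j)
  let ?N = "\<lambda>i. {\<xi>. subspace \<xi>} - grassmannian i E"
  have [measurable]: "?N i \<in> sets subspace_borel" for i
    using sets.compl_sets[OF grassmannian_in_sets[OF E], of i] by simp
  have IH: "AE \<xi> in random_subspace j E. \<xi> \<in> grassmannian j E" using Suc by simp
  have "(\<integral>\<^sup>+ \<xi>. indicator (?N (Suc j)) \<xi> \<partial>random_subspace (Suc j) E) =
    (\<integral>\<^sup>+ \<xi>. \<integral>\<^sup>+ x. indicator (?N (Suc j)) (span (insert (proj E x) \<xi>)) \<partial>ball_measure \<partial>random_subspace j E)"
    by (rule nn_integral_random_subspace_Suc) measurable
  also have "\<dots> = (\<integral>\<^sup>+ \<xi>. 0 \<partial>random_subspace j E)"
  proof (rule nn_integral_cong_AE, use IH in eventually_elim)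
    fix \<xi> assume "\<xi> \<in> grassmannian j E"
    then have \<xi>: "subspace \<xi>" "\<xi> \<subseteq> E" "dim \<xi> = j" by (auto simp: grassmannian_def)
    have neg: "AE x in ball_measure. proj E x \<notin> \<xi>"
    proof -
      let ?V = "{x. proj E x \<in> \<xi>}"
      have V: "subspace ?V"
        using \<xi>(1) by (auto simp: subspace_def blinfun.add_right blinfun.scaleR_right)
      have "?V \<noteq> UNIV"
      proof
        assume "?V = UNIV"
        then have "E \<subseteq> \<xi>" using proj_self[OF E] by (metis UNIV_I mem_Collect_eq subsetI)
        then show False using dim_subset[of E \<xi>] \<xi>(3) Suc.prems by simp
      qed
      then have "dim ?V < DIM('a)"
        using V by (metis dim_eq_full dim_subset_UNIV le_neq_implies_less span_eq_iff)
      then have "negligible ?V" by (rule negligible_lowdim)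
      moreover have "?V \<in> sets lborel"
        using V by (simp add: closed_subspace borel_closed)
      ultimately have "?V \<in> null_sets lborel"
        by (simp add: negligible_iff_null_sets null_sets_completion_iff)
      then have "AE x in lborel. x \<notin> ?V" by (rule AE_not_in)
      then show ?thesis
        unfolding ball_measure_def by (intro AE_uniform_measureI) auto
    qed
    show "(\<integral>\<^sup>+ x. indicator (?N (Suc j)) (span (insert (proj E x) \<xi>)) \<partial>ball_measure) = (0::ennreal)"
    proof (subst nn_integral_0_iff_AE)
      show "(\<lambda>x. indicator (?N (Suc j)) (span (insert (proj E x) \<xi>)) :: ennreal) \<in> borel_measurable ball_measure"
        using measurable_compose[OF measurable_insert_proj[OF \<xi>(1)] borel_measurable_indicator[of "?N (Suc j)"]]
        by (simp cong: measurable_cong_sets)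
      show "AE x in ball_measure. indicator (?N (Suc j)) (span (insert (proj E x) \<xi>)) = (0::ennreal)"
        using neg
      proof eventually_elim
        fix x assume x: "proj E x \<notin> \<xi>"
        have "span (insert (proj E x) \<xi>) \<subseteq> E"
          using \<xi>(2) proj_in[OF E, of x] by (intro span_minimal E) auto
        moreover have "dim (span (insert (proj E x) \<xi>)) = Suc j"
          using x \<xi> by (metis dim_insert dim_span span_eq_iff Suc_eq_plus1)
        ultimately have "span (insert (proj E x) \<xi>) \<in> grassmannian (Suc j) E"
          by (simp add: grassmannian_def)
        then show "indicator (?N (Suc j)) (span (insert (proj E x) \<xi>)) = (0::ennreal)" by simp
      qed
    qed
  qed
  finally have "emeasure (random_subspace (Suc j) E) (?N (Suc j)) = 0"
    by (subst (asm) nn_integral_indicator) (simp_all add: sets_random_subspace del: random_subspace.simps)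
  then have "?N (Suc j) \<in> null_sets (random_subspace (Suc j) E)"
    by (simp add: null_sets_def sets_random_subspace del: random_subspace.simps)
  then have "AE \<xi> in random_subspace (Suc j) E. \<xi> \<notin> ?N (Suc j)" by (rule AE_not_in)
  with AE_space show ?case
    by eventually_elim (auto simp: space_random_subspace simp del: random_subspace.simps)
qed

end

text \<open>Equivariance under all orthogonal maps, also those that move \<open>E\<close>; for maps
  that preserve \<open>E\<close> it is invariance. In the induction the new vector is rotated along,
  by rotation invariance of the ball and because T intertwines the projections onto \<open>E\<close>
  and onto its image.\<close>

lemma nn_integral_random_subspace_image:
  fixes T :: "'a::euclidean_space \<Rightarrow> 'a"
  assumes E: "subspace E" and T: "orthogonal_transformation T" and F: "F \<in> borel_measurable subspace_borel"
  shows "(\<integral>\<^sup>+ \<xi>. F \<xi> \<partial>random_subspace j (T ` E)) = (\<integral>\<^sup>+ \<xi>. F (T ` \<xi>) \<partial>random_subspace j E)"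
  using F
proof (induction j arbitrary: F)
  case 0
  have "(\<lambda>\<xi>. F (T ` \<xi>)) \<in> borel_measurable subspace_borel"
    by (rule measurable_compose[OF measurable_image_orthogonal[OF T] 0])
  moreover have "T 0 = 0" using T by (simp add: orthogonal_transformation linear_0)
  ultimately show ?case using 0 by (simp add: nn_integral_return)
next
  case (Suc j)
  note F[measurable] = Suc.prems
  have lin: "linear T" using T by (simp add: orthogonal_transformation)
  have TE: "subspace (T ` E)" by (simp add: lin E linear_subspace_image)
  note [measurable] = measurable_image_orthogonal[OF T]
  have cE: "(\<lambda>_. G) \<in> N \<rightarrow>\<^sub>M subspace_borel" if "subspace G" for G :: "'a set" and N :: "'d measure"
    using that by simp
  interpret U: prob_space ball_measure by (rule prob_space_ball_measure)
  define H where "H \<xi> = (\<integral>\<^sup>+ x. F (span (insert (proj (T ` E) x) \<xi>)) \<partial>ball_measure)" for \<xi>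
  have Hm: "H \<in> borel_measurable subspace_borel"
    unfolding H_def using cE[OF TE, measurable] by measurable
  have "(\<integral>\<^sup>+ \<xi>. F \<xi> \<partial>random_subspace (Suc j) (T ` E)) = (\<integral>\<^sup>+ \<xi>. H \<xi> \<partial>random_subspace j (T ` E))"
    unfolding H_def by (rule nn_integral_random_subspace_Suc[OF TE F])
  also have "\<dots> = (\<integral>\<^sup>+ \<xi>. H (T ` \<xi>) \<partial>random_subspace j E)"
    by (rule Suc.IH[OF Hm])
  also have "\<dots> = (\<integral>\<^sup>+ \<xi>. \<integral>\<^sup>+ x. F (T ` span (insert (proj E x) \<xi>)) \<partial>ball_measure \<partial>random_subspace j E)"
  proof (intro nn_integral_cong)
    fix \<xi> assume "\<xi> \<in> space (random_subspace j E)"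
    then have \<xi>: "subspace \<xi>" by (simp add: space_random_subspace E)
    have T\<xi>: "subspace (T ` \<xi>)" by (simp add: lin \<xi> linear_subspace_image)
    have "(\<lambda>x. F (span (insert (proj (T ` E) x) (T ` \<xi>)))) \<in> borel_measurable borel"
      using cE[OF TE, measurable] cE[OF T\<xi>, measurable] by measurable
    from nn_integral_ball_measure_orthogonal[OF T this, symmetric]
    show "H (T ` \<xi>) = (\<integral>\<^sup>+ x. F (T ` span (insert (proj E x) \<xi>)) \<partial>ball_measure)"
      by (simp add: H_def proj_image[OF T E] linear_span_image[OF lin, symmetric])
  qed
  also have "\<dots> = (\<integral>\<^sup>+ \<xi>. F (T ` \<xi>) \<partial>random_subspace (Suc j) E)"
    by (rule nn_integral_random_subspace_Suc[OF E, symmetric]) measurable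
  finally show ?case .
qed

lemma grassmannianD:
  assumes "\<xi> \<in> grassmannian j E"
  shows "subspace \<xi>" "\<xi> \<subseteq> E" "dim \<xi> = j"
  using assms by (auto simp: grassmannian_def)

lemma orthogonal_transformation_linear:
  fixes T :: "'a::euclidean_space \<Rightarrow> 'a"
  shows "orthogonal_transformation T \<Longrightarrow> linear T"
  by (simp add: orthogonal_transformation)

lemma orthogonal_image_cancel:
  fixes T :: "'a::euclidean_space \<Rightarrow> 'a"
  assumes "orthogonal_transformation T"
  shows "T ` A = T ` B \<longleftrightarrow> A = B"
  by (rule inj_image_eq_iff[OF orthogonal_transformation_inj[OF assms]])

lemma dim_orthogonal_image:
  fixes T :: "'a::euclidean_space \<Rightarrow> 'a"
  assumes "orthogonal_transformation T"
  shows "dim (T ` A) = dim A"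
  by (intro dim_image_eq orthogonal_transformation_linear[OF assms] inj_on_subset[OF orthogonal_transformation_inj[OF assms]]) simp

lemma image_grassmannian:
  fixes T :: "'a::euclidean_space \<Rightarrow> 'a"
  assumes "orthogonal_transformation T" "\<xi> \<in> grassmannian j E"
  shows "T ` \<xi> \<in> grassmannian j (T ` E)"
  using assms linear_subspace_image[OF orthogonal_transformation_linear[OF assms(1)], of \<xi>]
  by (auto simp: grassmannian_def dim_orthogonal_image)

section \<open>The invariant measure on a Grassmannian\<close>

text \<open>Transitivity is applied to the pairs (\<xi>, \<open>E\<^sup>\<bottom>\<close>) and
  (\<xi>', \<open>E\<^sup>\<bottom>\<close>): the map obtained preserves the complement, hence
  \<open>E\<close>, and takes one ball isometrically onto the other.\<close>

lemma invariant_prob_ball: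
  fixes E :: "'a::euclidean_space set"
  assumes E: "subspace E" and M: "invariant_prob j E M"
    and x: "\<xi> \<in> grassmannian j E" and y: "\<xi>' \<in> grassmannian j E"
  shows "emeasure M {\<zeta> \<in> grassmannian j E. dist (orth_proj \<zeta>) (orth_proj \<xi>) \<le> r} =
    emeasure M {\<zeta> \<in> grassmannian j E. dist (orth_proj \<zeta>) (orth_proj \<xi>') \<le> r}"
proof -
  note x = grassmannianD[OF x] and y = grassmannianD[OF y]
  have p: "\<zeta> \<subseteq> E\<^sup>\<bottom>\<^sup>\<bottom>" if "\<zeta> \<subseteq> E" for \<zeta> using that E by (simp add: orthogonal_comp_self)
  obtain T where T: "orthogonal_transformation T" "T ` \<xi> = \<xi>'" "T ` (E\<^sup>\<bottom>) = E\<^sup>\<bottom>"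
    by (rule orthogonal_transformation_exists_pair[OF x(1) subspace_orthogonal_comp[of E] y(1) subspace_orthogonal_comp[of E] p[OF x(2)] p[OF y(2)]])
       (use x y in auto)
  have TE: "T ` E = E"
    using orthogonal_transformation_image_comp[OF T(1), of "E\<^sup>\<bottom>"] T(3) by (simp add: orthogonal_comp_self E)
  have lin: "linear T" by (rule orthogonal_transformation_linear[OF T(1)])
  have sM: "sets M = sets (grassmannian_borel j E)"
    and inv: "\<And>A. A \<in> sets M \<Longrightarrow> emeasure M ((`) T ` A) = emeasure M A"
    using M T(1) TE by (auto simp: invariant_prob_def)
  let ?B = "\<lambda>\<xi>. {\<zeta> \<in> grassmannian j E. dist (orth_proj \<zeta>) (orth_proj \<xi>) \<le> r}"
  have B: "?B \<xi> \<in> sets M"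
  proof -
    have "orth_proj \<in> borel_measurable (grassmannian_borel j E)"
      unfolding grassmannian_borel_def by (rule measurable_vimage_algebra1) simp
    then have "{\<zeta> \<in> space (grassmannian_borel j E). dist (orth_proj \<zeta>) (orth_proj \<xi>) \<le> r} \<in> sets (grassmannian_borel j E)"
      by measurable
    then show ?thesis unfolding sM by (simp add: grassmannian_borel_def)
  qed
  have "(`) T ` ?B \<xi> = ?B \<xi>'"
  proof (intro subset_antisym subsetI)
    fix \<zeta> assume "\<zeta> \<in> (`) T ` ?B \<xi>"
    then obtain \<zeta>' where z: "\<zeta>' \<in> grassmannian j E" "dist (orth_proj \<zeta>') (orth_proj \<xi>) \<le> r" "\<zeta> = T ` \<zeta>'" by auto
    note z1 = grassmannianD[OF z(1)]
    have "\<zeta> \<in> grassmannian j E"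
      using z1 TE by (auto simp: z(3) grassmannian_def dim_orthogonal_image[OF T(1)] lin linear_subspace_image)
    moreover have "dist (orth_proj \<zeta>) (orth_proj \<xi>') \<le> r"
      using z(2) by (simp add: z(3) T(2)[symmetric] dist_orth_proj_image[OF T(1)] z1 x)
    ultimately show "\<zeta> \<in> ?B \<xi>'" by simp
  next
    fix \<zeta> assume "\<zeta> \<in> ?B \<xi>'"
    then have z: "\<zeta> \<in> grassmannian j E" "dist (orth_proj \<zeta>) (orth_proj \<xi>') \<le> r" by auto
    note z1 = grassmannianD[OF z(1)]
    define \<zeta>' where "\<zeta>' = T -` \<zeta>"
    have z3: "\<zeta> = T ` \<zeta>'"
      unfolding \<zeta>'_def using surj_image_vimage_eq[OF orthogonal_transformation_surj[OF T(1)]] by simp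
    have s: "subspace \<zeta>'" unfolding \<zeta>'_def using z1(1) lin by (rule linear_subspace_vimage[rotated])
    have "dim \<zeta>' = j" using z1(3) by (simp add: z3 dim_orthogonal_image[OF T(1)])
    moreover have "\<zeta>' \<subseteq> E"
    proof -
      have "T ` \<zeta>' \<subseteq> T ` E" using z1(2) TE z3 by simp
      then show ?thesis by (simp add: inj_image_subset_iff[OF orthogonal_transformation_inj[OF T(1)]])
    qed
    ultimately have "\<zeta>' \<in> grassmannian j E" using s by (simp add: grassmannian_def)
    moreover have "dist (orth_proj \<zeta>') (orth_proj \<xi>) \<le> r"
      using z(2) by (simp add: z3 T(2)[symmetric] dist_orth_proj_image[OF T(1)] s x)
    ultimately show "\<zeta> \<in> (`) T ` ?B \<xi>" using z3 by auto
  qed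
  then show ?thesis using inv[OF B] by simp
qed

lemma invariant_prob_unique:
  fixes E :: "'a::euclidean_space set"
  assumes E: "subspace E" and M: "invariant_prob j E M" and N: "invariant_prob j E N"
  shows "M = N"
proof -
  have s: "sets L = sets (vimage_algebra (grassmannian j E) orth_proj borel)" "space L = grassmannian j E"
    "emeasure L (grassmannian j E) = 1" if "invariant_prob j E L" for L
  proof -
    show 1: "sets L = sets (vimage_algebra (grassmannian j E) orth_proj borel)"
      using that by (simp add: invariant_prob_def grassmannian_borel_def)
    show "space L = grassmannian j E" using sets_eq_imp_space_eq[OF 1] by simp
    then show "emeasure L (grassmannian j E) = 1" using that by (simp add: invariant_prob_def)
  qed
  have f: "finite_measure L" if "invariant_prob j E L" for L
    using s[OF that] by (intro finite_measureI) simp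
  show ?thesis
  proof (rule uniformly_distributed_unique[where X="grassmannian j E" and Y="grassmannian j E" and \<phi>=orth_proj])
    show "grassmannian j E \<in> sets M" using sets.top[of M] s(2)[OF M] by simp
    show "sets M = sets (vimage_algebra (grassmannian j E) orth_proj borel)" "sets N = sets M"
      "emeasure M (grassmannian j E) = emeasure N (grassmannian j E)"
      using s(1,3)[OF M] s(1,3)[OF N] by simp_all
    show "emeasure M {z \<in> grassmannian j E. dist (orth_proj z) (orth_proj x) \<le> r} =
        emeasure M {z \<in> grassmannian j E. dist (orth_proj z) (orth_proj y) \<le> r}"
      "emeasure N {z \<in> grassmannian j E. dist (orth_proj z) (orth_proj x) \<le> r} =
        emeasure N {z \<in> grassmannian j E. dist (orth_proj z) (orth_proj y) \<le> r}"
      if "x \<in> grassmannian j E" "y \<in> grassmannian j E" for r x y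
      by (rule invariant_prob_ball[OF E M that], rule invariant_prob_ball[OF E N that])
  qed (use f[OF M] f[OF N] s(3)[OF M] in simp_all)
qed

text \<open>Existence of the invariant measure. The law \<open>random_subspace\<close> lives on all
  subspaces; restricting it loses no mass since almost surely the result is a
  \<open>j\<close>-dimensional subspace of \<open>E\<close>, and invariance is equivariance for maps
  that preserve \<open>E\<close>.\<close>

lemma random_subspace_invariant:
  fixes E :: "'a::euclidean_space set"
  assumes E: "subspace E" and j: "j \<le> dim E"
  shows "invariant_prob j E (restrict_space (random_subspace j E) (grassmannian j E))"
proof -
  let ?R = "random_subspace j E" and ?G = "grassmannian j E"
  let ?M = "restrict_space ?R ?G"
  interpret R: prob_space ?R by (rule prob_space_random_subspace[OF E])
  have Gs: "?G \<in> sets ?R" by (simp add: sets_random_subspace[OF E] grassmannian_in_sets[OF E])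
  have sub: "?G \<subseteq> space ?R" using sets.sets_into_space[OF Gs] .
  have AE: "AE \<xi> in ?R. \<xi> \<in> ?G" by (rule AE_random_subspace_grassmannian[OF E j])
  have sets: "sets ?M = sets (grassmannian_borel j E)"
    by (simp add: sets_grassmannian_borel sets_restrict_space sets_random_subspace[OF E])
  have sp: "space ?M = ?G" using sub by (auto simp: space_restrict_space)
  have em: "emeasure ?M A = emeasure ?R A" if "A \<subseteq> ?G" for A
    using Gs that by (intro emeasure_restrict_space) auto
  have "emeasure ?M (space ?M) = 1"
    unfolding sp em[OF order_refl] using AE Gs by (simp add: R.emeasure_eq_1_AE)
  moreover have "emeasure ?M ((`) T ` A) = emeasure ?M A"
    if T: "orthogonal_transformation T" and TE: "T ` E = E" and A: "A \<in> sets ?M" for T A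
  proof -
    have lin: "linear T" by (rule orthogonal_transformation_linear[OF T])
    have AR: "A \<in> sets ?R" "A \<subseteq> ?G"
      using A Gs sets.sets_into_space[OF A] sp by (auto simp: sets_restrict_space_iff)
    obtain g where g: "orthogonal_transformation g" "\<And>y. g (T y) = y" "\<And>y. T (g y) = y"
      using orthogonal_transformation_inv[OF T] orthogonal_transformation_bij[OF T]
      by (metis bij_inv_eq_iff)
    \<comment> \<open>The image under \<open>T\<close> is the preimage under its inverse
      \<open>g\<close>, the form in which measurability is known.\<close>
    have TA: "(`) T ` A = (`) g -` A \<inter> space subspace_borel"
    proof (intro subset_antisym subsetI)
      fix \<zeta> assume "\<zeta> \<in> (`) T ` A"
      then obtain \<xi> where "\<xi> \<in> A" "\<zeta> = T ` \<xi>" by auto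
      moreover have "subspace \<xi>" using \<open>\<xi> \<in> A\<close> AR(2) grassmannianD(1) by blast
      ultimately show "\<zeta> \<in> (`) g -` A \<inter> space subspace_borel"
        by (simp add: image_image g lin linear_subspace_image)
    next
      fix \<zeta> assume "\<zeta> \<in> (`) g -` A \<inter> space subspace_borel"
      then have "g ` \<zeta> \<in> A" by simp
      moreover have "T ` g ` \<zeta> = \<zeta>" by (simp add: image_image g)
      ultimately show "\<zeta> \<in> (`) T ` A" by (metis imageI)
    qed
    have TAs: "(`) T ` A \<in> sets subspace_borel"
      unfolding TA using AR(1) by (intro measurable_sets[OF measurable_image_orthogonal[OF g(1)]]) (simp add: sets_random_subspace[OF E])
    have TAG: "(`) T ` A \<subseteq> ?G"
      using AR(2) image_grassmannian[OF T, of _ j E] unfolding TE by blast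
    have "emeasure ?R ((`) T ` A) = (\<integral>\<^sup>+ \<xi>. indicator ((`) T ` A) \<xi> \<partial>random_subspace j (T ` E))"
      using TAs by (simp add: TE sets_random_subspace[OF E])
    also have "\<dots> = (\<integral>\<^sup>+ \<xi>. indicator ((`) T ` A) (T ` \<xi>) \<partial>?R)"
      by (rule nn_integral_random_subspace_image[OF E T]) (use TAs in simp)
    also have "\<dots> = (\<integral>\<^sup>+ \<xi>. indicator A \<xi> \<partial>?R)"
      by (intro nn_integral_cong) (auto simp: indicator_def image_iff orthogonal_image_cancel[OF T])
    also have "\<dots> = emeasure ?R A" using AR by simp
    finally show ?thesis by (simp add: em AR TAG)
  qed
  ultimately show ?thesis using sets by (simp add: invariant_prob_def)
qed

lemma grassmannian_measure_eq:
  fixes E :: "'a::euclidean_space set"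
  assumes E: "subspace E" and j: "j \<le> dim E"
  shows "grassmannian_measure j E = restrict_space (random_subspace j E) (grassmannian j E)"
  unfolding grassmannian_measure_def
  by (rule the_equality) (rule random_subspace_invariant[OF E j],
      erule invariant_prob_unique[OF E _ random_subspace_invariant[OF E j]])

context
  fixes E :: "'a::euclidean_space set" and j :: nat
  assumes E: "subspace E" and j: "j \<le> dim E"
begin

lemma sets_grassmannian_measure[measurable_cong]:
  "sets (grassmannian_measure j E) = sets (restrict_space subspace_borel (grassmannian j E))"
  by (simp add: grassmannian_measure_eq[OF E j] sets_restrict_space sets_random_subspace[OF E])

lemma space_grassmannian_measure: "space (grassmannian_measure j E) = grassmannian j E"
  using sets.sets_into_space[OF grassmannian_in_sets[OF E, of j]]
  by (auto simp: grassmannian_measure_eq[OF E j] space_restrict_space space_random_subspace[OF E])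

lemma prob_space_grassmannian_measure: "prob_space (grassmannian_measure j E)"
  using random_subspace_invariant[OF E j] grassmannian_measure_eq[OF E j]
  by (intro prob_spaceI) (simp add: invariant_prob_def)

lemma measurable_grassmannian_measure:
  "f \<in> subspace_borel \<rightarrow>\<^sub>M N \<Longrightarrow> f \<in> grassmannian_measure j E \<rightarrow>\<^sub>M N"
  by (subst measurable_cong_sets[OF sets_grassmannian_measure refl]) (rule measurable_restrict_space1)

text \<open>Under the measure on the left every \<xi> is a \<open>j\<close>-dimensional subspace of
  \<open>E\<close>, while the one on the right is a measurable kernel in \<open>E\<close>. Later
  integrals switch between the two.\<close>

lemma nn_integral_grassmannian_measure:
  "(\<integral>\<^sup>+ \<xi>. F \<xi> \<partial>grassmannian_measure j E) = (\<integral>\<^sup>+ \<xi>. F \<xi> \<partial>random_subspace j E)"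
proof -
  have G: "grassmannian j E \<inter> space (random_subspace j E) \<in> sets (random_subspace j E)"
    using grassmannian_in_sets[OF E, of j] by (intro sets.Int sets.top) (simp add: sets_random_subspace[OF E])
  have "(\<integral>\<^sup>+ \<xi>. F \<xi> \<partial>grassmannian_measure j E) = (\<integral>\<^sup>+ \<xi>. F \<xi> * indicator (grassmannian j E) \<xi> \<partial>random_subspace j E)"
    unfolding grassmannian_measure_eq[OF E j] by (rule nn_integral_restrict_space[OF G])
  also have "\<dots> = (\<integral>\<^sup>+ \<xi>. F \<xi> \<partial>random_subspace j E)"
    by (rule nn_integral_cong_AE, use AE_random_subspace_grassmannian[OF E j] in eventually_elim) simp
  finally show ?thesis .
qed

end

section \<open>Orthogonal pairs of subspaces\<close>

text \<open>\<eta> is drawn first and \<xi> second, although the pair lists \<xi> first.\<close>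

definition random_pair :: "nat \<Rightarrow> nat \<Rightarrow> ('a::euclidean_space set \<times> 'a set) measure" where
  "random_pair j k = bind (random_subspace k UNIV)
     (\<lambda>\<eta>. distr (random_subspace j (\<eta>\<^sup>\<bottom>)) (subspace_borel \<Otimes>\<^sub>M subspace_borel) (\<lambda>\<xi>. (\<xi>, \<eta>)))"

lemma measurable_random_pair_step:
  "(\<lambda>\<eta>. distr (random_subspace j (\<eta>\<^sup>\<bottom>)) (subspace_borel \<Otimes>\<^sub>M subspace_borel) (\<lambda>\<xi>. (\<xi>, \<eta>)))
    \<in> subspace_borel \<rightarrow>\<^sub>M subprob_algebra (subspace_borel \<Otimes>\<^sub>M (subspace_borel :: 'a::euclidean_space set measure))"
  by (rule measurable_distr2[where M=subspace_borel and f="\<lambda>\<eta> \<xi>. (\<xi>, \<eta>)"]) measurable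

lemma sets_random_pair: "sets (random_pair j k) = sets (subspace_borel \<Otimes>\<^sub>M (subspace_borel :: 'a::euclidean_space set measure))"
  unfolding random_pair_def
  by (rule sets_bind) (use subspace_0 in \<open>auto simp: space_random_subspace\<close>)

lemma nn_integral_random_pair:
  fixes F :: "'a::euclidean_space set \<times> 'a set \<Rightarrow> ennreal"
  assumes F[measurable]: "F \<in> borel_measurable (subspace_borel \<Otimes>\<^sub>M subspace_borel)"
  shows "(\<integral>\<^sup>+ p. F p \<partial>random_pair j k) = (\<integral>\<^sup>+ \<eta>. \<integral>\<^sup>+ \<xi>. F (\<xi>, \<eta>) \<partial>random_subspace j (\<eta>\<^sup>\<bottom>) \<partial>random_subspace k UNIV)"
proof -
  have "(\<integral>\<^sup>+ p. F p \<partial>random_pair j k) = (\<integral>\<^sup>+ \<eta>. \<integral>\<^sup>+ p. F p \<partial>distr (random_subspace j (\<eta>\<^sup>\<bottom>)) (subspace_borel \<Otimes>\<^sub>M subspace_borel) (\<lambda>\<xi>. (\<xi>, \<eta>)) \<partial>random_subspace k UNIV)"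
    unfolding random_pair_def
    by (rule nn_integral_bind[OF F]) (simp add: measurable_random_pair_step sets_random_subspace cong: measurable_cong_sets)
  also have "\<dots> = (\<integral>\<^sup>+ \<eta>. \<integral>\<^sup>+ \<xi>. F (\<xi>, \<eta>) \<partial>random_subspace j (\<eta>\<^sup>\<bottom>) \<partial>random_subspace k UNIV)"
  proof (intro nn_integral_cong nn_integral_distr)
    fix \<eta> assume "\<eta> \<in> space (random_subspace k (UNIV::'a set))"
    then have [simp]: "subspace \<eta>" by (simp add: space_random_subspace)
    note [measurable_cong] = sets_random_subspace[OF subspace_orthogonal_comp, of j \<eta>]
    show "(\<lambda>\<xi>. (\<xi>, \<eta>)) \<in> random_subspace j (\<eta>\<^sup>\<bottom>) \<rightarrow>\<^sub>M subspace_borel \<Otimes>\<^sub>M subspace_borel" by measurable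
  qed simp
  finally show ?thesis .
qed

definition orthogonal_pairs :: "nat \<Rightarrow> nat \<Rightarrow> ('a::euclidean_space set \<times> 'a set) set" where
  "orthogonal_pairs j k = {(\<xi>, \<eta>). \<xi> \<in> grassmannian j UNIV \<and> \<eta> \<in> grassmannian k UNIV \<and> \<xi> \<subseteq> \<eta>\<^sup>\<bottom>}"

lemma orthogonal_pairs_in_sets:
  "orthogonal_pairs j k \<in> sets (subspace_borel \<Otimes>\<^sub>M (subspace_borel :: 'a::euclidean_space set measure))"
proof -
  have "{p \<in> space (subspace_borel \<Otimes>\<^sub>M (subspace_borel :: 'a set measure)). fst p \<in> grassmannian j UNIV \<and> snd p \<in> grassmannian k UNIV \<and> fst p \<subseteq> (snd p)\<^sup>\<bottom>}
    \<in> sets (subspace_borel \<Otimes>\<^sub>M subspace_borel)"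
    by measurable
  also have "{p \<in> space (subspace_borel \<Otimes>\<^sub>M (subspace_borel :: 'a set measure)). fst p \<in> grassmannian j UNIV \<and> snd p \<in> grassmannian k UNIV \<and> fst p \<subseteq> (snd p)\<^sup>\<bottom>} = orthogonal_pairs j k"
    by (auto simp: orthogonal_pairs_def space_pair_measure grassmannian_def)
  finally show ?thesis .
qed

lemma prob_space_random_pair: "prob_space (random_pair j k :: ('a::euclidean_space set \<times> 'a set) measure)"
proof
  have sp: "space (random_pair j k :: ('a set \<times> 'a set) measure) = {\<xi>. subspace \<xi>} \<times> {\<xi>. subspace \<xi>}"
    using sets_eq_imp_space_eq[OF sets_random_pair] by (simp add: space_pair_measure)
  have "emeasure (random_pair j k :: ('a set \<times> 'a set) measure) (space (random_pair j k)) = (\<integral>\<^sup>+ p. 1 \<partial>(random_pair j k :: ('a set \<times> 'a set) measure))" by simp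
  also have "\<dots> = (\<integral>\<^sup>+ \<eta>. \<integral>\<^sup>+ \<xi>. 1 \<partial>random_subspace j ((\<eta> :: 'a set)\<^sup>\<bottom>) \<partial>random_subspace k UNIV)"
    by (rule nn_integral_random_pair) simp
  also have "\<dots> = 1"
    by (simp add: prob_space.emeasure_space_1 prob_space_random_subspace subspace_orthogonal_comp)
  finally show "emeasure (random_pair j k :: ('a set \<times> 'a set) measure) (space (random_pair j k)) = 1" .
qed

lemma random_pair_orthogonal:
  assumes jk: "j + k \<le> DIM('a)"
  shows "emeasure (random_pair j k) (space (random_pair j k) - orthogonal_pairs j k :: ('a::euclidean_space set \<times> 'a set) set) = 0"
proof -
  let ?C = "space (random_pair j k) - orthogonal_pairs j k :: ('a set \<times> 'a set) set"
  have C: "?C \<in> sets (random_pair j k)"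
    by (intro sets.Diff sets.top) (simp add: sets_random_pair orthogonal_pairs_in_sets)
  have "emeasure (random_pair j k) ?C = (\<integral>\<^sup>+ p. indicator ?C p \<partial>random_pair j k)"
    using C by simp
  also have "\<dots> = (\<integral>\<^sup>+ \<eta>. \<integral>\<^sup>+ \<xi>. indicator ?C (\<xi>, \<eta>) \<partial>random_subspace j (\<eta>\<^sup>\<bottom>) \<partial>random_subspace k UNIV)"
    by (rule nn_integral_random_pair) (use C in \<open>simp add: sets_random_pair\<close>)
  also have "\<dots> = (\<integral>\<^sup>+ \<eta>. 0 \<partial>random_subspace k (UNIV :: 'a set))"
  proof (rule nn_integral_cong_AE)
    have k: "k \<le> dim (UNIV :: 'a set)" using jk by simp
    show "AE \<eta> in random_subspace k UNIV. (\<integral>\<^sup>+ \<xi>. indicator ?C (\<xi>, \<eta>) \<partial>random_subspace j (\<eta>\<^sup>\<bottom>)) = 0"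
      using AE_random_subspace_grassmannian[OF subspace_UNIV k]
    proof eventually_elim
      case \<eta>: (elim \<eta>)
      have "j \<le> dim (\<eta>\<^sup>\<bottom>)" using dim_orthogonal_comp[of \<eta>] grassmannianD[OF \<eta>] jk by simp
      from AE_random_subspace_grassmannian[OF subspace_orthogonal_comp this]
      have "AE \<xi> in random_subspace j (\<eta>\<^sup>\<bottom>). indicator ?C (\<xi>, \<eta>) = (0::ennreal)"
      proof eventually_elim
        case (elim \<xi>)
        then have "(\<xi>, \<eta>) \<in> orthogonal_pairs j k"
          using \<eta> by (auto simp: orthogonal_pairs_def grassmannian_def)
        then show ?case by simp
      qed
      then have "(\<integral>\<^sup>+ \<xi>. indicator ?C (\<xi>, \<eta>) \<partial>random_subspace j (\<eta>\<^sup>\<bottom>)) = (\<integral>\<^sup>+ \<xi>. 0 \<partial>random_subspace j (\<eta>\<^sup>\<bottom>))"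
        by (rule nn_integral_cong_AE)
      then show ?case by simp
    qed
  qed
  finally show ?thesis by simp
qed

lemma measurable_map_prod_image:
  fixes T :: "'a::euclidean_space \<Rightarrow> 'a"
  assumes T: "orthogonal_transformation T"
  shows "map_prod ((`) T) ((`) T) \<in> subspace_borel \<Otimes>\<^sub>M subspace_borel \<rightarrow>\<^sub>M subspace_borel \<Otimes>\<^sub>M subspace_borel"
proof -
  note [measurable] = measurable_image_orthogonal[OF T]
  have "(\<lambda>p. (T ` fst p, T ` snd p)) \<in> subspace_borel \<Otimes>\<^sub>M subspace_borel \<rightarrow>\<^sub>M subspace_borel \<Otimes>\<^sub>M subspace_borel"
    by measurable
  then show ?thesis by (simp add: map_prod_def case_prod_beta')
qed

text \<open>Equivariance used twice: inside because T maps the complement of \<eta> to the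
  complement of its image, outside because T maps R^n onto itself.\<close>

lemma nn_integral_random_pair_image:
  fixes T :: "'a::euclidean_space \<Rightarrow> 'a"
  assumes T: "orthogonal_transformation T" and F[measurable]: "F \<in> borel_measurable (subspace_borel \<Otimes>\<^sub>M subspace_borel)"
  shows "(\<integral>\<^sup>+ p. F (map_prod ((`) T) ((`) T) p) \<partial>random_pair j k) = (\<integral>\<^sup>+ p. F p \<partial>random_pair j k)"
proof -
  have TU: "T ` UNIV = UNIV" by (rule orthogonal_transformation_surj[OF T])
  have "(\<integral>\<^sup>+ p. F (map_prod ((`) T) ((`) T) p) \<partial>random_pair j k) =
    (\<integral>\<^sup>+ \<eta>. \<integral>\<^sup>+ \<xi>. F (T ` \<xi>, T ` \<eta>) \<partial>random_subspace j (\<eta>\<^sup>\<bottom>) \<partial>random_subspace k UNIV)"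
    by (subst nn_integral_random_pair) (simp_all add: measurable_compose[OF measurable_map_prod_image[OF T] F])
  also have "\<dots> = (\<integral>\<^sup>+ \<eta>. \<integral>\<^sup>+ \<xi>. F (\<xi>, T ` \<eta>) \<partial>random_subspace j ((T ` \<eta>)\<^sup>\<bottom>) \<partial>random_subspace k UNIV)"
  proof (intro nn_integral_cong)
    fix \<eta> assume "\<eta> \<in> space (random_subspace k (UNIV :: 'a set))"
    then have "subspace (T ` \<eta>)"
      by (simp add: space_random_subspace linear_subspace_image orthogonal_transformation_linear[OF T])
    then have "(\<lambda>\<xi>. F (\<xi>, T ` \<eta>)) \<in> borel_measurable subspace_borel" by simp
    from nn_integral_random_subspace_image[OF subspace_orthogonal_comp T this, symmetric]
    show "(\<integral>\<^sup>+ \<xi>. F (T ` \<xi>, T ` \<eta>) \<partial>random_subspace j (\<eta>\<^sup>\<bottom>)) = (\<integral>\<^sup>+ \<xi>. F (\<xi>, T ` \<eta>) \<partial>random_subspace j ((T ` \<eta>)\<^sup>\<bottom>))"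
      by (simp add: orthogonal_transformation_image_comp[OF T])
  qed
  also have "\<dots> = (\<integral>\<^sup>+ \<eta>. \<integral>\<^sup>+ \<xi>. F (\<xi>, \<eta>) \<partial>random_subspace j (\<eta>\<^sup>\<bottom>) \<partial>random_subspace k UNIV)"
  proof -
    have "(\<lambda>\<eta>. \<integral>\<^sup>+ \<xi>. F (\<xi>, \<eta>) \<partial>random_subspace j (\<eta>\<^sup>\<bottom>)) \<in> borel_measurable subspace_borel"
      by (rule nn_integral_measurable_subprob_algebra2[where N=subspace_borel]) measurable
    from nn_integral_random_subspace_image[OF subspace_UNIV T this]
    show ?thesis unfolding TU by simp
  qed
  also have "\<dots> = (\<integral>\<^sup>+ p. F p \<partial>random_pair j k)"
    by (simp add: nn_integral_random_pair)
  finally show ?thesis .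
qed

definition orth_proj_pair :: "'a::euclidean_space set \<times> 'a set \<Rightarrow> ('a \<Rightarrow>\<^sub>L 'a) \<times> ('a \<Rightarrow>\<^sub>L 'a)" where
  "orth_proj_pair p = (orth_proj (fst p), orth_proj (snd p))"

lemma measurable_orth_proj_pair[measurable]: "orth_proj_pair \<in> borel_measurable (subspace_borel \<Otimes>\<^sub>M subspace_borel)"
  unfolding orth_proj_pair_def by measurable

text \<open>The uniqueness theorem refers to a single map into a metric space, so the product of the
  two Borel structures has to be recognized as the one induced by
  \<open>orth_proj_pair\<close>.\<close>

lemma sets_subspace_borel_pair:
  "sets (subspace_borel \<Otimes>\<^sub>M (subspace_borel :: 'a::euclidean_space set measure)) =
    sets (vimage_algebra ({\<xi>. subspace \<xi>} \<times> {\<xi>. subspace \<xi>}) orth_proj_pair borel)" (is "sets ?P = sets ?V")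
proof
  show "sets ?V \<subseteq> sets ?P"
    by (rule sets_image_in_sets) (auto simp: space_pair_measure)
  have \<phi>: "orth_proj_pair \<in> borel_measurable ?V" by (rule measurable_vimage_algebra1) simp
  have "(\<lambda>p. fst (orth_proj_pair p)) \<in> borel_measurable ?V" "(\<lambda>p. snd (orth_proj_pair p)) \<in> borel_measurable ?V"
    by (rule measurable_compose[OF \<phi>], intro borel_measurable_continuous_onI continuous_intros)+
  then have "fst \<in> ?V \<rightarrow>\<^sub>M subspace_borel" "snd \<in> ?V \<rightarrow>\<^sub>M subspace_borel"
    unfolding subspace_borel_def by (auto intro!: measurable_vimage_algebra2 simp: orth_proj_pair_def)
  then have id: "(\<lambda>p. (fst p, snd p)) \<in> ?V \<rightarrow>\<^sub>M ?P" by (rule measurable_Pair)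
  show "sets ?P \<subseteq> sets ?V"
  proof
    fix A assume A: "A \<in> sets ?P"
    then have "A \<subseteq> space ?V" using sets.sets_into_space[OF A] by (simp add: space_pair_measure)
    then show "A \<in> sets ?V" using measurable_sets[OF id A] by (simp add: Int_absorb2)
  qed
qed

text \<open>Both orders of choosing an orthogonal pair are invariant under the orthogonal group, which acts
  transitively on such pairs, so they agree.\<close>

lemma random_pair_swap:
  assumes jk: "j + k \<le> DIM('a)"
  shows "distr (random_pair k j) (subspace_borel \<Otimes>\<^sub>M subspace_borel) (\<lambda>(\<xi>, \<eta>). (\<eta>, \<xi>)) =
    (random_pair j k :: ('a::euclidean_space set \<times> 'a set) measure)"
proof -
  let ?P = "subspace_borel \<Otimes>\<^sub>M (subspace_borel :: 'a set measure)"
  let ?Y = "{\<xi>. subspace \<xi>} \<times> {\<xi>::'a set. subspace \<xi>}"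
  let ?s = "\<lambda>(\<xi>, \<eta>). (\<eta>, \<xi>)"
  let ?M = "distr (random_pair k j) ?P ?s" and ?N = "random_pair j k :: ('a set \<times> 'a set) measure"
  let ?X = "orthogonal_pairs j k :: ('a set \<times> 'a set) set"
  have sw: "?s \<in> random_pair k j \<rightarrow>\<^sub>M ?P"
    using measurable_pair_swap' by (simp cong: measurable_cong_sets add: sets_random_pair)
  have spN: "space (random_pair j k) = ?Y" for j k
    using sets_eq_imp_space_eq[OF sets_random_pair] by (simp add: space_pair_measure)
  have spM: "space ?M = ?Y" by (simp add: space_pair_measure)
  have pM: "prob_space ?M" by (rule prob_space.prob_space_distr[OF prob_space_random_pair sw])
  have pN: "prob_space ?N" by (rule prob_space_random_pair)
  have swX: "(\<xi>, \<eta>) \<in> orthogonal_pairs j k \<longleftrightarrow> (\<eta>, \<xi>) \<in> orthogonal_pairs k j" for \<xi> \<eta> :: "'a set" and j k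
    using orthogonal_comp_swap by (auto simp: orthogonal_pairs_def)
  have YX: "?Y - ?X \<in> sets ?P"
    using sets.compl_sets[OF orthogonal_pairs_in_sets[of j k]] by (simp add: space_pair_measure)
  have nullM: "emeasure ?M (?Y - ?X) = 0"
  proof -
    have "emeasure ?M (?Y - ?X) = emeasure (random_pair k j) (?s -` (?Y - ?X) \<inter> space (random_pair k j))"
      by (rule emeasure_distr[OF sw YX])
    also have "?s -` (?Y - ?X) \<inter> space (random_pair k j) = space (random_pair k j) - orthogonal_pairs k j"
      by (auto simp: spN swX[of _ _ j k])
    finally show ?thesis using random_pair_orthogonal[of k j, where 'a='a] jk by simp
  qed
  \<comment> \<open>An orthogonal map carrying \<open>p\<close> to \<open>q\<close> acts
    isometrically on pairs and pulls the ball about \<open>q\<close> back to the ball about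
    \<open>p\<close>.\<close>
  have ball: "emeasure L {z \<in> ?Y. dist (orth_proj_pair z) (orth_proj_pair p) \<le> r} = emeasure L {z \<in> ?Y. dist (orth_proj_pair z) (orth_proj_pair q) \<le> r}"
    if L: "sets L = sets ?P" and inv: "\<And>T F. orthogonal_transformation T \<Longrightarrow> F \<in> borel_measurable ?P \<Longrightarrow>
        (\<integral>\<^sup>+ p. F (map_prod ((`) T) ((`) T) p) \<partial>L) = (\<integral>\<^sup>+ p. F p \<partial>L)"
      and p: "p \<in> ?X" and q: "q \<in> ?X" for L p q r
  proof -
    obtain \<xi> \<eta> \<xi>' \<eta>' where pq: "p = (\<xi>, \<eta>)" "q = (\<xi>', \<eta>')" by (metis surj_pair)
    have s: "subspace \<xi>" "subspace \<eta>" "subspace \<xi>'" "subspace \<eta>'" "\<xi> \<subseteq> \<eta>\<^sup>\<bottom>" "\<xi>' \<subseteq> \<eta>'\<^sup>\<bottom>" "dim \<xi> = dim \<xi>'" "dim \<eta> = dim \<eta>'"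
      using p q by (auto simp: pq orthogonal_pairs_def grassmannian_def)
    obtain T where T: "orthogonal_transformation T" "T ` \<xi> = \<xi>'" "T ` \<eta> = \<eta>'"
      using orthogonal_transformation_exists_pair[OF s] by blast
    let ?b = "\<lambda>q z. if dist (orth_proj_pair z) (orth_proj_pair q) \<le> r then 1 else (0::ennreal)"
    have bm: "?b q \<in> borel_measurable ?P" for q by measurable
    have spL: "space L = ?Y" using sets_eq_imp_space_eq[OF L] by (simp add: space_pair_measure)
    have em: "emeasure L {z \<in> ?Y. dist (orth_proj_pair z) (orth_proj_pair q) \<le> r} = (\<integral>\<^sup>+ z. ?b q z \<partial>L)" for q
    proof -
      have "{z \<in> space ?P. dist (orth_proj_pair z) (orth_proj_pair q) \<le> r} \<in> sets ?P" by measurable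
      then have "{z \<in> ?Y. dist (orth_proj_pair z) (orth_proj_pair q) \<le> r} \<in> sets L"
        by (simp add: L space_pair_measure)
      then have "emeasure L {z \<in> ?Y. dist (orth_proj_pair z) (orth_proj_pair q) \<le> r} =
        (\<integral>\<^sup>+ z. indicator {z \<in> ?Y. dist (orth_proj_pair z) (orth_proj_pair q) \<le> r} z \<partial>L)" by simp
      also have "\<dots> = (\<integral>\<^sup>+ z. ?b q z \<partial>L)"
        by (intro nn_integral_cong) (auto simp: spL indicator_def)
      finally show ?thesis .
    qed
    have "(\<integral>\<^sup>+ z. ?b q z \<partial>L) = (\<integral>\<^sup>+ z. ?b q (map_prod ((`) T) ((`) T) z) \<partial>L)"
      by (rule inv[OF T(1) bm, symmetric])
    also have "\<dots> = (\<integral>\<^sup>+ z. ?b p z \<partial>L)"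
    proof (rule nn_integral_cong)
      fix z assume "z \<in> space L"
      then have "subspace (fst z)" "subspace (snd z)" by (auto simp: spL)
      then have "dist (orth_proj_pair (map_prod ((`) T) ((`) T) z)) (orth_proj_pair q) = dist (orth_proj_pair z) (orth_proj_pair p)"
        by (simp add: pq orth_proj_pair_def dist_Pair_Pair T(2,3)[symmetric] dist_orth_proj_image[OF T(1)] s)
      then show "?b q (map_prod ((`) T) ((`) T) z) = ?b p z" by simp
    qed
    finally show ?thesis by (simp add: em)
  qed
  have invM: "(\<integral>\<^sup>+ p. F (map_prod ((`) T) ((`) T) p) \<partial>?M) = (\<integral>\<^sup>+ p. F p \<partial>?M)"
    if T: "orthogonal_transformation T" and F: "F \<in> borel_measurable ?P" for T F
  proof -
    have 1: "(\<lambda>p. F (?s p)) \<in> borel_measurable ?P" by (rule measurable_compose[OF measurable_pair_swap' F])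
    have 2: "(\<lambda>p. F (map_prod ((`) T) ((`) T) p)) \<in> borel_measurable ?P"
      by (rule measurable_compose[OF measurable_map_prod_image[OF T] F])
    have "(\<integral>\<^sup>+ p. F (map_prod ((`) T) ((`) T) p) \<partial>?M) = (\<integral>\<^sup>+ p. F (map_prod ((`) T) ((`) T) (?s p)) \<partial>random_pair k j)"
      by (rule nn_integral_distr[OF sw]) (use 2 in simp)
    also have "\<dots> = (\<integral>\<^sup>+ p. F (?s (map_prod ((`) T) ((`) T) p)) \<partial>random_pair k j)"
      by (simp add: case_prod_beta')
    also have "\<dots> = (\<integral>\<^sup>+ p. F (?s p) \<partial>random_pair k j)"
      by (rule nn_integral_random_pair_image[OF T 1])
    also have "\<dots> = (\<integral>\<^sup>+ p. F p \<partial>?M)"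
      by (rule nn_integral_distr[OF sw, symmetric]) (use F in simp)
    finally show ?thesis .
  qed
  have fin: "finite_measure ?M" "finite_measure ?N"
    by (rule prob_space.finite_measure[OF pM], rule prob_space.finite_measure[OF pN])
  have one: "emeasure ?M ?Y = 1" "emeasure ?N ?Y = 1"
    using prob_space.emeasure_space_1[OF pM] prob_space.emeasure_space_1[OF pN] unfolding spM spN by simp_all
  have sM: "sets ?M = sets ?P" by simp
  show ?thesis
  proof (rule uniformly_distributed_unique[where X="?X" and Y="?Y" and \<phi>=orth_proj_pair])
    show "finite_measure ?M" "finite_measure ?N" by fact+
    show "sets ?M = sets (vimage_algebra ?Y orth_proj_pair borel)" by (simp add: sets_subspace_borel_pair)
    show "sets ?N = sets ?M" by (simp add: sets_random_pair)
    show "emeasure ?M ?Y = emeasure ?N ?Y" "emeasure ?M ?Y \<noteq> 0" unfolding one by simp_all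
    show "?X \<in> sets ?M" using orthogonal_pairs_in_sets by simp
    show "emeasure ?M (?Y - ?X) = 0" by fact
    show "emeasure ?N (?Y - ?X) = 0" using random_pair_orthogonal[OF jk] by (simp add: spN)
  qed (rule ball[OF sM invM] ball[OF sets_random_pair nn_integral_random_pair_image]; assumption)+
qed

lemma nn_integral_orthogonal_pairs_swap:
  fixes F :: "'a::euclidean_space set \<times> 'a set \<Rightarrow> ennreal"
  assumes F[measurable]: "F \<in> borel_measurable (subspace_borel \<Otimes>\<^sub>M subspace_borel)" and jk: "j + k \<le> DIM('a)"
  shows "(\<integral>\<^sup>+ \<eta>. \<integral>\<^sup>+ \<xi>. F (\<xi>, \<eta>) \<partial>random_subspace j (\<eta>\<^sup>\<bottom>) \<partial>random_subspace k UNIV) =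
    (\<integral>\<^sup>+ \<xi>. \<integral>\<^sup>+ \<eta>. F (\<xi>, \<eta>) \<partial>random_subspace k (\<xi>\<^sup>\<bottom>) \<partial>random_subspace j UNIV)"
proof -
  note [measurable_cong] = sets_random_pair
  have "(\<integral>\<^sup>+ \<eta>. \<integral>\<^sup>+ \<xi>. F (\<xi>, \<eta>) \<partial>random_subspace j (\<eta>\<^sup>\<bottom>) \<partial>random_subspace k UNIV) = (\<integral>\<^sup>+ p. F p \<partial>random_pair j k)"
    by (rule nn_integral_random_pair[symmetric]) measurable
  also have "\<dots> = (\<integral>\<^sup>+ p. F p \<partial>distr (random_pair k j) (subspace_borel \<Otimes>\<^sub>M subspace_borel) (\<lambda>(\<xi>, \<eta>). (\<eta>, \<xi>)))"
    by (simp add: random_pair_swap[OF jk])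
  also have "\<dots> = (\<integral>\<^sup>+ p. F (case p of (\<xi>, \<eta>) \<Rightarrow> (\<eta>, \<xi>)) \<partial>random_pair k j)"
    by (rule nn_integral_distr) (simp_all add: measurable_pair_swap' sets_random_pair cong: measurable_cong_sets)
  also have "\<dots> = (\<integral>\<^sup>+ \<xi>. \<integral>\<^sup>+ \<eta>. F (\<xi>, \<eta>) \<partial>random_subspace k (\<xi>\<^sup>\<bottom>) \<partial>random_subspace j UNIV)"
    by (subst nn_integral_random_pair) (simp_all add: measurable_compose[OF measurable_pair_swap' F])
  finally show ?thesis .
qed

section \<open>Affine planes\<close>

lemma plane_absorb:
  assumes "subspace \<xi>" "x \<in> \<xi>"
  shows "plane \<xi> (u + x) = plane \<xi> u"
proof
  show "plane \<xi> (u + x) \<subseteq> plane \<xi> u"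
    using assms by (auto simp: add.assoc subspace_add)
  show "plane \<xi> u \<subseteq> plane \<xi> (u + x)"
  proof
    fix y assume "y \<in> plane \<xi> u"
    then obtain z where z: "z \<in> \<xi>" "y = u + z" by auto
    then have "z - x \<in> \<xi>" "y = (u + x) + (z - x)" using assms by (auto simp: subspace_diff)
    then show "y \<in> plane \<xi> (u + x)" by blast
  qed
qed

lemma plane_diff_proj:
  assumes "subspace \<xi>"
  shows "plane \<xi> (u - proj \<xi> u) = plane \<xi> u"
  using plane_absorb[OF assms proj_in[OF assms, of u], of "u - proj \<xi> u"] by simp

lemma plane_coord_plane: "subspace \<xi> \<Longrightarrow> plane_coord (plane \<xi> u) = (orth_proj \<xi>, u - proj \<xi> u)"
  unfolding plane_coord_def
  by (simp add: direction_plane) (metis foot_plane plane_diff_proj proj_diff)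

lemma plane_norm_eq: "subspace \<xi> \<Longrightarrow> plane_norm (plane \<xi> u) = norm (u - proj \<xi> u)"
  by (metis plane_norm_plane plane_diff_proj proj_diff)

lemma plane_in_affine_grassmannian:
  "\<xi> \<in> grassmannian j UNIV \<Longrightarrow> plane \<xi> u \<in> affine_grassmannian j"
  unfolding affine_grassmannian_iff
  by (metis grassmannianD(1) plane_diff_proj proj_diff)

lemma affine_grassmannianE:
  assumes "\<tau> \<in> affine_grassmannian j"
  obtains \<xi> u where "\<xi> \<in> grassmannian j UNIV" "u \<in> \<xi>\<^sup>\<bottom>" "\<tau> = plane \<xi> u" "direction \<tau> = \<xi>" "foot \<tau> = u"
  using assms unfolding affine_grassmannian_iff
  by (metis direction_plane foot_plane grassmannianD(1))

lemma plane_direction_foot: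
  assumes "\<tau> \<in> affine_grassmannian j"
  shows "direction \<tau> \<in> grassmannian j UNIV" "foot \<tau> \<in> (direction \<tau>)\<^sup>\<bottom>" "plane (direction \<tau>) (foot \<tau>) = \<tau>"
  using affine_grassmannianE[OF assms] by metis+

lemma space_plane_borel[simp]: "space (plane_borel j) = affine_grassmannian j"
  by (simp add: plane_borel_def)

lemma measurable_plane_coord: "plane_coord \<in> borel_measurable (plane_borel j)"
  unfolding plane_borel_def by (rule measurable_vimage_algebra1) simp

lemma measurable_foot[measurable]: "foot \<in> borel_measurable (plane_borel j :: 'a::euclidean_space set measure)"
proof -
  have "(\<lambda>\<tau>. snd (plane_coord \<tau>)) \<in> borel_measurable (plane_borel j :: 'a set measure)"
    by (rule measurable_compose[OF measurable_plane_coord]) (intro borel_measurable_continuous_onI continuous_intros)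
  then show ?thesis by (simp add: plane_coord_def)
qed

lemma measurable_direction[measurable]: "direction \<in> plane_borel j \<rightarrow>\<^sub>M (subspace_borel :: 'a::euclidean_space set measure)"
  unfolding subspace_borel_def
proof (rule measurable_vimage_algebra2)
  have "(\<lambda>\<tau>. fst (plane_coord \<tau>)) \<in> borel_measurable (plane_borel j :: 'a set measure)"
    by (rule measurable_compose[OF measurable_plane_coord]) (intro borel_measurable_continuous_onI continuous_intros)
  then show "(\<lambda>\<tau>. orth_proj (direction \<tau>)) \<in> borel_measurable (plane_borel j :: 'a set measure)"
    by (simp add: plane_coord_def)
  show "direction \<in> space (plane_borel j) \<rightarrow> {\<xi>. subspace \<xi>}"
    by (auto intro: grassmannianD(1)[OF plane_direction_foot(1)])
qed

lemma measurable_plane_norm[measurable]: "plane_norm \<in> borel_measurable (plane_borel j :: 'a::euclidean_space set measure)"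
proof -
  have "plane_norm \<tau> = norm (foot \<tau>)" if "\<tau> \<in> space (plane_borel j)" for \<tau> :: "'a set"
    using that by (metis affine_grassmannianE grassmannianD(1) plane_norm_plane space_plane_borel)
  moreover have "(\<lambda>\<tau>. norm (foot \<tau>)) \<in> borel_measurable (plane_borel j :: 'a set measure)" by measurable
  ultimately show ?thesis by (subst measurable_cong)
qed

lemma measurable_plane:
  fixes f :: "'b \<Rightarrow> 'a::euclidean_space set"
  assumes f[measurable]: "f \<in> N \<rightarrow>\<^sub>M subspace_borel" and g[measurable]: "g \<in> borel_measurable N"
    and G: "\<And>x. x \<in> space N \<Longrightarrow> f x \<in> grassmannian j UNIV"
  shows "(\<lambda>x. plane (f x) (g x)) \<in> N \<rightarrow>\<^sub>M plane_borel j"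
  unfolding plane_borel_def
proof (rule measurable_vimage_algebra2)
  show "(\<lambda>x. plane (f x) (g x)) \<in> space N \<rightarrow> affine_grassmannian j"
    using G plane_in_affine_grassmannian by blast
  have "(\<lambda>x. (orth_proj (f x), g x - proj (f x) (g x))) \<in> borel_measurable N" by measurable
  then show "(\<lambda>x. plane_coord (plane (f x) (g x))) \<in> borel_measurable N"
    by (subst measurable_cong[OF plane_coord_plane]) (use G grassmannianD(1) in blast)
qed

text \<open>Extended by \<open>0\<close> to subspaces of the wrong dimension, which keeps it measurable on the space of all
  pairs.\<close>

definition plane_ext :: "nat \<Rightarrow> ('a::euclidean_space set \<Rightarrow> ennreal) \<Rightarrow> 'a set \<Rightarrow> 'a \<Rightarrow> ennreal" where
  "plane_ext j F \<xi> u = (if \<xi> \<in> grassmannian j UNIV then F (plane \<xi> u) else 0)"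

lemma plane_ext_eq: "\<xi> \<in> grassmannian j E \<Longrightarrow> plane_ext j F \<xi> u = F (plane \<xi> u)"
  by (simp add: plane_ext_def grassmannian_def)

lemma measurable_plane_ext[measurable (raw)]:
  fixes f :: "'b \<Rightarrow> 'a::euclidean_space set"
  assumes F: "F \<in> borel_measurable (plane_borel j)"
    and f[measurable]: "f \<in> N \<rightarrow>\<^sub>M subspace_borel" and g[measurable]: "g \<in> borel_measurable N"
  shows "(\<lambda>x. plane_ext j F (f x) (g x)) \<in> borel_measurable N"
proof -
  let ?\<Omega> = "{x \<in> space N. f x \<in> grassmannian j UNIV}"
  have \<Omega>: "?\<Omega> \<in> sets N" by measurable
  have "(\<lambda>x. F (plane (f x) (g x))) \<in> borel_measurable (restrict_space N ?\<Omega>)"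
    by (rule measurable_compose[OF measurable_plane F])
       (auto intro: measurable_restrict_space1 f g simp: space_restrict_space)
  then have "(\<lambda>x. F (plane (f x) (g x)) * indicator ?\<Omega> x) \<in> borel_measurable N"
    by (subst (asm) borel_measurable_restrict_space_iff_ennreal) (use \<Omega> in auto)
  moreover have "F (plane (f x) (g x)) * indicator ?\<Omega> x = plane_ext j F (f x) (g x)" if "x \<in> space N" for x
    using that by (simp add: plane_ext_def indicator_def)
  ultimately show ?thesis by (subst measurable_cong[symmetric])
qed

section \<open>The measure on affine planes\<close>

text \<open>The measure completed in \<open>plane_measure\<close>, written as the image of a measure
  on a product. A point of R^n stands for its component in \<open>\<xi>\<^sup>\<bottom>\<close>; the
  component in \<xi> does not change the plane, is confined to the unit ball of \<xi>, and the
  volume of that ball is divided out.\<close>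

definition plane_lborel :: "nat \<Rightarrow> 'a::euclidean_space set measure" where
  "plane_lborel j = distr (density (grassmannian_measure j UNIV \<Otimes>\<^sub>M lborel)
     (\<lambda>(\<xi>, x). indicator (cball 0 1) (proj \<xi> x) / ennreal (unit_ball_vol j)))
     (plane_borel j) (\<lambda>(\<xi>, x). plane \<xi> x)"

lemma sets_plane_lborel[simp, measurable_cong]: "sets (plane_lborel j) = sets (plane_borel j)"
  by (simp add: plane_lborel_def)

lemma space_plane_lborel[simp]: "space (plane_lborel j) = affine_grassmannian j"
  by (simp add: plane_lborel_def)

context
  fixes j :: nat
  assumes j: "j \<le> DIM('a::euclidean_space)"
begin

lemma le_dim_UNIV: "j \<le> dim (UNIV :: 'a set)" using j by simp

lemma nn_integral_perp:
  fixes \<xi> :: "'a set"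
  assumes \<xi>: "\<xi> \<in> grassmannian j UNIV" and g: "g \<in> borel_measurable (restrict_space borel (\<xi>\<^sup>\<bottom>))"
  shows "(\<integral>\<^sup>+ u. g u \<partial>subspace_lborel (\<xi>\<^sup>\<bottom>)) =
    (\<integral>\<^sup>+ x. indicator (cball 0 1) (proj \<xi> x) * g (x - proj \<xi> x) \<partial>lborel) / ennreal (unit_ball_vol j)"
proof -
  note s = grassmannianD(1)[OF \<xi>]
  have d: "DIM('a) - dim (\<xi>\<^sup>\<bottom>) = j"
    using dim_orthogonal_comp[OF s] grassmannianD(3)[OF \<xi>] by simp
  have e: "proj (\<xi>\<^sup>\<bottom>) x = x - proj \<xi> x" for x by (rule proj_comp[OF s])
  have "ennreal (unit_ball_vol j) * (\<integral>\<^sup>+ u. g u \<partial>subspace_lborel (\<xi>\<^sup>\<bottom>)) / ennreal (unit_ball_vol j) = (\<integral>\<^sup>+ u. g u \<partial>subspace_lborel (\<xi>\<^sup>\<bottom>))"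
    using unit_ball_vol_pos[OF of_nat_0_le_iff[of j]]
    by (subst mult.commute, intro ennreal_mult_divide_eq) (auto simp: ennreal_eq_0_iff not_le)
  then show ?thesis
    using nn_integral_subspace_lborel[OF subspace_orthogonal_comp g] unfolding d e by simp
qed

lemma measurable_plane_grassmannian:
  "(\<lambda>(\<xi>, x). plane \<xi> x) \<in> grassmannian_measure j (UNIV::'a set) \<Otimes>\<^sub>M lborel \<rightarrow>\<^sub>M plane_borel j"
proof -
  have "(\<lambda>p. plane (fst p) (snd p)) \<in> grassmannian_measure j (UNIV::'a set) \<Otimes>\<^sub>M lborel \<rightarrow>\<^sub>M plane_borel j"
  proof (rule measurable_plane)
    show "fst \<in> grassmannian_measure j (UNIV::'a set) \<Otimes>\<^sub>M lborel \<rightarrow>\<^sub>M subspace_borel"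
      by (rule measurable_compose[OF measurable_fst measurable_grassmannian_measure[OF subspace_UNIV le_dim_UNIV]]) simp
    show "snd \<in> borel_measurable (grassmannian_measure j (UNIV::'a set) \<Otimes>\<^sub>M lborel)"
      using measurable_snd[of "grassmannian_measure j (UNIV::'a set)" lborel] by simp
  qed (auto simp: space_pair_measure space_grassmannian_measure[OF subspace_UNIV le_dim_UNIV])
  then show ?thesis by (simp add: case_prod_beta')
qed

lemma nn_integral_plane_lborel:
  fixes F :: "'a set \<Rightarrow> ennreal"
  assumes F: "F \<in> borel_measurable (plane_borel j)"
  shows "(\<integral>\<^sup>+ \<tau>. F \<tau> \<partial>plane_lborel j) = (\<integral>\<^sup>+ \<xi>. \<integral>\<^sup>+ u. F (plane \<xi> u) \<partial>subspace_lborel (\<xi>\<^sup>\<bottom>) \<partial>grassmannian_measure j UNIV)"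
proof -
  let ?G = "grassmannian_measure j (UNIV :: 'a set)"
  let ?w = "\<lambda>(\<xi>, x). indicator (cball 0 1) (proj \<xi> x) / ennreal (unit_ball_vol j)"
  have [measurable]: "fst \<in> ?G \<Otimes>\<^sub>M lborel \<rightarrow>\<^sub>M subspace_borel"
    by (rule measurable_compose[OF measurable_fst measurable_grassmannian_measure[OF subspace_UNIV le_dim_UNIV]]) simp
  have [measurable]: "cball (0::'a) 1 \<in> sets borel" by simp
  have [measurable]: "snd \<in> borel_measurable (?G \<Otimes>\<^sub>M lborel)"
    using measurable_snd[of ?G lborel] by simp
  have w: "?w \<in> borel_measurable (?G \<Otimes>\<^sub>M lborel)"
    unfolding case_prod_beta' by measurable
  have FP: "(\<lambda>p. F (case p of (\<xi>, x) \<Rightarrow> plane \<xi> x)) \<in> borel_measurable (?G \<Otimes>\<^sub>M lborel)"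
    by (rule measurable_compose[OF measurable_plane_grassmannian F])
  have "(\<integral>\<^sup>+ \<tau>. F \<tau> \<partial>plane_lborel j) = (\<integral>\<^sup>+ p. F (case p of (\<xi>, x) \<Rightarrow> plane \<xi> x) \<partial>density (?G \<Otimes>\<^sub>M lborel) ?w)"
    unfolding plane_lborel_def
    by (rule nn_integral_distr) (use measurable_plane_grassmannian F in simp_all)
  also have "\<dots> = (\<integral>\<^sup>+ p. ?w p * F (case p of (\<xi>, x) \<Rightarrow> plane \<xi> x) \<partial>(?G \<Otimes>\<^sub>M lborel))"
    by (rule nn_integral_density[OF w FP])
  also have "\<dots> = (\<integral>\<^sup>+ \<xi>. \<integral>\<^sup>+ x. ?w (\<xi>, x) * F (plane \<xi> x) \<partial>lborel \<partial>?G)"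
    by (subst lborel.nn_integral_fst[symmetric]) (use w FP in \<open>auto intro!: borel_measurable_times\<close>)
  also have "\<dots> = (\<integral>\<^sup>+ \<xi>. \<integral>\<^sup>+ u. F (plane \<xi> u) \<partial>subspace_lborel (\<xi>\<^sup>\<bottom>) \<partial>?G)"
  proof (rule nn_integral_cong)
    fix \<xi> assume "\<xi> \<in> space ?G"
    then have \<xi>: "\<xi> \<in> grassmannian j UNIV" by (simp add: space_grassmannian_measure[OF subspace_UNIV le_dim_UNIV])
    note s = grassmannianD(1)[OF \<xi>]
    have Fm: "(\<lambda>u. F (plane \<xi> u)) \<in> borel_measurable borel"
      by (rule measurable_compose[OF measurable_plane F]) (use \<xi> s in auto)
    have [measurable]: "(\<lambda>x. F (plane \<xi> x)) \<in> borel_measurable lborel" using Fm by simp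
    have "(\<integral>\<^sup>+ u. F (plane \<xi> u) \<partial>subspace_lborel (\<xi>\<^sup>\<bottom>)) =
      (\<integral>\<^sup>+ x. indicator (cball 0 1) (proj \<xi> x) * F (plane \<xi> x) \<partial>lborel) / ennreal (unit_ball_vol j)"
      using nn_integral_perp[OF \<xi> measurable_restrict_space1[OF Fm]] by (simp add: plane_diff_proj[OF s])
    also have "\<dots> = (\<integral>\<^sup>+ x. ?w (\<xi>, x) * F (plane \<xi> x) \<partial>lborel)"
      by (subst nn_integral_divide[symmetric]) (measurable, simp add: ennreal_times_divide mult.commute divide_ennreal_def mult.assoc mult.left_commute)
    finally show "(\<integral>\<^sup>+ x. ?w (\<xi>, x) * F (plane \<xi> x) \<partial>lborel) = (\<integral>\<^sup>+ u. F (plane \<xi> u) \<partial>subspace_lborel (\<xi>\<^sup>\<bottom>))" ..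
  qed
  finally show ?thesis .
qed

text \<open>\<open>measure_of\<close> returns the prescribed set function only if that is a measure,
  and 0 otherwise; agreement with \<open>plane_lborel\<close> on all Borel sets settles
  this.\<close>

lemma plane_measure_eq: "plane_measure j = completion (plane_lborel j :: 'a set measure)"
proof -
  let ?G = "grassmannian_measure j (UNIV :: 'a set)"
  let ?\<mu> = "\<lambda>A. \<integral>\<^sup>+ \<xi>. emeasure (subspace_lborel (\<xi>\<^sup>\<bottom>)) {u \<in> \<xi>\<^sup>\<bottom>. plane \<xi> u \<in> A} \<partial>?G"
  have "emeasure (plane_lborel j) A = ?\<mu> A" if A: "A \<in> sets (plane_borel j)" for A
  proof -
    have "emeasure (plane_lborel j) A = (\<integral>\<^sup>+ \<tau>. indicator A \<tau> \<partial>plane_lborel j)" using A by simp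
    also have "\<dots> = (\<integral>\<^sup>+ \<xi>. \<integral>\<^sup>+ u. indicator A (plane \<xi> u) \<partial>subspace_lborel (\<xi>\<^sup>\<bottom>) \<partial>?G)"
      by (rule nn_integral_plane_lborel) (use A in simp)
    also have "\<dots> = ?\<mu> A"
    proof (rule nn_integral_cong)
      fix \<xi> assume "\<xi> \<in> space ?G"
      then have \<xi>: "\<xi> \<in> grassmannian j UNIV" by (simp add: space_grassmannian_measure[OF subspace_UNIV le_dim_UNIV])
      note s = grassmannianD(1)[OF \<xi>]
      have sp: "space (subspace_lborel (\<xi>\<^sup>\<bottom>)) = \<xi>\<^sup>\<bottom>" by (rule space_subspace_lborel[OF subspace_orthogonal_comp])
      have "(\<lambda>u. plane \<xi> u) \<in> borel \<rightarrow>\<^sub>M plane_borel j"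
        by (rule measurable_plane) (use \<xi> s in auto)
      then have "(\<lambda>u. plane \<xi> u) \<in> subspace_lborel (\<xi>\<^sup>\<bottom>) \<rightarrow>\<^sub>M plane_borel j"
        by (subst measurable_cong_sets[OF sets_subspace_lborel[OF subspace_orthogonal_comp] refl]) (rule measurable_restrict_space1)
      from measurable_sets[OF this A]
      have "{u \<in> \<xi>\<^sup>\<bottom>. plane \<xi> u \<in> A} \<in> sets (subspace_lborel (\<xi>\<^sup>\<bottom>))"
        by (simp add: sp vimage_def Int_def conj_commute)
      then have "emeasure (subspace_lborel (\<xi>\<^sup>\<bottom>)) {u \<in> \<xi>\<^sup>\<bottom>. plane \<xi> u \<in> A} = (\<integral>\<^sup>+ u. indicator {u \<in> \<xi>\<^sup>\<bottom>. plane \<xi> u \<in> A} u \<partial>subspace_lborel (\<xi>\<^sup>\<bottom>))"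
        by simp
      also have "\<dots> = (\<integral>\<^sup>+ u. indicator A (plane \<xi> u) \<partial>subspace_lborel (\<xi>\<^sup>\<bottom>))"
        by (rule nn_integral_cong) (auto simp: sp indicator_def)
      finally show "(\<integral>\<^sup>+ u. indicator A (plane \<xi> u) \<partial>subspace_lborel (\<xi>\<^sup>\<bottom>)) = emeasure (subspace_lborel (\<xi>\<^sup>\<bottom>)) {u \<in> \<xi>\<^sup>\<bottom>. plane \<xi> u \<in> A}" ..
    qed
    finally show ?thesis .
  qed
  then have "measure_of (affine_grassmannian j) (sets (plane_borel j)) ?\<mu> =
    measure_of (affine_grassmannian j) (sets (plane_borel j)) (emeasure (plane_lborel j))"
    using sets.sigma_sets_eq[of "plane_borel j :: 'a set measure"] sets.space_closed[of "plane_borel j :: 'a set measure"]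
    by (intro measure_of_eq) simp_all
  also have "\<dots> = plane_lborel j"
    using measure_of_of_measure[of "plane_lborel j :: 'a set measure"] by simp
  finally show ?thesis by (simp add: plane_measure_def)
qed

end

section \<open>The distance from a point to a random subspace\<close>

lemma
  fixes E \<eta> :: "'a::euclidean_space set"
  assumes E: "subspace E" and \<eta>: "subspace \<eta>" "\<eta> \<subseteq> E"
  shows proj_comp_Int: "proj (E \<inter> \<eta>\<^sup>\<bottom>) x = proj E x - proj \<eta> x"
    and dim_comp_Int: "dim (E \<inter> \<eta>\<^sup>\<bottom>) + dim \<eta> = dim E"
proof -
  have W: "subspace (E \<inter> \<eta>\<^sup>\<bottom>)" by (simp add: E subspace_inter subspace_orthogonal_comp)
  have p: "proj (E \<inter> \<eta>\<^sup>\<bottom>) x = proj E x - proj \<eta> x" for x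
  proof (rule proj_eqI[OF W])
    have "x - proj \<eta> x - (x - proj E x) \<in> \<eta>\<^sup>\<bottom>"
      using proj_diff[OF E, of x] proj_diff[OF \<eta>(1), of x] orthogonal_comp_anti_mono[OF \<eta>(2)]
      by (intro subspace_diff[OF subspace_orthogonal_comp, of "x - proj \<eta> x"]) auto
    moreover have "proj E x - proj \<eta> x \<in> E"
      using proj_in[OF E, of x] proj_in[OF \<eta>(1), of x] \<eta>(2) by (intro subspace_diff E) auto
    ultimately show "proj E x - proj \<eta> x \<in> E \<inter> \<eta>\<^sup>\<bottom>" by (simp add: algebra_simps)
    show "x - (proj E x - proj \<eta> x) \<in> (E \<inter> \<eta>\<^sup>\<bottom>)\<^sup>\<bottom>"
    proof (rule orthogonal_compI)
      fix y assume y: "y \<in> E \<inter> \<eta>\<^sup>\<bottom>"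
      then have "(x - proj E x) \<bullet> y = 0" "proj \<eta> x \<bullet> y = 0"
        using orthogonal_compD(1)[OF proj_diff[OF E]] orthogonal_compD(2)[OF _ proj_in[OF \<eta>(1)]] by auto
      then show "(x - (proj E x - proj \<eta> x)) \<bullet> y = 0"
        by (simp add: inner_diff_left)
    qed
  qed
  then show "proj (E \<inter> \<eta>\<^sup>\<bottom>) x = proj E x - proj \<eta> x" .
  have "real (dim (E \<inter> \<eta>\<^sup>\<bottom>)) = real (dim E) - real (dim \<eta>)"
    by (simp add: trace_proj[symmetric] W E \<eta>(1) p inner_diff_left sum_subtractf)
  then show "dim (E \<inter> \<eta>\<^sup>\<bottom>) + dim \<eta> = dim E" by linarith
qed

text \<open>A point of the unit ball with small component in \<open>W\<close> has its components in
  an \<epsilon>-ball of \<open>W\<close> and in the unit ball of the complement. When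
  \<open>W\<close> is the complement of \<eta> within \<open>\<xi>\<^sup>\<bottom>\<close>, the
  exponent \<open>dim W\<close> is n - j - k: this is where the weight of the tail condition comes
  from.\<close>

lemma lborel_tube_le:
  fixes W :: "'a::euclidean_space set"
  assumes W: "subspace W" and \<epsilon>: "\<epsilon> > 0"
  shows "(\<integral>\<^sup>+ x. indicator {x. norm (proj W x) \<le> \<epsilon>} x * indicator (cball 0 1) x \<partial>lborel)
    \<le> ennreal (unit_ball_vol (dim W) * unit_ball_vol (DIM('a) - dim W) * \<epsilon> ^ dim W)"
proof -
  have p: "unit_ball_vol (real n) \<ge> 0" for n by (simp add: less_imp_le unit_ball_vol_pos)
  have d: "dim (W\<^sup>\<bottom>) = DIM('a) - dim W" using dim_orthogonal_comp[OF W] by simp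
  have sp: "space (subspace_lborel W) = W" "space (subspace_lborel (W\<^sup>\<bottom>)) = W\<^sup>\<bottom>"
    by (simp_all add: space_subspace_lborel W subspace_orthogonal_comp)
  have m: "{x. norm (proj W x) \<le> \<epsilon>} \<in> sets borel" "cball (0::'a) 1 \<in> sets borel" by measurable
  let ?A = "{u \<in> W. norm u \<le> \<epsilon>}" and ?B = "{v \<in> W\<^sup>\<bottom>. norm v \<le> 1}"
  have B: "?B \<in> sets (subspace_lborel (W\<^sup>\<bottom>))" and A: "?A \<in> sets (subspace_lborel W)"
    by (simp_all add: sets_subspace_lborel[OF W] sets_subspace_lborel[OF subspace_orthogonal_comp] sets_restrict_space_cball)
  have "(\<integral>\<^sup>+ x. indicator {x. norm (proj W x) \<le> \<epsilon>} x * indicator (cball 0 1) x \<partial>lborel) =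
    (\<integral>\<^sup>+ u. \<integral>\<^sup>+ v. indicator {x. norm (proj W x) \<le> \<epsilon>} (u + v) * indicator (cball 0 1) (u + v) \<partial>subspace_lborel (W\<^sup>\<bottom>) \<partial>subspace_lborel W)"
    by (rule nn_integral_lborel_decomp[OF W]) (use m in measurable)
  also have "\<dots> \<le> (\<integral>\<^sup>+ u. \<integral>\<^sup>+ v. indicator ?A u * indicator ?B v \<partial>subspace_lborel (W\<^sup>\<bottom>) \<partial>subspace_lborel W)"
  proof (intro nn_integral_mono)
    fix u v assume "u \<in> space (subspace_lborel W)" "v \<in> space (subspace_lborel (W\<^sup>\<bottom>))"
    then have uv: "u \<in> W" "v \<in> W\<^sup>\<bottom>" by (simp_all add: sp)
    then have e: "proj W (u + v) = u" by (simp add: blinfun.add_right proj_self proj_perp W)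
    have "norm v \<le> norm (u + v)" using norm_diff_proj_le[OF W, of "u + v"] by (simp add: e)
    then show "indicator {x. norm (proj W x) \<le> \<epsilon>} (u + v) * indicator (cball 0 1) (u + v) \<le> (indicator ?A u * indicator ?B v :: ennreal)"
      using uv by (auto simp: indicator_def e)
  qed
  also have "\<dots> = (\<integral>\<^sup>+ u. indicator ?A u * emeasure (subspace_lborel (W\<^sup>\<bottom>)) ?B \<partial>subspace_lborel W)"
    using B by (simp add: nn_integral_cmult)
  also have "\<dots> = emeasure (subspace_lborel W) ?A * emeasure (subspace_lborel (W\<^sup>\<bottom>)) ?B"
    using A by (simp add: nn_integral_multc)
  also have "\<dots> = ennreal (unit_ball_vol (dim W) * \<epsilon> ^ dim W) * ennreal (unit_ball_vol (DIM('a) - dim W))"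
    using emeasure_subspace_lborel_cball[OF W \<epsilon>] emeasure_subspace_lborel_cball[OF subspace_orthogonal_comp[of W], of 1]
    by (simp add: d)
  also have "\<dots> = ennreal (unit_ball_vol (dim W) * unit_ball_vol (DIM('a) - dim W) * \<epsilon> ^ dim W)"
    using p \<epsilon> by (simp add: ennreal_mult[symmetric] mult_ac)
  finally show ?thesis by simp
qed

text \<open>The probability of a random subspace of \<open>E\<close> passing within distance \<open>\<epsilon>\<close> of a unit vector \<open>e\<close> of
  \<open>E\<close> does not depend on \<open>e\<close> and increases when \<open>e\<close> is shortened, so it is at most its average over
  the projections of the points of the unit ball.\<close>

lemma random_subspace_near_unit:
  fixes E :: "'a::euclidean_space set"
  assumes E: "subspace E" and k: "k \<le> dim E" and e: "e \<in> E" "norm e = 1" and \<epsilon>: "\<epsilon> > 0"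
  shows "emeasure (random_subspace k E) {\<eta>. subspace \<eta> \<and> norm (e - proj \<eta> e) \<le> \<epsilon>}
    \<le> ennreal (unit_ball_vol (dim E - k) * unit_ball_vol (DIM('a) - (dim E - k)) / unit_ball_vol DIM('a) * \<epsilon> ^ (dim E - k))"
proof -
  let ?R = "random_subspace k E"
  interpret R: prob_space ?R by (rule prob_space_random_subspace[OF E])
  interpret U: prob_space "ball_measure :: 'a measure" by (rule prob_space_ball_measure)
  interpret RU: pair_sigma_finite ?R "ball_measure :: 'a measure" ..
  note [measurable_cong] = sets_random_subspace[OF E]
  define b :: "'a set \<Rightarrow> 'a \<Rightarrow> ennreal" where "b \<eta> x = (if norm (x - proj \<eta> x) \<le> \<epsilon> then 1 else 0)" for \<eta> x
  have bm[measurable]: "(\<lambda>(\<eta>, x). b \<eta> x) \<in> borel_measurable (subspace_borel \<Otimes>\<^sub>M borel)"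
    unfolding b_def by measurable
  have b1: "(\<lambda>\<eta>. b \<eta> x) \<in> borel_measurable subspace_borel" for x
    unfolding b_def by measurable
  define g where "g x = (\<integral>\<^sup>+ \<eta>. b \<eta> x \<partial>?R)" for x
  have em: "emeasure ?R {\<eta>. subspace \<eta> \<and> norm (e - proj \<eta> e) \<le> \<epsilon>} = g e"
  proof -
    have "{\<eta> \<in> space subspace_borel. norm (e - proj \<eta> e) \<le> \<epsilon>} \<in> sets subspace_borel" by measurable
    then have "{\<eta>. subspace \<eta> \<and> norm (e - proj \<eta> e) \<le> \<epsilon>} \<in> sets ?R" by (simp add: sets_random_subspace[OF E])
    then have "emeasure ?R {\<eta>. subspace \<eta> \<and> norm (e - proj \<eta> e) \<le> \<epsilon>} = (\<integral>\<^sup>+ \<eta>. indicator {\<eta>. subspace \<eta> \<and> norm (e - proj \<eta> e) \<le> \<epsilon>} \<eta> \<partial>?R)"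
      by simp
    also have "\<dots> = g e" unfolding g_def
      by (intro nn_integral_cong) (auto simp: space_random_subspace[OF E] b_def indicator_def)
    finally show ?thesis .
  qed
  \<comment> \<open>A rotation preserving \<open>E\<close> takes the line of \<open>e\<close> to the
    line of \<open>u\<close>, hence \<open>e\<close> to \<open>u\<close> or \<open>- u\<close>, and
    the sign does not affect the distance to a subspace.\<close>
  have unit: "g e \<le> g u" if u: "u \<in> E" "norm u = 1" for u
  proof -
    have sp: "span {e} \<subseteq> E\<^sup>\<bottom>\<^sup>\<bottom>" "span {u} \<subseteq> E\<^sup>\<bottom>\<^sup>\<bottom>"
      using e u E by (simp_all add: orthogonal_comp_self span_minimal)
    have d: "dim (span {e}) = dim (span {u})" using e u by (auto simp: dim_insert)
    obtain T where T: "orthogonal_transformation T" "T ` span {e} = span {u}" "T ` (E\<^sup>\<bottom>) = E\<^sup>\<bottom>"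
      by (rule orthogonal_transformation_exists_pair[OF subspace_span subspace_orthogonal_comp subspace_span subspace_orthogonal_comp sp d refl])
    have TE: "T ` E = E"
      using orthogonal_transformation_image_comp[OF T(1), of "E\<^sup>\<bottom>"] T(3) by (simp add: orthogonal_comp_self E)
    have "T e \<in> span {u}" using T(2) by (metis imageI insertI1 span_base)
    then obtain c where c: "T e = c *\<^sub>R u" by (auto simp: span_singleton)
    have "\<bar>c\<bar> = 1" using orthogonal_transformation_norm[OF T(1), of e] e u by (simp add: c)
    have "g u = (\<integral>\<^sup>+ \<eta>. b \<eta> u \<partial>random_subspace k (T ` E))" by (simp add: g_def TE)
    also have "\<dots> = (\<integral>\<^sup>+ \<eta>. b (T ` \<eta>) u \<partial>?R)"
      by (rule nn_integral_random_subspace_image[OF E T(1) b1])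
    also have "\<dots> = (\<integral>\<^sup>+ \<eta>. b \<eta> e \<partial>?R)"
    proof (rule nn_integral_cong)
      fix \<eta> assume "\<eta> \<in> space ?R"
      then have \<eta>: "subspace \<eta>" by (simp add: space_random_subspace[OF E])
      have "norm (u - proj (T ` \<eta>) u) = norm (c *\<^sub>R (u - proj (T ` \<eta>) u))"
        using \<open>\<bar>c\<bar> = 1\<close> by simp
      also have "\<dots> = norm (T e - proj (T ` \<eta>) (T e))"
        by (simp add: c blinfun.scaleR_right scaleR_diff_right)
      also have "\<dots> = norm (T (e - proj \<eta> e))"
        by (simp add: proj_image[OF T(1) \<eta>] linear_diff[OF orthogonal_transformation_linear[OF T(1)]])
      also have "\<dots> = norm (e - proj \<eta> e)" by (rule orthogonal_transformation_norm[OF T(1)])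
      finally show "b (T ` \<eta>) u = b \<eta> e" by (simp add: b_def)
    qed
    finally show ?thesis by (simp add: g_def)
  qed
  have short: "g e \<le> g u" if u: "u \<in> E" "norm u \<le> 1" for u
  proof (cases "u = 0")
    \<comment> \<open>The zero vector lies in every subspace, so \<open>g u\<close> is the total
      mass 1.\<close>
    case True
    have "g e \<le> (\<integral>\<^sup>+ \<eta>. 1 \<partial>?R)" unfolding g_def by (intro nn_integral_mono) (simp add: b_def)
    also have "\<dots> = g u" using \<epsilon> by (simp add: g_def b_def True)
    finally show ?thesis .
  next
    case False
    let ?u = "u /\<^sub>R norm u"
    have "g e \<le> g ?u" by (rule unit) (use False u subspace_scale[OF E] in auto)
    also have "\<dots> \<le> g u"
      unfolding g_def
    proof (rule nn_integral_mono)
      fix \<eta> assume "\<eta> \<in> space ?R"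
      have "norm (u - proj \<eta> u) = norm u * norm (?u - proj \<eta> ?u)"
      proof -
        have "u - proj \<eta> u = norm u *\<^sub>R (?u - proj \<eta> ?u)"
          using False by (simp add: blinfun.scaleR_right scaleR_diff_right)
        then show ?thesis by (metis norm_scaleR abs_norm_cancel)
      qed
      also have "\<dots> \<le> norm (?u - proj \<eta> ?u)" using u by (simp add: mult_left_le_one_le)
      finally show "b \<eta> ?u \<le> b \<eta> u" by (simp add: b_def)
    qed
    finally show ?thesis .
  qed
  have "g e = (\<integral>\<^sup>+ x. g e \<partial>(ball_measure :: 'a measure))" by (simp add: U.emeasure_space_1[simplified])
  also have "\<dots> \<le> (\<integral>\<^sup>+ x. g (proj E x) \<partial>ball_measure)"
  proof (rule nn_integral_mono_AE)
    have "AE x in (ball_measure :: 'a measure). x \<in> cball 0 1"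
      unfolding ball_measure_def by (rule AE_uniform_measureI) auto
    then show "AE x in ball_measure. g e \<le> g (proj E x)"
    proof eventually_elim
      case (elim x)
      then have "norm (proj E x) \<le> 1" using norm_proj_le[OF E, of x] by simp
      then show ?case by (intro short proj_in E)
    qed
  qed
  also have "\<dots> = (\<integral>\<^sup>+ \<eta>. \<integral>\<^sup>+ x. b \<eta> (proj E x) \<partial>ball_measure \<partial>?R)"
    unfolding g_def by (rule RU.Fubini') measurable
  also have "\<dots> \<le> (\<integral>\<^sup>+ \<eta>. ennreal (unit_ball_vol (dim E - k) * unit_ball_vol (DIM('a) - (dim E - k)) / unit_ball_vol DIM('a) * \<epsilon> ^ (dim E - k)) \<partial>?R)"
  proof (rule nn_integral_mono_AE, use AE_random_subspace_grassmannian[OF E k] in eventually_elim)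
    case (elim \<eta>)
    note \<eta> = grassmannianD[OF elim]
    let ?W = "E \<inter> \<eta>\<^sup>\<bottom>"
    have W: "subspace ?W" by (simp add: E subspace_inter subspace_orthogonal_comp)
    have dW: "dim ?W = dim E - k" using dim_comp_Int[OF E \<eta>(1,2)] \<eta>(3) by simp
    have "proj \<eta> (proj E x) = proj \<eta> x" for x
    proof -
      have "x - proj E x \<in> \<eta>\<^sup>\<bottom>" using proj_diff[OF E, of x] orthogonal_comp_anti_mono[OF \<eta>(2)] by auto
      then have "proj \<eta> (x - proj E x) = 0" by (rule proj_perp[OF \<eta>(1)])
      then show ?thesis by (simp add: blinfun.diff_right)
    qed
    \<comment> \<open>For fixed \<eta>, what the projection to \<eta> leaves of
      \<open>proj E x\<close> is the component of \<open>x\<close> in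
      \<open>E \<inter> \<eta>\<^sup>\<bottom>\<close>. So the average over \<open>x\<close> is a
      tube volume, with the same bound for every \<eta>.\<close>
    then have bW: "b \<eta> (proj E x) = indicator {x. norm (proj ?W x) \<le> \<epsilon>} x" for x
      by (simp add: b_def indicator_def proj_comp_Int[OF E \<eta>(1,2)])
    have "(\<integral>\<^sup>+ x. b \<eta> (proj E x) \<partial>ball_measure) =
      (\<integral>\<^sup>+ x. indicator {x. norm (proj ?W x) \<le> \<epsilon>} x * indicator (cball 0 1) x \<partial>lborel) / ennreal (unit_ball_vol DIM('a))"
      unfolding bW by (rule nn_integral_ball_measure) measurable
    also have "\<dots> \<le> ennreal (unit_ball_vol (dim ?W) * unit_ball_vol (DIM('a) - dim ?W) * \<epsilon> ^ dim ?W) / ennreal (unit_ball_vol DIM('a))"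
      by (intro divide_right_mono_ennreal lborel_tube_le W \<epsilon>)
    also have "\<dots> = ennreal (unit_ball_vol (dim ?W) * unit_ball_vol (DIM('a) - dim ?W) * \<epsilon> ^ dim ?W / unit_ball_vol DIM('a))"
      using \<epsilon> by (intro divide_ennreal) (auto simp: unit_ball_vol_pos less_imp_le)
    finally show ?case by (simp add: dW mult_ac)
  qed
  also have "\<dots> = ennreal (unit_ball_vol (dim E - k) * unit_ball_vol (DIM('a) - (dim E - k)) / unit_ball_vol DIM('a) * \<epsilon> ^ (dim E - k))"
    by (simp add: R.emeasure_space_1)
  finally show ?thesis unfolding em .
qed

lemma random_subspace_near:
  fixes E :: "'a::euclidean_space set"
  assumes E: "subspace E" and k: "k \<le> dim E" and y: "y \<in> E" "y \<noteq> 0" and R: "R > 0"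
  shows "emeasure (random_subspace k E) {\<eta>. subspace \<eta> \<and> norm (y - proj \<eta> y) \<le> R}
    \<le> ennreal (unit_ball_vol (dim E - k) * unit_ball_vol (DIM('a) - (dim E - k)) / unit_ball_vol DIM('a) * (R / norm y) ^ (dim E - k))"
proof -
  let ?e = "y /\<^sub>R norm y"
  have "norm (y - proj \<eta> y) = norm y * norm (?e - proj \<eta> ?e)" for \<eta>
  proof -
    have "y - proj \<eta> y = norm y *\<^sub>R (?e - proj \<eta> ?e)"
      using y by (simp add: blinfun.scaleR_right scaleR_diff_right)
    then show ?thesis by (metis norm_scaleR abs_norm_cancel)
  qed
  then have "norm (y - proj \<eta> y) \<le> R \<longleftrightarrow> norm (?e - proj \<eta> ?e) \<le> R / norm y" for \<eta>
    using y(2) by (simp add: pos_le_divide_eq mult.commute)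
  then show ?thesis
    using random_subspace_near_unit[OF E k, of ?e "R / norm y"] y R subspace_scale[OF E] by simp
qed

section \<open>Duality\<close>

text \<open>The transform on functions with values in [0,\<infinity>], where it always has a
  value.\<close>

definition radon_nn :: "nat \<Rightarrow> ('a::euclidean_space set \<Rightarrow> ennreal) \<Rightarrow> 'a set \<Rightarrow> 'a \<Rightarrow> ennreal" where
  "radon_nn j H \<eta> v = (\<integral>\<^sup>+ \<xi>. \<integral>\<^sup>+ u. H (plane \<xi> (u + v)) \<partial>subspace_lborel \<eta> \<partial>grassmannian_measure j (\<eta>\<^sup>\<bottom>))"

lemma measurable_subspace_lborel_ident:
  assumes "subspace (E::'a::euclidean_space set)"
  shows "(\<lambda>x. x) \<in> subspace_lborel E \<rightarrow>\<^sub>M borel"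
  by (subst measurable_cong_sets[OF sets_subspace_lborel[OF assms] refl]) (rule measurable_restrict_space1, simp)

lemma measurable_grassmannian_ident:
  assumes "subspace (E::'a::euclidean_space set)" "j \<le> dim E"
  shows "(\<lambda>x. x) \<in> grassmannian_measure j E \<rightarrow>\<^sub>M subspace_borel"
  by (rule measurable_grassmannian_measure[OF assms]) simp

text \<open>The probability p(\<tau>) of the sketch. Here \<eta> is random inside the complement of
  the direction of \<tau>: this is the law of \<eta> given \<xi> once the order of choice has been
  exchanged.\<close>

definition near_prob :: "nat \<Rightarrow> real \<Rightarrow> 'a::euclidean_space set \<Rightarrow> ennreal" where
  "near_prob k R \<tau> = emeasure (random_subspace k ((direction \<tau>)\<^sup>\<bottom>)) {\<eta>. subspace \<eta> \<and> norm (foot \<tau> - proj \<eta> (foot \<tau>)) \<le> R}"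

lemma near_prob_eq:
  fixes \<tau> :: "'a::euclidean_space set"
  shows "near_prob k R \<tau> = (\<integral>\<^sup>+ \<eta>. (if norm (foot \<tau> - proj \<eta> (foot \<tau>)) \<le> R then 1 else 0) \<partial>random_subspace k ((direction \<tau>)\<^sup>\<bottom>))"
proof -
  let ?R = "random_subspace k ((direction \<tau>)\<^sup>\<bottom>)" and ?y = "foot \<tau>"
  note E = subspace_orthogonal_comp[of "direction \<tau>"]
  have "{\<eta> \<in> space subspace_borel. norm (?y - proj \<eta> ?y) \<le> R} \<in> sets subspace_borel" by measurable
  then have "{\<eta>. subspace \<eta> \<and> norm (?y - proj \<eta> ?y) \<le> R} \<in> sets ?R" by (simp add: sets_random_subspace[OF E])
  then have "near_prob k R \<tau> = (\<integral>\<^sup>+ \<eta>. indicator {\<eta>. subspace \<eta> \<and> norm (?y - proj \<eta> ?y) \<le> R} \<eta> \<partial>?R)"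
    by (simp add: near_prob_def)
  also have "\<dots> = (\<integral>\<^sup>+ \<eta>. (if norm (?y - proj \<eta> ?y) \<le> R then 1 else 0) \<partial>?R)"
    by (intro nn_integral_cong) (auto simp: space_random_subspace[OF E] indicator_def)
  finally show ?thesis .
qed

lemma measurable_near_prob[measurable]: "near_prob k R \<in> borel_measurable (plane_borel j :: 'a::euclidean_space set measure)"
  unfolding near_prob_eq[abs_def]
  by (rule nn_integral_measurable_subprob_algebra2[where N=subspace_borel]) measurable

context
  fixes j k :: nat
  assumes jk: "j + k \<le> DIM('a::euclidean_space)"
begin

lemma le_dim_perp: "\<eta> \<in> grassmannian k (UNIV :: 'a set) \<Longrightarrow> j \<le> dim (\<eta>\<^sup>\<bottom>)"
  using dim_orthogonal_comp[of \<eta>] grassmannianD(1,3)[of \<eta> k UNIV] jk by simp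

lemma grassmannian_UNIV: "\<xi> \<in> grassmannian j E \<Longrightarrow> \<xi> \<in> grassmannian j UNIV"
  by (simp add: grassmannian_def)

text \<open>In this form the integrals run over R^n and over a kernel in \<eta>, so that the
  transform is visibly measurable in \<eta> and \<open>v\<close>.\<close>

lemma radon_nn_eq:
  fixes H :: "'a set \<Rightarrow> ennreal"
  assumes H: "H \<in> borel_measurable (plane_borel j)" and \<eta>: "\<eta> \<in> grassmannian k UNIV"
  shows "radon_nn j H \<eta> v = (\<integral>\<^sup>+ \<xi>. (\<integral>\<^sup>+ x. indicator (cball 0 1) (x - proj \<eta> x) * plane_ext j H \<xi> (proj \<eta> x + v) \<partial>lborel)
    / ennreal (unit_ball_vol (DIM('a) - k)) \<partial>random_subspace j (\<eta>\<^sup>\<bottom>))"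
proof -
  note s = grassmannianD(1,3)[OF \<eta>]
  have "radon_nn j H \<eta> v = (\<integral>\<^sup>+ \<xi>. (\<integral>\<^sup>+ x. indicator (cball 0 1) (x - proj \<eta> x) * plane_ext j H \<xi> (proj \<eta> x + v) \<partial>lborel)
    / ennreal (unit_ball_vol (DIM('a) - k)) \<partial>grassmannian_measure j (\<eta>\<^sup>\<bottom>))"
    unfolding radon_nn_def
  proof (rule nn_integral_cong)
    fix \<xi> assume "\<xi> \<in> space (grassmannian_measure j (\<eta>\<^sup>\<bottom>))"
    then have \<xi>: "\<xi> \<in> grassmannian j (\<eta>\<^sup>\<bottom>)"
      by (simp add: space_grassmannian_measure[OF subspace_orthogonal_comp le_dim_perp[OF \<eta>]])
    have "(\<lambda>u. H (plane \<xi> (u + v))) \<in> borel_measurable borel"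
      by (rule measurable_compose[OF measurable_plane H]) (use grassmannianD(1)[OF \<xi>] grassmannian_UNIV[OF \<xi>] in auto)
    then have m: "(\<lambda>u. H (plane \<xi> (u + v))) \<in> borel_measurable (restrict_space borel \<eta>)" by (rule measurable_restrict_space1)
    have "(\<integral>\<^sup>+ u. H (plane \<xi> (u + v)) \<partial>subspace_lborel \<eta>) =
      (ennreal (unit_ball_vol (DIM('a) - k)) * (\<integral>\<^sup>+ u. H (plane \<xi> (u + v)) \<partial>subspace_lborel \<eta>)) / ennreal (unit_ball_vol (DIM('a) - k))"
      by (subst mult.commute, intro ennreal_mult_divide_eq[symmetric]) (auto simp: ennreal_eq_0_iff not_le)
    also have "\<dots> = (\<integral>\<^sup>+ x. indicator (cball 0 1) (x - proj \<eta> x) * H (plane \<xi> (proj \<eta> x + v)) \<partial>lborel) / ennreal (unit_ball_vol (DIM('a) - k))"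
      using nn_integral_subspace_lborel[OF s(1) m] by (simp add: s(2))
    finally show "(\<integral>\<^sup>+ u. H (plane \<xi> (u + v)) \<partial>subspace_lborel \<eta>) =
      (\<integral>\<^sup>+ x. indicator (cball 0 1) (x - proj \<eta> x) * plane_ext j H \<xi> (proj \<eta> x + v) \<partial>lborel) / ennreal (unit_ball_vol (DIM('a) - k))"
      by (simp add: plane_ext_eq[OF \<xi>])
  qed
  then show ?thesis
    by (simp add: nn_integral_grassmannian_measure[OF subspace_orthogonal_comp le_dim_perp[OF \<eta>]])
qed

lemma measurable_radon_nn:
  fixes H :: "'a set \<Rightarrow> ennreal"
  assumes H: "H \<in> borel_measurable (plane_borel j)"
  shows "(\<lambda>\<zeta>. radon_nn j H (direction \<zeta>) (foot \<zeta>)) \<in> borel_measurable (plane_borel k)"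
proof -
  note [measurable] = measurable_plane_ext[OF H]
  have [measurable]: "cball (0::'a) 1 \<in> sets borel" by simp
  have "(\<lambda>p. (\<integral>\<^sup>+ x. indicator (cball 0 1) (x - proj (direction (fst p)) x) * plane_ext j H (snd p) (proj (direction (fst p)) x + foot (fst p)) \<partial>lborel)
    / ennreal (unit_ball_vol (DIM('a) - k))) \<in> borel_measurable (plane_borel k \<Otimes>\<^sub>M subspace_borel)"
    by measurable
  then have "(\<lambda>\<zeta>. \<integral>\<^sup>+ \<xi>. (\<integral>\<^sup>+ x. indicator (cball 0 1) (x - proj (direction \<zeta>) x) * plane_ext j H \<xi> (proj (direction \<zeta>) x + foot \<zeta>) \<partial>lborel)
    / ennreal (unit_ball_vol (DIM('a) - k)) \<partial>random_subspace j ((direction \<zeta>)\<^sup>\<bottom>)) \<in> borel_measurable (plane_borel k)"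
    by (intro nn_integral_measurable_subprob_algebra2[where N=subspace_borel]) (simp add: case_prod_beta', measurable)
  then show ?thesis
    by (subst measurable_cong[OF radon_nn_eq[OF H]]) (use plane_direction_foot(1) in auto)
qed

text \<open>The foot v in the complement of \<eta> and the inner variable u in \<eta> combine to x =
  u + v, and \<Phi>(\<eta> + v) = \<Phi>(\<eta> + x) because u lies in \<eta>. After that the inner
  domain of integration is R^n, free of \<eta>, and the order of \<xi> and \<eta> can be
  exchanged.\<close>

lemma radon_nn_duality:
  fixes H \<Phi> :: "'a set \<Rightarrow> ennreal"
  assumes H: "H \<in> borel_measurable (plane_borel j)" and \<Phi>: "\<Phi> \<in> borel_measurable (plane_borel k)"
  shows "(\<integral>\<^sup>+ \<zeta>. \<Phi> \<zeta> * radon_nn j H (direction \<zeta>) (foot \<zeta>) \<partial>plane_lborel k) =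
    (\<integral>\<^sup>+ \<xi>. \<integral>\<^sup>+ \<eta>. \<integral>\<^sup>+ x. plane_ext k \<Phi> \<eta> x * plane_ext j H \<xi> x \<partial>lborel \<partial>random_subspace k (\<xi>\<^sup>\<bottom>) \<partial>random_subspace j UNIV)"
proof -
  note [measurable] = measurable_plane_ext[OF H] measurable_plane_ext[OF \<Phi>]
  have k: "k \<le> DIM('a)" "k \<le> dim (UNIV :: 'a set)" using jk by simp_all
  have G: "(\<lambda>p. \<integral>\<^sup>+ x. plane_ext k \<Phi> (snd p) x * plane_ext j H (fst p) x \<partial>lborel) \<in> borel_measurable (subspace_borel \<Otimes>\<^sub>M subspace_borel)"
    by measurable
  have "(\<integral>\<^sup>+ \<zeta>. \<Phi> \<zeta> * radon_nn j H (direction \<zeta>) (foot \<zeta>) \<partial>plane_lborel k) =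
    (\<integral>\<^sup>+ \<eta>. \<integral>\<^sup>+ v. \<Phi> (plane \<eta> v) * radon_nn j H (direction (plane \<eta> v)) (foot (plane \<eta> v)) \<partial>subspace_lborel (\<eta>\<^sup>\<bottom>) \<partial>grassmannian_measure k UNIV)"
    by (rule nn_integral_plane_lborel[OF k(1)]) (intro borel_measurable_times_ennreal \<Phi> measurable_radon_nn[OF H])
  also have "\<dots> = (\<integral>\<^sup>+ \<eta>. \<integral>\<^sup>+ \<xi>. \<integral>\<^sup>+ x. plane_ext k \<Phi> \<eta> x * plane_ext j H \<xi> x \<partial>lborel \<partial>random_subspace j (\<eta>\<^sup>\<bottom>) \<partial>grassmannian_measure k UNIV)"
  proof (rule nn_integral_cong)
    fix \<eta> :: "'a set" assume "\<eta> \<in> space (grassmannian_measure k UNIV)"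
    then have \<eta>: "\<eta> \<in> grassmannian k UNIV" by (simp add: space_grassmannian_measure[OF subspace_UNIV k(2)])
    note s = grassmannianD(1)[OF \<eta>]
    note E = subspace_orthogonal_comp[of \<eta>] and d = le_dim_perp[OF \<eta>]
    let ?G = "grassmannian_measure j (\<eta>\<^sup>\<bottom>)" and ?L = "subspace_lborel \<eta>" and ?L' = "subspace_lborel (\<eta>\<^sup>\<bottom>)"
    interpret G: prob_space ?G by (rule prob_space_grassmannian_measure[OF E d])
    interpret L: sigma_finite_measure ?L by (rule sigma_finite_subspace_lborel[OF s])
    interpret L': sigma_finite_measure ?L' by (rule sigma_finite_subspace_lborel[OF E])
    interpret P: pair_sigma_finite ?G ?L' ..
    have spG: "space ?G = grassmannian j (\<eta>\<^sup>\<bottom>)" by (rule space_grassmannian_measure[OF E d])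
    have spL: "space ?L = \<eta>" "space ?L' = \<eta>\<^sup>\<bottom>" by (simp_all add: space_subspace_lborel s E)
    have [simp]: "subspace \<eta>" by fact
    note [measurable] = measurable_subspace_lborel_ident[OF s] measurable_subspace_lborel_ident[OF E] measurable_grassmannian_ident[OF E d]
    have "(\<integral>\<^sup>+ v. \<Phi> (plane \<eta> v) * radon_nn j H (direction (plane \<eta> v)) (foot (plane \<eta> v)) \<partial>?L') =
      (\<integral>\<^sup>+ v. \<integral>\<^sup>+ \<xi>. \<integral>\<^sup>+ u. plane_ext k \<Phi> \<eta> v * plane_ext j H \<xi> (u + v) \<partial>?L \<partial>?G \<partial>?L')"
    proof (rule nn_integral_cong)
      fix v assume "v \<in> space ?L'"
      then have v: "v \<in> \<eta>\<^sup>\<bottom>" by (simp add: spL)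
      have "radon_nn j H \<eta> v = (\<integral>\<^sup>+ \<xi>. \<integral>\<^sup>+ u. plane_ext j H \<xi> (u + v) \<partial>?L \<partial>?G)"
        unfolding radon_nn_def by (intro nn_integral_cong) (simp add: spG plane_ext_eq)
      moreover have "plane_ext k \<Phi> \<eta> v * (\<integral>\<^sup>+ \<xi>. \<integral>\<^sup>+ u. plane_ext j H \<xi> (u + v) \<partial>?L \<partial>?G) =
        (\<integral>\<^sup>+ \<xi>. plane_ext k \<Phi> \<eta> v * (\<integral>\<^sup>+ u. plane_ext j H \<xi> (u + v) \<partial>?L) \<partial>?G)"
        by (rule nn_integral_cmult[symmetric]) measurable
      moreover have "\<dots> = (\<integral>\<^sup>+ \<xi>. \<integral>\<^sup>+ u. plane_ext k \<Phi> \<eta> v * plane_ext j H \<xi> (u + v) \<partial>?L \<partial>?G)"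
      proof (intro nn_integral_cong nn_integral_cmult[symmetric])
        fix \<xi> assume "\<xi> \<in> space ?G"
        then have [simp]: "subspace \<xi>" using spG grassmannianD(1) by blast
        show "(\<lambda>u. plane_ext j H \<xi> (u + v)) \<in> borel_measurable ?L" by measurable
      qed
      ultimately show "\<Phi> (plane \<eta> v) * radon_nn j H (direction (plane \<eta> v)) (foot (plane \<eta> v)) =
        (\<integral>\<^sup>+ \<xi>. \<integral>\<^sup>+ u. plane_ext k \<Phi> \<eta> v * plane_ext j H \<xi> (u + v) \<partial>?L \<partial>?G)"
        by (simp add: direction_plane foot_plane v plane_ext_eq[OF \<eta>])
    qed
    also have "\<dots> = (\<integral>\<^sup>+ \<xi>. \<integral>\<^sup>+ v. \<integral>\<^sup>+ u. plane_ext k \<Phi> \<eta> v * plane_ext j H \<xi> (u + v) \<partial>?L \<partial>?L' \<partial>?G)"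
      by (rule P.Fubini') measurable
    also have "\<dots> = (\<integral>\<^sup>+ \<xi>. \<integral>\<^sup>+ x. plane_ext k \<Phi> \<eta> x * plane_ext j H \<xi> x \<partial>lborel \<partial>?G)"
    proof (rule nn_integral_cong)
      fix \<xi> assume "\<xi> \<in> space ?G"
      then have [simp]: "subspace \<xi>" using spG grassmannianD(1) by blast
      have "(\<integral>\<^sup>+ x. plane_ext k \<Phi> \<eta> x * plane_ext j H \<xi> x \<partial>lborel) =
        (\<integral>\<^sup>+ v. \<integral>\<^sup>+ u. plane_ext k \<Phi> \<eta> (v + u) * plane_ext j H \<xi> (v + u) \<partial>subspace_lborel (\<eta>\<^sup>\<bottom>\<^sup>\<bottom>) \<partial>?L')"
        by (rule nn_integral_lborel_decomp[OF E]) measurable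
      also have "\<dots> = (\<integral>\<^sup>+ v. \<integral>\<^sup>+ u. plane_ext k \<Phi> \<eta> v * plane_ext j H \<xi> (u + v) \<partial>?L \<partial>?L')"
        unfolding orthogonal_comp_self[OF s]
      proof (intro nn_integral_cong)
        fix v u assume "u \<in> space ?L"
        then have "plane \<eta> (v + u) = plane \<eta> v" by (simp add: spL plane_absorb[OF s])
        then show "plane_ext k \<Phi> \<eta> (v + u) * plane_ext j H \<xi> (v + u) = plane_ext k \<Phi> \<eta> v * plane_ext j H \<xi> (u + v)"
          by (simp only: plane_ext_eq[OF \<eta>] add.commute[of u v])
      qed
      finally show "(\<integral>\<^sup>+ v. \<integral>\<^sup>+ u. plane_ext k \<Phi> \<eta> v * plane_ext j H \<xi> (u + v) \<partial>?L \<partial>?L') =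
        (\<integral>\<^sup>+ x. plane_ext k \<Phi> \<eta> x * plane_ext j H \<xi> x \<partial>lborel)" ..
    qed
    finally show "(\<integral>\<^sup>+ v. \<Phi> (plane \<eta> v) * radon_nn j H (direction (plane \<eta> v)) (foot (plane \<eta> v)) \<partial>?L') =
      (\<integral>\<^sup>+ \<xi>. \<integral>\<^sup>+ x. plane_ext k \<Phi> \<eta> x * plane_ext j H \<xi> x \<partial>lborel \<partial>random_subspace j (\<eta>\<^sup>\<bottom>))"
      by (simp add: nn_integral_grassmannian_measure[OF E d])
  qed
  also have "\<dots> = (\<integral>\<^sup>+ \<eta>. \<integral>\<^sup>+ \<xi>. \<integral>\<^sup>+ x. plane_ext k \<Phi> \<eta> x * plane_ext j H \<xi> x \<partial>lborel \<partial>random_subspace j (\<eta>\<^sup>\<bottom>) \<partial>random_subspace k UNIV)"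
    by (simp add: nn_integral_grassmannian_measure[OF subspace_UNIV k(2)])
  also have "\<dots> = (\<integral>\<^sup>+ \<xi>. \<integral>\<^sup>+ \<eta>. \<integral>\<^sup>+ x. plane_ext k \<Phi> \<eta> x * plane_ext j H \<xi> x \<partial>lborel \<partial>random_subspace k (\<xi>\<^sup>\<bottom>) \<partial>random_subspace j UNIV)"
    using nn_integral_orthogonal_pairs_swap[OF G jk] by simp
  finally show ?thesis .
qed

text \<open>Split x = y + z with y in the complement of \<xi> and z in \<xi>. Since \<eta> is
  orthogonal to \<xi>, the squared distance from x to \<eta> is |y - P y|^2 + |z|^2 with P the
  projection to \<eta>, so |\<eta> + x| \<le> R bounds both terms. The z-integral contributes the
  volume \<open>unit_ball_vol j * R ^ j\<close>, the \<eta>-integral contributes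
  \<open>near_prob\<close>.\<close>

lemma radon_nn_ball_le:
  fixes H :: "'a set \<Rightarrow> ennreal"
  assumes H: "H \<in> borel_measurable (plane_borel j)" and R: "R > 0"
  shows "(\<integral>\<^sup>+ \<zeta>. indicator {\<zeta>. plane_norm \<zeta> \<le> R} \<zeta> * radon_nn j H (direction \<zeta>) (foot \<zeta>) \<partial>plane_lborel k) \<le>
    ennreal (unit_ball_vol j * R ^ j) * (\<integral>\<^sup>+ \<tau>. H \<tau> * near_prob k R \<tau> \<partial>plane_lborel j)" (is "?lhs \<le> ?c * ?rhs")
proof -
  let ?\<Phi> = "indicator {\<zeta>. plane_norm \<zeta> \<le> R} :: 'a set \<Rightarrow> ennreal"
  have jd: "j \<le> dim (UNIV :: 'a set)" using jk by simp
  have \<Phi>: "?\<Phi> \<in> borel_measurable (plane_borel k)"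
  proof -
    have "(\<lambda>\<zeta>. if plane_norm \<zeta> \<le> R then 1 else 0 :: ennreal) \<in> borel_measurable (plane_borel k :: 'a set measure)" by measurable
    then show ?thesis by (simp add: indicator_def[abs_def])
  qed
  note [measurable] = measurable_plane_ext[OF H] measurable_plane_ext[OF \<Phi>]
  have "?lhs = (\<integral>\<^sup>+ \<xi>. \<integral>\<^sup>+ \<eta>. \<integral>\<^sup>+ x. plane_ext k ?\<Phi> \<eta> x * plane_ext j H \<xi> x \<partial>lborel \<partial>random_subspace k (\<xi>\<^sup>\<bottom>) \<partial>random_subspace j UNIV)"
    by (rule radon_nn_duality[OF H \<Phi>])
  also have "\<dots> = (\<integral>\<^sup>+ \<xi>. \<integral>\<^sup>+ \<eta>. \<integral>\<^sup>+ x. plane_ext k ?\<Phi> \<eta> x * plane_ext j H \<xi> x \<partial>lborel \<partial>random_subspace k (\<xi>\<^sup>\<bottom>) \<partial>grassmannian_measure j UNIV)"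
    by (simp add: nn_integral_grassmannian_measure[OF subspace_UNIV jd])
  also have "\<dots> \<le> (\<integral>\<^sup>+ \<xi>. \<integral>\<^sup>+ y. ?c * (H (plane \<xi> y) * near_prob k R (plane \<xi> y))
      \<partial>subspace_lborel (\<xi>\<^sup>\<bottom>) \<partial>grassmannian_measure j UNIV)"
  proof (rule nn_integral_mono)
    fix \<xi> :: "'a set" assume "\<xi> \<in> space (grassmannian_measure j UNIV)"
    then have \<xi>: "\<xi> \<in> grassmannian j UNIV" by (simp add: space_grassmannian_measure[OF subspace_UNIV jd])
    note s = grassmannianD(1)[OF \<xi>] and E = subspace_orthogonal_comp[of \<xi>]
    have d: "k \<le> dim (\<xi>\<^sup>\<bottom>)" using dim_orthogonal_comp[OF s] grassmannianD(3)[OF \<xi>] jk by simp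
    let ?L = "subspace_lborel \<xi>" and ?L' = "subspace_lborel (\<xi>\<^sup>\<bottom>)" and ?R = "random_subspace k (\<xi>\<^sup>\<bottom>)"
    interpret R: prob_space ?R by (rule prob_space_random_subspace[OF E])
    interpret L: sigma_finite_measure ?L by (rule sigma_finite_subspace_lborel[OF s])
    interpret L': sigma_finite_measure ?L' by (rule sigma_finite_subspace_lborel[OF E])
    interpret P: pair_sigma_finite ?R ?L' ..
    have spL: "space ?L = \<xi>" "space ?L' = \<xi>\<^sup>\<bottom>" by (simp_all add: space_subspace_lborel s E)
    have [simp]: "subspace \<xi>" by fact
    note [measurable] = measurable_subspace_lborel_ident[OF s] measurable_subspace_lborel_ident[OF E]
    note [measurable_cong] = sets_random_subspace[OF E]
    define b :: "'a set \<Rightarrow> 'a \<Rightarrow> ennreal" where "b \<eta> y = (if norm (y - proj \<eta> y) \<le> R then 1 else 0)" for \<eta> y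
    have bm[measurable]: "(\<lambda>(\<eta>, x). b \<eta> x) \<in> borel_measurable (subspace_borel \<Otimes>\<^sub>M borel)"
      unfolding b_def by measurable
    have [measurable]: "fst \<in> ?R \<Otimes>\<^sub>M ?L' \<rightarrow>\<^sub>M subspace_borel" "snd \<in> ?R \<Otimes>\<^sub>M ?L' \<rightarrow>\<^sub>M borel"
      by (rule measurable_compose[OF measurable_fst measurable_ident_sets[OF sets_random_subspace[OF E]]],
          rule measurable_compose[OF measurable_snd measurable_subspace_lborel_ident[OF E]])
    have [measurable]: "(\<lambda>p. b (fst p) (snd p)) \<in> borel_measurable (?R \<Otimes>\<^sub>M ?L')"
      unfolding b_def by measurable
    have near: "near_prob k R (plane \<xi> y) = (\<integral>\<^sup>+ \<eta>. b \<eta> y \<partial>?R)" if "y \<in> \<xi>\<^sup>\<bottom>" for y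
      unfolding near_prob_eq b_def by (simp add: direction_plane foot_plane that)
    have vol: "(\<integral>\<^sup>+ z. indicator {z \<in> \<xi>. norm z \<le> R} z \<partial>?L) = ?c"
      using emeasure_subspace_lborel_cball[OF s R] grassmannianD(3)[OF \<xi>]
      by (subst nn_integral_indicator) (simp_all add: sets_subspace_lborel[OF s] sets_restrict_space_cball)
    have Hp: "plane_ext j H \<xi> y = H (plane \<xi> y)" for y by (rule plane_ext_eq[OF \<xi>])
    have Hm: "(\<lambda>y. H (plane \<xi> y)) \<in> borel_measurable borel"
      unfolding Hp[symmetric] by measurable
    note [measurable] = Hm
    have "(\<integral>\<^sup>+ \<eta>. \<integral>\<^sup>+ x. plane_ext k ?\<Phi> \<eta> x * plane_ext j H \<xi> x \<partial>lborel \<partial>?R) \<le>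
      (\<integral>\<^sup>+ \<eta>. \<integral>\<^sup>+ y. ?c * (H (plane \<xi> y) * b \<eta> y) \<partial>?L' \<partial>?R)"
    proof (rule nn_integral_mono_AE, use AE_random_subspace_grassmannian[OF E d] in eventually_elim)
      case (elim \<eta>)
      note \<eta> = grassmannianD[OF elim]
      have [simp]: "subspace \<eta>" by fact
      have "(\<integral>\<^sup>+ x. plane_ext k ?\<Phi> \<eta> x * plane_ext j H \<xi> x \<partial>lborel) =
        (\<integral>\<^sup>+ y. \<integral>\<^sup>+ z. plane_ext k ?\<Phi> \<eta> (y + z) * plane_ext j H \<xi> (y + z) \<partial>subspace_lborel (\<xi>\<^sup>\<bottom>\<^sup>\<bottom>) \<partial>?L')"
        by (rule nn_integral_lborel_decomp[OF E]) measurable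
      also have "\<dots> \<le> (\<integral>\<^sup>+ y. \<integral>\<^sup>+ z. (H (plane \<xi> y) * b \<eta> y) * indicator {z \<in> \<xi>. norm z \<le> R} z \<partial>?L \<partial>?L')"
        unfolding orthogonal_comp_self[OF s]
      proof (intro nn_integral_mono)
        fix y z assume "y \<in> space ?L'" "z \<in> space ?L"
        then have yz: "y \<in> \<xi>\<^sup>\<bottom>" "z \<in> \<xi>" by (simp_all add: spL)
        have z0: "proj \<eta> z = 0" 
          by (rule proj_perp[OF \<eta>(1)]) (use orthogonal_comp_swap[OF \<eta>(2)] yz in auto)
        have "y - proj \<eta> y \<in> \<xi>\<^sup>\<bottom>" using yz(1) proj_in[OF \<eta>(1), of y] \<eta>(2) by (intro subspace_diff[OF E]) auto
        then have "orthogonal (y - proj \<eta> y) z" using yz(2) unfolding orthogonal_def by (rule orthogonal_compD(1))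
        from norm_add_Pythagorean[OF this]
        have N: "(norm (y + z - proj \<eta> (y + z)))\<^sup>2 = (norm (y - proj \<eta> y))\<^sup>2 + (norm z)\<^sup>2"
          by (simp add: blinfun.add_right z0 algebra_simps)
        have le: "norm (y - proj \<eta> y) \<le> norm (y + z - proj \<eta> (y + z))" "norm z \<le> norm (y + z - proj \<eta> (y + z))"
          by (rule power2_le_imp_le; simp add: N)+
        have H1: "plane_ext j H \<xi> (y + z) = H (plane \<xi> y)"
          unfolding plane_ext_eq[OF \<xi>] plane_absorb[OF s yz(2)] ..
        have P1: "plane_ext k ?\<Phi> \<eta> (y + z) = (if norm (y + z - proj \<eta> (y + z)) \<le> R then 1 else 0)"
          unfolding plane_ext_eq[OF elim] by (simp add: indicator_def plane_norm_eq[OF \<eta>(1)])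
        show "plane_ext k ?\<Phi> \<eta> (y + z) * plane_ext j H \<xi> (y + z) \<le> H (plane \<xi> y) * b \<eta> y * indicator {z \<in> \<xi>. norm z \<le> R} z"
          using yz(2) le unfolding H1 P1 by (simp add: b_def)
      qed
      also have "\<dots> = (\<integral>\<^sup>+ y. ?c * (H (plane \<xi> y) * b \<eta> y) \<partial>?L')"
      proof (rule nn_integral_cong)
        fix y
        have "(indicator {z \<in> \<xi>. norm z \<le> R} :: 'a \<Rightarrow> ennreal) \<in> borel_measurable ?L"
          by (rule borel_measurable_indicator) (simp add: sets_subspace_lborel[OF s] sets_restrict_space_cball)
        then show "(\<integral>\<^sup>+ z. (H (plane \<xi> y) * b \<eta> y) * indicator {z \<in> \<xi>. norm z \<le> R} z \<partial>?L) = ?c * (H (plane \<xi> y) * b \<eta> y)"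
          by (subst nn_integral_cmult) (simp_all add: vol mult.commute)
      qed
      finally show ?case .
    qed
    also have "\<dots> = (\<integral>\<^sup>+ y. \<integral>\<^sup>+ \<eta>. ?c * (H (plane \<xi> y) * b \<eta> y) \<partial>?R \<partial>?L')"
      by (rule P.Fubini'[symmetric]) measurable
    also have "\<dots> = (\<integral>\<^sup>+ y. ?c * (H (plane \<xi> y) * near_prob k R (plane \<xi> y)) \<partial>?L')"
      by (intro nn_integral_cong) (simp add: nn_integral_cmult near spL)
    finally show "(\<integral>\<^sup>+ \<eta>. \<integral>\<^sup>+ x. plane_ext k ?\<Phi> \<eta> x * plane_ext j H \<xi> x \<partial>lborel \<partial>?R) \<le>
      (\<integral>\<^sup>+ y. ?c * (H (plane \<xi> y) * near_prob k R (plane \<xi> y)) \<partial>?L')" .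
  qed
  also have "\<dots> = (\<integral>\<^sup>+ \<tau>. ?c * (H \<tau> * near_prob k R \<tau>) \<partial>plane_lborel j)"
    by (rule nn_integral_plane_lborel[symmetric]) (use H jk in simp_all)
  also have "\<dots> = ?c * ?rhs"
    by (rule nn_integral_cmult) (use H in simp)
  finally show ?thesis .
qed

end

section \<open>Finiteness almost everywhere\<close>

definition tail_weight :: "nat \<Rightarrow> nat \<Rightarrow> 'a::euclidean_space set \<Rightarrow> real" where
  "tail_weight j k \<tau> = plane_norm \<tau> powi (int k + int j - int DIM('a))"

lemma tail_weight_nonneg: "0 \<le> tail_weight j k \<tau>"
  by (simp add: tail_weight_def infdist_nonneg zero_le_power_int)

lemma measurable_tail_weight[measurable]: "tail_weight j k \<in> borel_measurable (plane_borel i :: 'a::euclidean_space set measure)"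
proof -
  have "(\<lambda>t::real. t powi n) \<in> borel_measurable borel" for n :: int
    unfolding power_int_def by measurable
  from measurable_compose[OF measurable_plane_norm this] show ?thesis
    unfolding tail_weight_def[abs_def] .
qed

lemma sets_plane_norm[measurable]:
  "{\<tau>. plane_norm \<tau> \<le> a} \<inter> affine_grassmannian j \<in> sets (plane_borel j :: 'a::euclidean_space set measure)"
  "{\<tau>. plane_norm \<tau> > a} \<inter> affine_grassmannian j \<in> sets (plane_borel j :: 'a::euclidean_space set measure)"
proof -
  have "{\<tau> \<in> space (plane_borel j :: 'a set measure). plane_norm \<tau> \<le> a} \<in> sets (plane_borel j)"
    "{\<tau> \<in> space (plane_borel j :: 'a set measure). plane_norm \<tau> > a} \<in> sets (plane_borel j)" by measurable
  then show "{\<tau>. plane_norm \<tau> \<le> a} \<inter> affine_grassmannian j \<in> sets (plane_borel j :: 'a set measure)"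
    "{\<tau>. plane_norm \<tau> > a} \<inter> affine_grassmannian j \<in> sets (plane_borel j :: 'a set measure)"
    by (simp_all add: Int_def conj_commute)
qed

lemma indicator_plane_norm[measurable]:
  "indicator {\<tau>. plane_norm \<tau> \<le> a} \<in> borel_measurable (plane_borel j :: 'a::euclidean_space set measure)"
  "indicator {\<tau>. plane_norm \<tau> > a} \<in> borel_measurable (plane_borel j :: 'a::euclidean_space set measure)"
  using sets_plane_norm by (simp_all add: borel_measurable_indicator_iff)

context
  fixes j k :: nat
  assumes jk: "j + k \<le> DIM('a::euclidean_space)"
begin

text \<open>The exponent is minus the codimension n - j - k of \<eta> in
  \<open>\<xi>\<^sup>\<bottom>\<close>. The bound 1 serves near the origin, where local
  integrability controls f. The power bound is restricted to |\<tau>| > 0, because 0 to a negative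
  power is 0 here, while a plane through the origin has probability 1.\<close>

lemma near_prob_le:
  fixes \<tau> :: "'a set"
  assumes \<tau>: "\<tau> \<in> affine_grassmannian j" and R: "R > 0"
  defines "C \<equiv> unit_ball_vol (DIM('a) - j - k) * unit_ball_vol (DIM('a) - (DIM('a) - j - k)) / unit_ball_vol DIM('a) * R ^ (DIM('a) - j - k)"
  shows "near_prob k R \<tau> \<le> 1" and "plane_norm \<tau> > 0 \<Longrightarrow> near_prob k R \<tau> \<le> ennreal (C * tail_weight j k \<tau>)"
proof -
  obtain \<xi> u where \<xi>: "\<xi> \<in> grassmannian j UNIV" "u \<in> \<xi>\<^sup>\<bottom>" "\<tau> = plane \<xi> u" "direction \<tau> = \<xi>" "foot \<tau> = u"
    by (rule affine_grassmannianE[OF \<tau>])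
  note s = grassmannianD(1)[OF \<xi>(1)] and E = subspace_orthogonal_comp[of \<xi>]
  have d: "dim (\<xi>\<^sup>\<bottom>) = DIM('a) - j" "k \<le> dim (\<xi>\<^sup>\<bottom>)"
    using dim_orthogonal_comp[OF s] grassmannianD(3)[OF \<xi>(1)] jk by simp_all
  interpret prob_space "random_subspace k (\<xi>\<^sup>\<bottom>)" by (rule prob_space_random_subspace[OF E])
  show "near_prob k R \<tau> \<le> 1" unfolding near_prob_def \<xi>(4) by (rule emeasure_le_1)
  assume pos: "plane_norm \<tau> > 0"
  have n: "plane_norm \<tau> = norm u" using plane_norm_plane[OF s \<xi>(2)] \<xi>(3) by simp
  let ?m = "DIM('a) - j - k"
  have e: "int k + int j - int DIM('a) = - int ?m" using jk by simp
  have "near_prob k R \<tau> \<le> ennreal (unit_ball_vol ?m * unit_ball_vol (DIM('a) - ?m) / unit_ball_vol DIM('a) * (R / norm u) ^ ?m)"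
    using random_subspace_near[OF E d(2) \<xi>(2) _ R] pos n unfolding near_prob_def \<xi>(4,5) d(1) by auto
  also have "\<dots> = ennreal (C * tail_weight j k \<tau>)"
    unfolding C_def tail_weight_def n e by (simp add: power_int_minus divide_inverse power_mult_distrib power_inverse mult_ac)
  finally show "near_prob k R \<tau> \<le> ennreal (C * tail_weight j k \<tau>)" .
qed

text \<open>The two hypotheses match the two bounds on \<open>near_prob\<close>. Integrability over
  |\<zeta>| \<le> R gives finiteness almost everywhere there, and countably many radii exhaust all
  planes.\<close>

lemma AE_radon_nn_finite:
  fixes H :: "'a set \<Rightarrow> ennreal"
  assumes H[measurable]: "H \<in> borel_measurable (plane_borel j)" and a: "a > 0"
    and fin: "(\<integral>\<^sup>+ \<tau>. H \<tau> * indicator {\<tau>. plane_norm \<tau> \<le> a} \<tau> \<partial>plane_lborel j) < \<infinity>"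
      "(\<integral>\<^sup>+ \<tau>. H \<tau> * ennreal (tail_weight j k \<tau>) * indicator {\<tau>. plane_norm \<tau> > a} \<tau> \<partial>plane_lborel j) < \<infinity>"
  shows "AE \<zeta> in plane_lborel k. radon_nn j H (direction \<zeta>) (foot \<zeta>) < \<infinity>"
proof -
  have "AE \<zeta> in plane_lborel k. plane_norm \<zeta> \<le> real (Suc n) \<longrightarrow> radon_nn j H (direction \<zeta>) (foot \<zeta>) < \<infinity>" for n
  proof -
    let ?R = "real (Suc n)"
    have R: "?R > 0" by simp
    let ?m = "DIM('a) - j - k"
    define C where "C = unit_ball_vol ?m * unit_ball_vol (DIM('a) - ?m) / unit_ball_vol DIM('a) * ?R ^ ?m"
    have C0: "C \<ge> 0" by (simp add: C_def)
    have "(\<integral>\<^sup>+ \<tau>. H \<tau> * near_prob k ?R \<tau> \<partial>plane_lborel j) \<le>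
      (\<integral>\<^sup>+ \<tau>. H \<tau> * indicator {\<tau>. plane_norm \<tau> \<le> a} \<tau> + ennreal C * (H \<tau> * ennreal (tail_weight j k \<tau>) * indicator {\<tau>. plane_norm \<tau> > a} \<tau>) \<partial>plane_lborel j)"
    proof (rule nn_integral_mono)
      fix \<tau> :: "'a set" assume "\<tau> \<in> space (plane_lborel j)"
      then have \<tau>: "\<tau> \<in> affine_grassmannian j" by simp
      show "H \<tau> * near_prob k ?R \<tau> \<le> H \<tau> * indicator {\<tau>. plane_norm \<tau> \<le> a} \<tau> + ennreal C * (H \<tau> * ennreal (tail_weight j k \<tau>) * indicator {\<tau>. plane_norm \<tau> > a} \<tau>)"
      proof (cases "plane_norm \<tau> \<le> a")
        case True
        then show ?thesis using mult_left_mono[OF near_prob_le(1)[OF \<tau> R], of "H \<tau>"] by simp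
      next
        case False
        then have "near_prob k ?R \<tau> \<le> ennreal (C * tail_weight j k \<tau>)"
          using near_prob_le(2)[OF \<tau> R] a unfolding C_def by simp
        also have "\<dots> = ennreal C * ennreal (tail_weight j k \<tau>)" by (rule ennreal_mult[OF C0 tail_weight_nonneg])
        finally have "H \<tau> * near_prob k ?R \<tau> \<le> H \<tau> * (ennreal C * ennreal (tail_weight j k \<tau>))"
          by (rule mult_left_mono) simp
        then show ?thesis using False by (simp add: mult.left_commute)
      qed
    qed
    also have "\<dots> = (\<integral>\<^sup>+ \<tau>. H \<tau> * indicator {\<tau>. plane_norm \<tau> \<le> a} \<tau> \<partial>plane_lborel j) +
      ennreal C * (\<integral>\<^sup>+ \<tau>. H \<tau> * ennreal (tail_weight j k \<tau>) * indicator {\<tau>. plane_norm \<tau> > a} \<tau> \<partial>plane_lborel j)"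
      by (subst nn_integral_add) (measurable, simp add: nn_integral_cmult)
    also have "\<dots> < \<infinity>" using fin by (simp add: ennreal_mult_less_top)
    finally have "(\<integral>\<^sup>+ \<zeta>. indicator {\<zeta>. plane_norm \<zeta> \<le> ?R} \<zeta> * radon_nn j H (direction \<zeta>) (foot \<zeta>) \<partial>plane_lborel k) < \<infinity>"
      using radon_nn_ball_le[OF jk H R] by (auto simp: ennreal_mult_less_top intro: le_less_trans)
    then have "AE \<zeta> in plane_lborel k. indicator {\<zeta>. plane_norm \<zeta> \<le> ?R} \<zeta> * radon_nn j H (direction \<zeta>) (foot \<zeta>) \<noteq> \<infinity>"
      using measurable_radon_nn[OF jk H]
      by (intro nn_integral_PInf_AE) (auto intro!: borel_measurable_times_ennreal simp: less_top[symmetric])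
    then show ?thesis by eventually_elim (auto simp: less_top)
  qed
  then have "AE \<zeta> in plane_lborel k. \<forall>n. plane_norm \<zeta> \<le> real (Suc n) \<longrightarrow> radon_nn j H (direction \<zeta>) (foot \<zeta>) < \<infinity>"
    unfolding AE_all_countable by blast
  then show ?thesis
  proof eventually_elim
    case (elim \<zeta>)
    obtain n where "plane_norm \<zeta> \<le> real n" using real_arch_simple by blast
    then have "plane_norm \<zeta> \<le> real (Suc n)" by simp
    with elim show ?case by blast
  qed
qed

end

section \<open>Completions, and compactness of the set of planes near the origin\<close>

text \<open>The preimages under \<open>f\<close> and \<open>f'\<close> differ by a null set of the
  completion, and the completion contains every set that differs from a measurable one in this
  way.\<close>

lemma measurable_completion_AE:
  assumes f': "f' \<in> M \<rightarrow>\<^sub>M N" and AE: "AE x in M. f x = f' x" and f: "\<And>x. x \<in> space M \<Longrightarrow> f x \<in> space N"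
  shows "f \<in> completion M \<rightarrow>\<^sub>M N"
proof (rule measurableI)
  fix A assume A: "A \<in> sets N"
  show "f -` A \<inter> space (completion M) \<in> sets (completion M)"
  proof (rule completion.in_sets_AE)
    show "AE x in completion M. x \<in> f' -` A \<inter> space M \<longleftrightarrow> x \<in> f -` A \<inter> space (completion M)"
      using AE_completion[OF AE] by eventually_elim simp
    show "f' -` A \<inter> space M \<in> sets (completion M)" using measurable_sets[OF f' A] by simp
  qed simp
qed (use f in simp)

text \<open>Orthogonal projections of rank j are the symmetric idempotents of trace j, and each of
  these conditions is closed in \<open>Q\<close>. Symmetry is required on basis vectors, a finite
  number of equations, and extends by linearity.\<close>

lemma orth_proj_grassmannian:
  "orth_proj ` grassmannian j (UNIV :: 'a::euclidean_space set) =
    {Q. Q o\<^sub>L Q = Q \<and> (\<forall>x\<in>Basis. \<forall>y\<in>Basis. Q x \<bullet> y = x \<bullet> Q y) \<and> (\<Sum>b\<in>Basis. Q b \<bullet> b) = real j}"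
proof (intro subset_antisym subsetI)
  fix Q :: "'a \<Rightarrow>\<^sub>L 'a" assume "Q \<in> orth_proj ` grassmannian j UNIV"
  then obtain \<xi> where \<xi>: "subspace \<xi>" "dim \<xi> = j" "Q = orth_proj \<xi>" by (auto simp: grassmannian_def)
  have "Q o\<^sub>L Q = Q"
    by (rule blinfun_eqI) (simp add: \<xi>(3) proj_self proj_in \<xi>(1))
  then show "Q \<in> {Q. Q o\<^sub>L Q = Q \<and> (\<forall>x\<in>Basis. \<forall>y\<in>Basis. Q x \<bullet> y = x \<bullet> Q y) \<and> (\<Sum>b\<in>Basis. Q b \<bullet> b) = real j}"
    using trace_proj[OF \<xi>(1)] \<xi>(2) by (simp add: \<xi>(3) inner_proj_commute[OF \<xi>(1)])
next
  fix Q :: "'a \<Rightarrow>\<^sub>L 'a" assume "Q \<in> {Q. Q o\<^sub>L Q = Q \<and> (\<forall>x\<in>Basis. \<forall>y\<in>Basis. Q x \<bullet> y = x \<bullet> Q y) \<and> (\<Sum>b\<in>Basis. Q b \<bullet> b) = real j}"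
  then have Q: "Q o\<^sub>L Q = Q" "\<And>x y. x \<in> Basis \<Longrightarrow> y \<in> Basis \<Longrightarrow> Q x \<bullet> y = x \<bullet> Q y" "(\<Sum>b\<in>Basis. Q b \<bullet> b) = real j" by auto
  have QQ: "Q (Q x) = Q x" for x by (metis Q(1) blinfun_apply_blinfun_compose)
  have sym1: "Q x \<bullet> y = x \<bullet> Q y" if "x \<in> Basis" for x y
  proof -
    have "Q x \<bullet> y = (\<Sum>b\<in>Basis. (y \<bullet> b) * (Q x \<bullet> b))"
      by (subst euclidean_inner[of "Q x" y]) (simp add: mult.commute)
    also have "\<dots> = (\<Sum>b\<in>Basis. (y \<bullet> b) * (x \<bullet> Q b))" using Q(2)[OF that] by simp
    also have "\<dots> = x \<bullet> Q (\<Sum>b\<in>Basis. (y \<bullet> b) *\<^sub>R b)" by (simp add: blinfun.sum_right blinfun.scaleR_right inner_sum_right)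
    finally show ?thesis by (simp add: euclidean_representation)
  qed
  have sym: "Q x \<bullet> y = x \<bullet> Q y" for x y
  proof -
    have "x \<bullet> Q y = (\<Sum>b\<in>Basis. (x \<bullet> b) * (b \<bullet> Q y))"
      by (subst euclidean_inner[of x "Q y"]) (simp add: inner_commute)
    also have "\<dots> = (\<Sum>b\<in>Basis. (x \<bullet> b) * (Q b \<bullet> y))" using sym1 by simp
    also have "\<dots> = Q (\<Sum>b\<in>Basis. (x \<bullet> b) *\<^sub>R b) \<bullet> y" by (simp add: blinfun.sum_right blinfun.scaleR_right inner_sum_left)
    finally show ?thesis by (simp add: euclidean_representation)
  qed
  let ?\<xi> = "range (blinfun_apply Q)"
  have s: "subspace ?\<xi>"
    by (rule linear_subspace_image[OF bounded_linear.linear[OF blinfun.bounded_linear_right] subspace_UNIV])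
  have e: "orth_proj ?\<xi> = Q"
  proof (rule blinfun_eqI, rule proj_eqI[OF s])
    fix x
    show "x - Q x \<in> ?\<xi>\<^sup>\<bottom>"
      by (rule orthogonal_compI) (auto simp: inner_diff_left sym QQ)
  qed simp
  have "dim ?\<xi> = j" using trace_proj[OF s] Q(3) by (simp add: e)
  then have "?\<xi> \<in> grassmannian j UNIV" using s by (simp add: grassmannian_def)
  then show "Q \<in> orth_proj ` grassmannian j UNIV" using e by (metis imageI)
qed

text \<open>The image consists of the pairs (Q, u) with Q a projection of rank j, Q u = 0 and |u|
  \<le> a, a closed and bounded set in finite dimension. So local integrability yields integrability
  over |\<tau>| \<le> a.\<close>

lemma compact_plane_coord:
  "compact (plane_coord ` ({\<tau>. plane_norm \<tau> \<le> a} \<inter> affine_grassmannian j :: 'a::euclidean_space set set))"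
proof -
  let ?K = "plane_coord ` ({\<tau>. plane_norm \<tau> \<le> a} \<inter> affine_grassmannian j :: 'a set set)"
  let ?G = "orth_proj ` grassmannian j (UNIV :: 'a set)"
  have eq: "?K = {p. fst p \<in> ?G \<and> blinfun_apply (fst p) (snd p) = 0 \<and> norm (snd p) \<le> a}"
  proof (intro subset_antisym subsetI)
    fix p assume "p \<in> ?K"
    then obtain \<tau> where \<tau>: "\<tau> \<in> affine_grassmannian j" "plane_norm \<tau> \<le> a" "p = plane_coord \<tau>" by auto
    obtain \<xi> u where \<xi>: "\<xi> \<in> grassmannian j UNIV" "u \<in> \<xi>\<^sup>\<bottom>" "\<tau> = plane \<xi> u" "direction \<tau> = \<xi>" "foot \<tau> = u"
      by (rule affine_grassmannianE[OF \<tau>(1)])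
    note s = grassmannianD(1)[OF \<xi>(1)]
    show "p \<in> {p. fst p \<in> ?G \<and> blinfun_apply (fst p) (snd p) = 0 \<and> norm (snd p) \<le> a}"
      using \<tau>(2) \<xi> proj_perp[OF s \<xi>(2)] plane_norm_plane[OF s \<xi>(2)] by (simp add: \<tau>(3) plane_coord_def)
  next
    fix p assume "p \<in> {p. fst p \<in> ?G \<and> blinfun_apply (fst p) (snd p) = 0 \<and> norm (snd p) \<le> a}"
    then obtain \<xi> where \<xi>: "\<xi> \<in> grassmannian j UNIV" "fst p = orth_proj \<xi>" "proj \<xi> (snd p) = 0" "norm (snd p) \<le> a" by auto
    note s = grassmannianD(1)[OF \<xi>(1)]
    have "plane_coord (plane \<xi> (snd p)) = p" "plane_norm (plane \<xi> (snd p)) \<le> a" "plane \<xi> (snd p) \<in> affine_grassmannian j"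
      using \<xi> plane_in_affine_grassmannian[OF \<xi>(1)] by (simp_all add: plane_coord_plane[OF s] plane_norm_eq[OF s] prod_eq_iff)
    then show "p \<in> ?K" by (metis IntI imageI mem_Collect_eq)
  qed
  have "closed ?G"
  proof -
    have "closed {Q :: 'a \<Rightarrow>\<^sub>L 'a. Q o\<^sub>L Q = Q}"
      by (intro closed_Collect_eq continuous_intros)
    moreover have "closed {Q :: 'a \<Rightarrow>\<^sub>L 'a. \<forall>x\<in>Basis. \<forall>y\<in>Basis. Q x \<bullet> y = x \<bullet> Q y}"
      unfolding Collect_ball_eq by (intro closed_INT ballI closed_Collect_eq continuous_intros)
    moreover have "closed {Q :: 'a \<Rightarrow>\<^sub>L 'a. (\<Sum>b\<in>Basis. Q b \<bullet> b) = real j}"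
      by (intro closed_Collect_eq continuous_intros)
    ultimately show ?thesis unfolding orth_proj_grassmannian by (intro closed_Collect_conj)
  qed
  then have "closed {p :: ('a \<Rightarrow>\<^sub>L 'a) \<times> 'a. fst p \<in> ?G}"
    using closed_vimage_fst[of ?G] by (simp add: vimage_def)
  moreover have "closed {p :: ('a \<Rightarrow>\<^sub>L 'a) \<times> 'a. blinfun_apply (fst p) (snd p) = 0}"
    by (intro closed_Collect_eq continuous_intros)
  moreover have "closed {p :: ('a \<Rightarrow>\<^sub>L 'a) \<times> 'a. norm (snd p) \<le> a}"
    by (intro closed_Collect_le continuous_intros)
  ultimately have "closed ?K" unfolding eq by (intro closed_Collect_conj)
  moreover have "bounded ?K"
  proof -
    have "?K \<subseteq> cball 0 1 \<times> cball 0 a"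
    proof
      fix p assume "p \<in> ?K"
      then obtain \<xi> where \<xi>: "\<xi> \<in> grassmannian j UNIV" "fst p = orth_proj \<xi>" "norm (snd p) \<le> a" unfolding eq by auto
      have "norm (orth_proj \<xi>) \<le> 1"
        by (rule norm_blinfun_bound) (simp_all add: norm_proj_le grassmannianD(1)[OF \<xi>(1)])
      then show "p \<in> cball 0 1 \<times> cball 0 a" using \<xi> by (simp add: mem_Times_iff)
    qed
    then show ?thesis using bounded_Times[OF bounded_cball bounded_cball] bounded_subset by blast
  qed
  ultimately show ?thesis by (simp add: compact_eq_bounded_closed)
qed

lemma locally_integrable_cball:
  fixes f :: "'a::euclidean_space set \<Rightarrow> real"
  assumes "locally_integrable j f"
  shows "integrable (plane_measure j) (\<lambda>\<tau>. indicator ({\<tau>. plane_norm \<tau> \<le> a} \<inter> affine_grassmannian j) \<tau> * f \<tau>)"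
  using assms[unfolded locally_integrable_def, rule_format, OF conjI[OF Int_lower2 compact_plane_coord]]
  by (simp add: set_integrable_def)

text \<open>Local integrability speaks only of f cut off to compact sets; f is the pointwise limit
  of its cut-offs at |\<tau>| \<le> n.\<close>

lemma locally_integrable_measurable:
  fixes f :: "'a::euclidean_space set \<Rightarrow> real"
  assumes f: "locally_integrable j f" and j: "j \<le> DIM('a)"
  shows "f \<in> borel_measurable (plane_measure j)"
proof (rule borel_measurable_LIMSEQ_real)
  let ?f = "\<lambda>n \<tau>. indicator ({\<tau>. plane_norm \<tau> \<le> real n} \<inter> affine_grassmannian j) \<tau> * f \<tau>"
  show "?f n \<in> borel_measurable (plane_measure j)" for n
    by (rule borel_measurable_integrable[OF locally_integrable_cball[OF f]])
  fix \<tau> :: "'a set" assume "\<tau> \<in> space (plane_measure j)"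
  then have \<tau>: "\<tau> \<in> affine_grassmannian j" by (simp add: plane_measure_eq[OF j])
  obtain n where n: "plane_norm \<tau> \<le> real n" using real_arch_simple by blast
  have "eventually (\<lambda>m. ?f m \<tau> = f \<tau>) sequentially"
    using eventually_ge_at_top[of n] by eventually_elim (use n \<tau> in auto)
  then show "(\<lambda>n. ?f n \<tau>) \<longlonglongrightarrow> f \<tau>" by (rule tendsto_eventually)
qed

lemma has_bochner_integral_completion_AE:
  fixes f g :: "'b \<Rightarrow> real"
  assumes g: "integrable M g" and AE: "AE x in M. f x = g x"
  shows "has_bochner_integral (completion M) f (integral\<^sup>L M g)"
proof -
  have gm: "g \<in> borel_measurable M" using g by simp
  have "has_bochner_integral (completion M) g (integral\<^sup>L M g)"
    using g by (simp add: has_bochner_integral_iff integrable_completion[OF gm] integral_completion[OF gm])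
  moreover have "f \<in> borel_measurable (completion M)"
    by (rule measurable_completion_AE[OF gm AE]) simp
  ultimately show ?thesis
    using AE_completion[OF AE] measurable_completion[OF gm] has_bochner_integral_cong_AE[of f "completion M" g] by simp
qed

text \<open>The estimate is applied to \<open>H\<close>, which equals |f| almost everywhere but is
  infinite on the null set \<open>N\<close> outside which f is the Borel function \<open>f'\<close>.
  Where its transform is finite, almost every \<xi> has a finite inner integral of \<open>H\<close>;
  for such \<xi> almost every plane avoids \<open>N\<close>, so f may be replaced by
  \<open>f'\<close>, whose integrals exist by domination.\<close>

theorem mixed_radon_finite:
  fixes f :: "'a::euclidean_space set \<Rightarrow> real"
  assumes jk: "j + k \<le> DIM('a)" and f: "locally_integrable j f" and a: "a > 0" and tail: "tail_condition j k f a"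
  shows "AE \<zeta> in plane_measure k. \<exists>r::real. has_mixed_radon j f \<zeta> (ereal r)"
proof -
  have j: "j \<le> DIM('a)" and k: "k \<le> DIM('a)" using jk by simp_all
  have fm: "f \<in> borel_measurable (completion (plane_lborel j))"
    using locally_integrable_measurable[OF f j] by (simp add: plane_measure_eq[OF j])
  obtain f' where f': "f' \<in> borel_measurable (plane_lborel j)" and AE: "AE \<tau> in plane_lborel j. f \<tau> = f' \<tau>"
    using completion_ex_borel_measurable_real[OF fm] by blast
  obtain N where N: "N \<in> null_sets (plane_lborel j)" "{\<tau> \<in> space (plane_lborel j). f \<tau> \<noteq> f' \<tau>} \<subseteq> N"
    using AE unfolding eventually_ae_filter by auto
  have ff': "f \<tau> = f' \<tau>" if "\<tau> \<in> affine_grassmannian j" "\<tau> \<notin> N" for \<tau> using N(2) that by auto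
  have f'm[measurable]: "f' \<in> borel_measurable (plane_borel j)" using f' by (simp cong: measurable_cong_sets)
  have [measurable]: "N \<in> sets (plane_borel j)" using N(1) by auto
  \<comment> \<open>\<open>\<infinity> * 0 = 0\<close>, so off \<open>N\<close> this is just
    |f'|.\<close>
  define H where "H \<tau> = ennreal \<bar>f' \<tau>\<bar> + \<infinity> * indicator N \<tau>" for \<tau>
  have H[measurable]: "H \<in> borel_measurable (plane_borel j)" unfolding H_def by measurable
  have AEN: "AE \<tau> in plane_lborel j. H \<tau> = ennreal \<bar>f \<tau>\<bar>"
    using AE_not_in[OF N(1)] AE by eventually_elim (simp add: H_def)
  have "(\<integral>\<^sup>+ \<tau>. H \<tau> * indicator {\<tau>. plane_norm \<tau> \<le> a} \<tau> \<partial>plane_lborel j) =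
    (\<integral>\<^sup>+ \<tau>. ennreal (norm (indicator ({\<tau>. plane_norm \<tau> \<le> a} \<inter> affine_grassmannian j) \<tau> * f \<tau>)) \<partial>plane_lborel j)"
    by (rule nn_integral_cong_AE, use AEN AE_space in eventually_elim) (auto simp: indicator_def)
  also have "\<dots> < \<infinity>"
    using locally_integrable_cball[OF f, of a]
    by (simp add: integrable_iff_bounded plane_measure_eq[OF j] nn_integral_completion)
  finally have 1: "(\<integral>\<^sup>+ \<tau>. H \<tau> * indicator {\<tau>. plane_norm \<tau> \<le> a} \<tau> \<partial>plane_lborel j) < \<infinity>" .
  have "(\<integral>\<^sup>+ \<tau>. H \<tau> * ennreal (tail_weight j k \<tau>) * indicator {\<tau>. plane_norm \<tau> > a} \<tau> \<partial>plane_lborel j) =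
    (\<integral>\<^sup>+ \<tau>. ennreal (\<bar>f \<tau>\<bar> * tail_weight j k \<tau>) * indicator {\<tau>. plane_norm \<tau> > a} \<tau> \<partial>plane_lborel j)"
    by (rule nn_integral_cong_AE, use AEN in eventually_elim) (simp add: ennreal_mult tail_weight_nonneg)
  also have "\<dots> < \<infinity>"
    using tail by (simp add: tail_condition_def tail_weight_def plane_measure_eq[OF j] nn_integral_completion)
  finally have 2: "(\<integral>\<^sup>+ \<tau>. H \<tau> * ennreal (tail_weight j k \<tau>) * indicator {\<tau>. plane_norm \<tau> > a} \<tau> \<partial>plane_lborel j) < \<infinity>" .
  have "AE \<zeta> in plane_lborel k. \<exists>r::real. has_mixed_radon j f \<zeta> (ereal r)"
    using AE_radon_nn_finite[OF jk H a 1 2] AE_space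
  proof eventually_elim
    case (elim \<zeta>)
    obtain \<eta> v where \<eta>: "\<eta> \<in> grassmannian k UNIV" "v \<in> \<eta>\<^sup>\<bottom>" "\<zeta> = plane \<eta> v" "direction \<zeta> = \<eta>" "foot \<zeta> = v"
      using elim(2) by (auto elim: affine_grassmannianE)
    have rf: "radon_nn j H \<eta> v < \<infinity>" using elim(1) \<eta> by simp
    note s = grassmannianD(1)[OF \<eta>(1)] and E = subspace_orthogonal_comp[of \<eta>] and d = le_dim_perp[OF jk \<eta>(1)]
    let ?G = "grassmannian_measure j (\<eta>\<^sup>\<bottom>)" and ?L = "subspace_lborel \<eta>"
    interpret G: prob_space ?G by (rule prob_space_grassmannian_measure[OF E d])
    interpret L: sigma_finite_measure ?L by (rule sigma_finite_subspace_lborel[OF s])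
    have spG: "space ?G = grassmannian j (\<eta>\<^sup>\<bottom>)" by (rule space_grassmannian_measure[OF E d])
    have spL: "space ?L = \<eta>" by (simp add: space_subspace_lborel s)
    have [measurable]: "fst \<in> ?G \<Otimes>\<^sub>M ?L \<rightarrow>\<^sub>M subspace_borel" "snd \<in> ?G \<Otimes>\<^sub>M ?L \<rightarrow>\<^sub>M borel"
      by (rule measurable_compose[OF measurable_fst measurable_grassmannian_ident[OF E d]],
          rule measurable_compose[OF measurable_snd measurable_subspace_lborel_ident[OF s]])
    have pm: "(\<lambda>p. plane (fst p) (snd p + v)) \<in> ?G \<Otimes>\<^sub>M ?L \<rightarrow>\<^sub>M plane_borel j"
      by (rule measurable_plane) (auto simp: space_pair_measure spG grassmannian_def)
    define F where "F \<xi> u = f' (plane \<xi> (u + v))" for \<xi> u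
    have Fm: "(\<lambda>(\<xi>, u). F \<xi> u) \<in> borel_measurable (?G \<Otimes>\<^sub>M ?L)"
      unfolding F_def case_prod_beta' by (rule measurable_compose[OF pm f'm])
    have Hm: "(\<lambda>(\<xi>, u). H (plane \<xi> (u + v))) \<in> borel_measurable (?G \<Otimes>\<^sub>M ?L)"
      unfolding case_prod_beta' by (rule measurable_compose[OF pm H])
    have FH: "ennreal \<bar>F \<xi> u\<bar> \<le> H (plane \<xi> (u + v))" for \<xi> u by (simp add: F_def H_def)
    define g where "g \<xi> = (\<integral>u. F \<xi> u \<partial>?L)" for \<xi>
    have gm: "g \<in> borel_measurable ?G"
      unfolding g_def by (rule L.borel_measurable_lebesgue_integral[OF Fm])
    have Hn: "(\<lambda>\<xi>. \<integral>\<^sup>+ u. H (plane \<xi> (u + v)) \<partial>?L) \<in> borel_measurable ?G"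
      by (rule L.borel_measurable_nn_integral[OF Hm])
    have "AE \<xi> in ?G. (\<integral>\<^sup>+ u. H (plane \<xi> (u + v)) \<partial>?L) \<noteq> \<infinity>"
      by (rule nn_integral_PInf_AE[OF Hn]) (use rf in \<open>simp add: radon_nn_def\<close>)
    then have "AE \<xi> in ?G. has_lebesgue_integral (completion ?L) (\<lambda>u. ereal (f (plane \<xi> (u + v)))) (ereal (g \<xi>))"
      using AE_space
    proof eventually_elim
      case \<xi>: (elim \<xi>)
      then have \<xi>G: "\<xi> \<in> grassmannian j (\<eta>\<^sup>\<bottom>)" by (simp add: spG)
      have Hmx: "(\<lambda>u. H (plane \<xi> (u + v))) \<in> borel_measurable ?L" and Fmx: "F \<xi> \<in> borel_measurable ?L"
        using measurable_Pair2[OF Hm \<xi>(2)] measurable_Pair2[OF Fm \<xi>(2)] by simp_all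
      have "(\<integral>\<^sup>+ u. ennreal (norm (F \<xi> u)) \<partial>?L) \<le> (\<integral>\<^sup>+ u. H (plane \<xi> (u + v)) \<partial>?L)"
        by (rule nn_integral_mono) (simp add: FH)
      then have int: "integrable ?L (F \<xi>)"
        using Fmx \<xi>(1) by (auto simp: integrable_iff_bounded less_top intro: le_less_trans)
      \<comment> \<open>A finite integral forces \<open>H\<close> to be finite almost everywhere on
        \<eta>, which means that the planes avoid \<open>N\<close>.\<close>
      have "AE u in ?L. H (plane \<xi> (u + v)) \<noteq> \<infinity>"
        by (rule nn_integral_PInf_AE[OF Hmx]) (use \<xi>(1) in simp)
      then have "AE u in ?L. f (plane \<xi> (u + v)) = F \<xi> u"
      proof eventually_elim
        case (elim u)
        have "plane \<xi> (u + v) \<notin> N"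
        proof
          assume "plane \<xi> (u + v) \<in> N"
          then have "H (plane \<xi> (u + v)) = \<infinity>" by (simp add: H_def)
          with elim show False by simp
        qed
        moreover have "plane \<xi> (u + v) \<in> affine_grassmannian j"
          using \<xi>G by (intro plane_in_affine_grassmannian) (simp add: grassmannian_def)
        ultimately show ?case using ff' by (simp add: F_def)
      qed
      from has_bochner_integral_completion_AE[OF int this]
      show ?case unfolding has_lebesgue_integral_real_iff g_def .
    qed
    moreover have "integrable ?G g"
    proof -
      have "(\<integral>\<^sup>+ \<xi>. ennreal (norm (g \<xi>)) \<partial>?G) \<le> (\<integral>\<^sup>+ \<xi>. \<integral>\<^sup>+ u. H (plane \<xi> (u + v)) \<partial>?L \<partial>?G)"
      proof (rule nn_integral_mono)
        fix \<xi>
        show "ennreal (norm (g \<xi>)) \<le> (\<integral>\<^sup>+ u. H (plane \<xi> (u + v)) \<partial>?L)"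
        \<comment> \<open>The Bochner integral is 0 where \<open>F \<xi>\<close> is not integrable,
          so the bound holds for every \<xi>.\<close>
        proof (cases "integrable ?L (F \<xi>)")
          case True
          then have "ennreal (norm (g \<xi>)) \<le> (\<integral>\<^sup>+ u. ennreal (norm (F \<xi> u)) \<partial>?L)"
            unfolding g_def by (rule integral_norm_bound_ennreal)
          also have "\<dots> \<le> (\<integral>\<^sup>+ u. H (plane \<xi> (u + v)) \<partial>?L)" by (rule nn_integral_mono) (simp add: FH)
          finally show ?thesis .
        qed (simp add: g_def not_integrable_integral_eq)
      qed
      also have "\<dots> < \<infinity>" using rf by (simp add: radon_nn_def)
      finally show ?thesis using gm by (simp add: integrable_iff_bounded)
    qed
    then have "has_lebesgue_integral (completion ?G) (\<lambda>\<xi>. ereal (g \<xi>)) (ereal (integral\<^sup>L ?G g))"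
      unfolding has_lebesgue_integral_real_iff by (rule has_bochner_integral_completion_AE) simp
    ultimately show ?case
      unfolding \<eta>(3) has_mixed_radon_plane[OF \<eta>(1,2)] by (auto intro!: exI[of _ "\<lambda>\<xi>. ereal (g \<xi>)"] AE_completion)
  qed
  then show ?thesis unfolding plane_measure_eq[OF k] by (rule AE_completion)
qed

section \<open>Radial functions\<close>

text \<open>The derivative of the volume of the ball of radius \<open>sqrt (t\<^sup>2 - w\<^sup>2)\<close>. It is only used for
  \<open>t > A > w\<close>, away from the singularity that it has at \<open>t = w\<close> if \<open>d = 1\<close>.\<close>

definition radial_density :: "nat \<Rightarrow> real \<Rightarrow> real \<Rightarrow> real" where
  "radial_density d w t = unit_ball_vol d * (d * sqrt (t\<^sup>2 - w\<^sup>2) ^ (d - 1) * (t / sqrt (t\<^sup>2 - w\<^sup>2)))"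

lemma measurable_radial_density[measurable]: "radial_density d w \<in> borel_measurable borel"
  unfolding radial_density_def by measurable

lemma nn_integral_radial_density:
  assumes "0 \<le> w" "w < A" "A \<le> b"
  shows "(\<integral>\<^sup>+ t. ennreal (radial_density d w t) * indicator {A<..b} t \<partial>lborel) =
    ennreal (unit_ball_vol d * sqrt (b\<^sup>2 - w\<^sup>2) ^ d - unit_ball_vol d * sqrt (A\<^sup>2 - w\<^sup>2) ^ d)"
proof -
  have sq: "t\<^sup>2 - w\<^sup>2 > 0" if "A \<le> t" for t
  proof -
    have "w < t" using assms that by simp
    then have "w\<^sup>2 < t\<^sup>2" using assms by (intro power_strict_mono) auto
    then show ?thesis by simp
  qed
  \<comment> \<open>The fundamental theorem of calculus is applied on the closed interval; the
    endpoint \<open>A\<close> is a null set.\<close>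
  have "AE t in lborel. t \<noteq> A" by (rule AE_lborel_singleton)
  then have "(\<integral>\<^sup>+ t. ennreal (radial_density d w t) * indicator {A<..b} t \<partial>lborel) =
    (\<integral>\<^sup>+ t. ennreal (radial_density d w t) * indicator {A..b} t \<partial>lborel)"
    by (intro nn_integral_cong_AE) (auto simp: indicator_def)
  also have "\<dots> = ennreal (unit_ball_vol d * sqrt (b\<^sup>2 - w\<^sup>2) ^ d - unit_ball_vol d * sqrt (A\<^sup>2 - w\<^sup>2) ^ d)"
  proof (rule nn_integral_has_integral_lebesgue')
    show "0 \<le> radial_density d w t" if "t \<in> {A..b}" for t
      using sq[of t] that assms by (simp add: radial_density_def)
    show "(radial_density d w has_integral (unit_ball_vol d * sqrt (b\<^sup>2 - w\<^sup>2) ^ d - unit_ball_vol d * sqrt (A\<^sup>2 - w\<^sup>2) ^ d)) {A..b}"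
    proof (rule fundamental_theorem_of_calculus[OF assms(3)])
      fix t assume "t \<in> {A..b}"
      then have "t\<^sup>2 - w\<^sup>2 > 0" using sq[of t] by simp
      then show "((\<lambda>t. unit_ball_vol d * sqrt (t\<^sup>2 - w\<^sup>2) ^ d) has_vector_derivative radial_density d w t) (at t within {A..b})"
        unfolding has_real_derivative_iff_has_vector_derivative[symmetric]
        by (auto simp: radial_density_def intro!: derivative_eq_intros) (simp add: divide_inverse)
    qed
  qed
  finally show ?thesis .
qed

text \<open>Polar coordinates for functions of |\<tau>|, where \<open>w\<close> is the distance that
  remains at u = 0. The image of Lebesgue measure on \<open>E\<close> under u -> sqrt(|u|^2 + w^2),
  cut off at \<open>A\<close>, and the measure with the given density agree on all half-lines: there
  both masses are 0 or the difference of two ball volumes.\<close>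

lemma nn_integral_radial_tail:
  fixes E :: "'a::euclidean_space set"
  assumes E: "subspace E" and w: "0 \<le> w" "w < A" and g[measurable]: "g \<in> borel_measurable borel"
  shows "(\<integral>\<^sup>+ u. g (sqrt ((norm u)\<^sup>2 + w\<^sup>2)) * indicator {A<..} (sqrt ((norm u)\<^sup>2 + w\<^sup>2)) \<partial>subspace_lborel E) =
    (\<integral>\<^sup>+ t. g t * (ennreal (radial_density (dim E) w t) * indicator {A<..} t) \<partial>lborel)"
proof -
  let ?q = "\<lambda>u::'a. sqrt ((norm u)\<^sup>2 + w\<^sup>2)" and ?L = "subspace_lborel E" and ?d = "dim E"
  have spL: "space ?L = E" by (rule space_subspace_lborel[OF E])
  note [measurable] = measurable_subspace_lborel_ident[OF E]
  have q[measurable]: "?q \<in> borel_measurable ?L" by measurable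
  define M1 where "M1 = distr (density ?L (\<lambda>u. indicator {A<..} (?q u))) borel ?q"
  define M2 where "M2 = density lborel (\<lambda>t. ennreal (radial_density ?d w t) * indicator {A<..} t)"
  have m1: "(\<integral>\<^sup>+ t. h t \<partial>M1) = (\<integral>\<^sup>+ u. h (?q u) * indicator {A<..} (?q u) \<partial>?L)" if [measurable]: "h \<in> borel_measurable borel" for h
    unfolding M1_def by (subst nn_integral_distr, simp, simp, subst nn_integral_density) (auto simp: mult.commute)
  have m2: "(\<integral>\<^sup>+ t. h t \<partial>M2) = (\<integral>\<^sup>+ t. h t * (ennreal (radial_density ?d w t) * indicator {A<..} t) \<partial>lborel)" if [measurable]: "h \<in> borel_measurable borel" for h
    unfolding M2_def by (subst nn_integral_density) (auto simp: mult.commute)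
  have eq: "emeasure M1 {..b} = emeasure M2 {..b} \<and> emeasure M1 {..b} \<noteq> \<infinity>" for b
  proof (cases "A \<le> b")
    case True
    define r where "r t = sqrt (t\<^sup>2 - w\<^sup>2)" for t
    have sq: "t\<^sup>2 - w\<^sup>2 > 0" if "A \<le> t" for t
    proof -
      have "w < t" using w that by simp
      then have "w\<^sup>2 < t\<^sup>2" using w by (intro power_strict_mono) auto
      then show ?thesis by simp
    qed
    have qr: "?q u \<le> t \<longleftrightarrow> norm u \<le> r t" if "A \<le> t" for u t
    proof -
      have "?q u \<le> t \<longleftrightarrow> (norm u)\<^sup>2 + w\<^sup>2 \<le> t\<^sup>2"
        using that w by (simp add: real_sqrt_le_iff' real_le_lsqrt sqrt_le_D)
      also have "\<dots> \<longleftrightarrow> (norm u)\<^sup>2 \<le> t\<^sup>2 - w\<^sup>2" by auto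
      also have "\<dots> \<longleftrightarrow> norm u \<le> r t"
        unfolding r_def using sq[OF that] by (metis abs_norm_cancel real_sqrt_abs real_sqrt_le_iff)
      finally show ?thesis .
    qed
    have rp: "r A > 0" "r b > 0" using sq True by (auto simp: r_def)
    have cb: "{x \<in> E. norm x \<le> s} \<in> sets ?L" for s
      by (simp add: sets_subspace_lborel[OF E] sets_restrict_space_cball)
    have sub: "{x \<in> E. norm x \<le> r A} \<subseteq> {x \<in> E. norm x \<le> r b}"
    proof -
      have "A\<^sup>2 \<le> b\<^sup>2" using True w by (intro power_mono) auto
      then have "r A \<le> r b" by (simp add: r_def)
      then show ?thesis by auto
    qed
    have "emeasure M1 {..b} = (\<integral>\<^sup>+ t. indicator {..b} t \<partial>M1)" by (simp add: M1_def)
    also have "\<dots> = (\<integral>\<^sup>+ u. indicator ({x \<in> E. norm x \<le> r b} - {x \<in> E. norm x \<le> r A}) u \<partial>?L)"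
      unfolding m1[OF borel_measurable_indicator[OF atMost_borel]]
    proof (rule nn_integral_cong)
      fix u assume "u \<in> space ?L"
      then have "u \<in> E" by (simp add: spL)
      then show "indicator {..b} (?q u) * indicator {A<..} (?q u) = (indicator ({x \<in> E. norm x \<le> r b} - {x \<in> E. norm x \<le> r A}) u :: ennreal)"
        using qr[of A u] qr[of b u] True by (auto simp: indicator_def not_le[symmetric])
    qed
    also have "\<dots> = emeasure ?L ({x \<in> E. norm x \<le> r b} - {x \<in> E. norm x \<le> r A})"
      by (rule nn_integral_indicator) (intro sets.Diff cb)
    also have "\<dots> = emeasure ?L {x \<in> E. norm x \<le> r b} - emeasure ?L {x \<in> E. norm x \<le> r A}"
      by (rule emeasure_Diff[OF _ cb cb sub]) (simp add: emeasure_subspace_lborel_cball[OF E rp(1)])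
    also have "\<dots> = ennreal (unit_ball_vol ?d * r b ^ ?d - unit_ball_vol ?d * r A ^ ?d)"
      unfolding emeasure_subspace_lborel_cball[OF E rp(1)] emeasure_subspace_lborel_cball[OF E rp(2)]
      by (rule ennreal_minus) (use rp in auto)
    finally have 1: "emeasure M1 {..b} = ennreal (unit_ball_vol ?d * r b ^ ?d - unit_ball_vol ?d * r A ^ ?d)" .
    have "emeasure M2 {..b} = (\<integral>\<^sup>+ t. indicator {..b} t \<partial>M2)" by (simp add: M2_def)
    also have "\<dots> = (\<integral>\<^sup>+ t. ennreal (radial_density ?d w t) * indicator {A<..b} t \<partial>lborel)"
      unfolding m2[OF borel_measurable_indicator[OF atMost_borel]]
      by (intro nn_integral_cong) (auto simp: indicator_def)
    also have "\<dots> = ennreal (unit_ball_vol ?d * r b ^ ?d - unit_ball_vol ?d * r A ^ ?d)"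
      unfolding r_def by (rule nn_integral_radial_density[OF w True])
    finally show ?thesis using 1 by simp
  next
    case False
    have "emeasure M1 {..b} = (\<integral>\<^sup>+ t. indicator {..b} t \<partial>M1)" by (simp add: M1_def)
    also have "\<dots> = (\<integral>\<^sup>+ u. 0 \<partial>?L)"
      unfolding m1[OF borel_measurable_indicator[OF atMost_borel]]
      by (intro nn_integral_cong) (use False in \<open>auto simp: indicator_def\<close>)
    finally have 1: "emeasure M1 {..b} = 0" by simp
    have "emeasure M2 {..b} = (\<integral>\<^sup>+ t. indicator {..b} t \<partial>M2)" by (simp add: M2_def)
    also have "\<dots> = (\<integral>\<^sup>+ t. 0 \<partial>(lborel :: real measure))"
      unfolding m2[OF borel_measurable_indicator[OF atMost_borel]]
      by (intro nn_integral_cong) (use False in \<open>auto simp: indicator_def\<close>)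
    finally show ?thesis using 1 by simp
  qed
  have "M1 = M2"
  proof (rule measure_eqI_generator_eq[where \<Omega>=UNIV and E="range atMost" and A="\<lambda>n. {..real n}"])
    show "Int_stable (range (atMost :: real \<Rightarrow> real set))" by (auto simp: Int_stable_def)
    show "sets M1 = sigma_sets UNIV (range atMost)" "sets M2 = sigma_sets UNIV (range atMost)"
      by (simp_all add: M1_def M2_def borel_eq_atMost)
    have "x \<in> (\<Union>n. {..real n})" for x :: real using real_arch_simple[of x] by auto
    then show "(\<Union>n. {..real n}) = (UNIV :: real set)" by blast
    show "emeasure M1 {..real i} \<noteq> \<infinity>" for i using eq by blast
    show "emeasure M1 X = emeasure M2 X" if "X \<in> range atMost" for X using that eq by blast
  qed auto
  then show ?thesis using m1[OF g] m2[OF g] by simp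
qed

section \<open>Null sets and Borel profiles of radial functions\<close>

lemma AE_subspace_lborel_nonzero:
  fixes E :: "'a::euclidean_space set"
  assumes E: "subspace E" and d: "dim E > 0"
  shows "AE u in subspace_lborel E. u \<noteq> 0"
proof -
  let ?L = "subspace_lborel E"
  have cb: "{x \<in> E. norm x \<le> s} \<in> sets ?L" for s
    by (simp add: sets_subspace_lborel[OF E] sets_restrict_space_cball)
  have e0: "{x \<in> E. norm x \<le> 0} = {0}" using subspace_0[OF E] by auto
  have le: "emeasure ?L {0} \<le> ennreal (unit_ball_vol (dim E) * (1 / real (Suc n)))" for n
  proof -
    have "emeasure ?L {0} \<le> emeasure ?L {x \<in> E. norm x \<le> 1 / real (Suc n)}"
      by (rule emeasure_mono[OF _ cb]) (use subspace_0[OF E] in auto)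
    also have "\<dots> = ennreal (unit_ball_vol (dim E) * (1 / real (Suc n)) ^ dim E)"
      by (rule emeasure_subspace_lborel_cball[OF E]) simp
    also have "\<dots> \<le> ennreal (unit_ball_vol (dim E) * (1 / real (Suc n)))"
    proof (intro ennreal_leI mult_left_mono)
      show "(1 / real (Suc n)) ^ dim E \<le> 1 / real (Suc n)"
        using power_decreasing[of 1 "dim E" "1 / real (Suc n)"] d by simp
    qed simp
    finally show ?thesis .
  qed
  have "(\<lambda>n. ennreal (unit_ball_vol (dim E) * (1 / real (Suc n)))) \<longlonglongrightarrow> ennreal (unit_ball_vol (dim E) * 0)"
    by (intro tendsto_ennrealI tendsto_mult tendsto_const LIMSEQ_Suc[OF lim_1_over_n])
  then have "emeasure ?L {0} \<le> 0"
    using le by (intro LIMSEQ_le_const[of _ "0::ennreal"]) auto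
  moreover have "{0} \<in> sets ?L" using cb[of 0] e0 by simp
  ultimately have "{0} \<in> null_sets ?L" by (auto simp: null_sets_def)
  from AE_not_in[OF this] show ?thesis by simp
qed

text \<open>The density formula makes the image measure of u -> sqrt(|u|^2 + w^2) absolutely
  continuous above every A > w; take A = w + 1/(n+1) for all n. The value w itself is attained only
  at u = 0, a null set.\<close>

lemma AE_radial_null:
  fixes E :: "'a::euclidean_space set"
  assumes E: "subspace E" and d: "dim E > 0" and w: "0 \<le> w" and Z: "Z \<in> null_sets (lborel :: real measure)"
  shows "AE u in subspace_lborel E. sqrt ((norm u)\<^sup>2 + w\<^sup>2) \<notin> Z"
proof -
  let ?q = "\<lambda>u::'a. sqrt ((norm u)\<^sup>2 + w\<^sup>2)" and ?L = "subspace_lborel E"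
  note [measurable] = measurable_subspace_lborel_ident[OF E]
  have [measurable]: "Z \<in> sets borel" using Z by auto
  have "AE u in ?L. ?q u > w + 1 / real (Suc n) \<longrightarrow> ?q u \<notin> Z" for n
  proof -
    let ?A = "w + 1 / real (Suc n)"
    have A: "w < ?A" by simp
    have "(\<integral>\<^sup>+ u. indicator Z (?q u) * indicator {?A<..} (?q u) \<partial>?L) =
      (\<integral>\<^sup>+ t. indicator Z t * (ennreal (radial_density (dim E) w t) * indicator {?A<..} t) \<partial>lborel)"
      by (rule nn_integral_radial_tail[OF E w A]) measurable
    also have "\<dots> = (\<integral>\<^sup>+ t. 0 \<partial>(lborel :: real measure))"
      by (rule nn_integral_cong_AE, use AE_not_in[OF Z] in eventually_elim) simp
    finally have "(\<integral>\<^sup>+ u. indicator Z (?q u) * indicator {?A<..} (?q u) \<partial>?L) = 0" by simp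
    then have "AE u in ?L. indicator Z (?q u) * indicator {?A<..} (?q u) = (0 :: ennreal)"
      by (subst (asm) nn_integral_0_iff_AE) auto
    then show ?thesis by eventually_elim (auto simp: indicator_def split: if_splits)
  qed
  then have "AE u in ?L. \<forall>n. ?q u > w + 1 / real (Suc n) \<longrightarrow> ?q u \<notin> Z"
    unfolding AE_all_countable by blast
  with AE_subspace_lborel_nonzero[OF E d] show ?thesis
  proof eventually_elim
    case (elim u)
    have "w = sqrt (w\<^sup>2)" using w by simp
    also have "\<dots> < ?q u" using elim(1) by (intro real_sqrt_less_mono) simp
    finally obtain n where "1 / real (Suc n) < ?q u - w" by (metis diff_gt_0_iff_gt nat_approx_posE)
    then have "w + 1 / real (Suc n) < ?q u" by (simp add: algebra_simps)
    then show ?case using elim(2) by blast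
  qed
qed

text \<open>A radial function that agrees almost everywhere on \<open>E\<close> with a Borel function does so on almost
  every ray, by Fubini's theorem for \<open>(s, x) \<mapsto> s x\<close>.\<close>

lemma radial_profile_borel:
  fixes E :: "'a::euclidean_space set" and f\<^sub>0 :: "real \<Rightarrow> real"
  assumes E: "subspace E" and d: "dim E > 0" and g[measurable]: "g \<in> borel_measurable borel"
    and AE: "AE u in subspace_lborel E. f\<^sub>0 (norm u) = g u"
  obtains f\<^sub>1 where "f\<^sub>1 \<in> borel_measurable borel" "AE t in lborel. t > 0 \<longrightarrow> f\<^sub>0 t = f\<^sub>1 t"
proof -
  let ?L = "subspace_lborel E"
  have spL: "space ?L = E" by (rule space_subspace_lborel[OF E])
  obtain B where B: "B \<in> null_sets ?L" "{u \<in> space ?L. f\<^sub>0 (norm u) \<noteq> g u} \<subseteq> B"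
    using AE unfolding eventually_ae_filter by auto
  have fg: "f\<^sub>0 (norm u) = g u" if "u \<in> E" "u \<notin> B" for u using B(2) that spL by auto
  have BE: "B \<in> sets (restrict_space borel E)" using B(1) sets_subspace_lborel[OF E] by (auto simp: null_sets_def)
  have [measurable]: "B \<in> sets borel"
    using BE closed_subspace[OF E] by (subst (asm) sets_restrict_space_iff) auto
  note pm[measurable] = measurable_proj[of E]
  \<comment> \<open>The exceptional set in \<open>E\<close> is pulled back along the projection and
    becomes a null cylinder in R^n.\<close>
  have B0: "AE x in lborel. proj E x \<notin> B"
  proof -
    have "(\<integral>\<^sup>+ x. indicator B (proj E x) \<partial>lborel) = (\<integral>\<^sup>+ u. \<integral>\<^sup>+ v. indicator B (proj E (u + v)) \<partial>subspace_lborel (E\<^sup>\<bottom>) \<partial>?L)"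
      by (rule nn_integral_lborel_decomp[OF E]) measurable
    also have "\<dots> = (\<integral>\<^sup>+ u. 0 \<partial>?L)"
    proof (rule nn_integral_cong_AE, use AE_not_in[OF B(1)] AE_space in eventually_elim)
      case (elim u)
      have "(\<integral>\<^sup>+ v. indicator B (proj E (u + v)) \<partial>subspace_lborel (E\<^sup>\<bottom>)) = (\<integral>\<^sup>+ v. 0 \<partial>subspace_lborel (E\<^sup>\<bottom>))"
        by (intro nn_integral_cong) (use elim in \<open>simp add: spL space_subspace_lborel subspace_orthogonal_comp
          blinfun.add_right proj_self[OF E] proj_perp[OF E]\<close>)
      then show ?case by simp
    qed
    finally have "(\<integral>\<^sup>+ x. indicator B (proj E x) \<partial>lborel) = 0" by simp
    then have "AE x in lborel. indicator B (proj E x) = (0 :: ennreal)"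
      by (subst (asm) nn_integral_0_iff_AE) auto
    then show ?thesis by eventually_elim (simp add: indicator_def split: if_splits)
  qed
  \<comment> \<open>Dilations multiply Lebesgue measure by a constant and commute with the
    projection, so for each fixed \<open>s\<close> the condition holds for almost all
    \<open>x\<close>; Fubini then exchanges the two quantifiers.\<close>
  have scale: "AE x in lborel. s *\<^sub>R proj E x \<notin> B" if s: "s > 0" for s
  proof -
    have "(\<integral>\<^sup>+ x. indicator B (proj E x) \<partial>lborel) = (\<integral>\<^sup>+ x. 0 \<partial>(lborel :: 'a measure))"
      by (rule nn_integral_cong_AE, use B0 in eventually_elim) simp
    then have "0 = (\<integral>\<^sup>+ x. indicator B (proj E x) \<partial>density (distr lborel borel (\<lambda>x. 0 + s *\<^sub>R x)) (\<lambda>_. \<bar>s\<bar> ^ DIM('a)))"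
      using lborel_affine[of s "0::'a"] s by simp
    also have "\<dots> = (\<integral>\<^sup>+ x. ennreal (\<bar>s\<bar> ^ DIM('a)) * indicator B (proj E (s *\<^sub>R x)) \<partial>lborel)"
      by (subst nn_integral_density, simp, simp, subst nn_integral_distr) auto
    finally have "AE x in lborel. ennreal (\<bar>s\<bar> ^ DIM('a)) * indicator B (proj E (s *\<^sub>R x)) = (0::ennreal)"
      by (subst nn_integral_0_iff_AE[symmetric]) auto
    then show ?thesis
      by eventually_elim (use s in \<open>auto simp: indicator_def blinfun.scaleR_right split: if_splits\<close>)
  qed
  have "AE s in lborel. AE x in lborel. s > 0 \<longrightarrow> s *\<^sub>R proj E x \<notin> B"
  proof (rule AE_I2)
    fix s :: real
    show "AE x in lborel. s > 0 \<longrightarrow> s *\<^sub>R proj E x \<notin> B"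
      using scale[of s] by (cases "s > 0") auto
  qed
  then have "AE x in lborel. AE s in lborel. s > 0 \<longrightarrow> s *\<^sub>R proj E x \<notin> B"
  proof (subst (asm) lborel_pair.AE_commute)
    show "{p \<in> space (lborel \<Otimes>\<^sub>M lborel). fst p > 0 \<longrightarrow> fst p *\<^sub>R proj E (snd p) \<notin> B} \<in> sets (lborel \<Otimes>\<^sub>M lborel)"
      by measurable
  qed
  moreover have "AE x in lborel. proj E x \<noteq> 0"
  proof -
    have V: "subspace {x. proj E x = 0}"
      by (auto simp: subspace_def blinfun.add_right blinfun.scaleR_right)
    have "{x. proj E x = 0} \<noteq> UNIV"
    proof
      assume "{x. proj E x = 0} = UNIV"
      then have "proj E x = 0" for x by blast
      then have "E \<subseteq> {0}" using proj_self[OF E] by (metis singletonI subsetI)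
      then have "dim E = 0" unfolding dim_eq_0 .
      with d show False by linarith
    qed
    then have "dim {x. proj E x = 0} < DIM('a)"
      using V by (metis dim_eq_full dim_subset_UNIV le_neq_implies_less span_eq_iff)
    then have "negligible {x. proj E x = 0}" by (rule negligible_lowdim)
    moreover have "{x. proj E x = 0} \<in> sets lborel"
      using V by (simp add: closed_subspace borel_closed)
    ultimately have "{x. proj E x = 0} \<in> null_sets lborel"
      by (simp add: negligible_iff_null_sets null_sets_completion_iff)
    from AE_not_in[OF this] show ?thesis by simp
  qed
  ultimately have "AE x in lborel. proj E x \<noteq> 0 \<and> (AE s in lborel. s > 0 \<longrightarrow> s *\<^sub>R proj E x \<notin> B)"
    by eventually_elim simp
  moreover have "ae_filter (lborel :: 'a measure) \<noteq> bot"
    by (simp add: ae_filter_eq_bot_iff)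
  ultimately obtain x where x: "proj E x \<noteq> 0" "AE s in lborel. s > 0 \<longrightarrow> s *\<^sub>R proj E x \<notin> B"
    using eventually_happens'[of "ae_filter lborel"] by blast
  let ?r = "norm (proj E x)"
  have r: "?r > 0" using x(1) by simp
  \<comment> \<open>The ray through \<open>proj E x\<close> is reparametrized by distance from the
    origin; \<open>0 +\<close> fits the affine substitution rule.\<close>
  have "AE t in lborel. 0 + (1 / ?r) * t > 0 \<longrightarrow> (0 + (1 / ?r) * t) *\<^sub>R proj E x \<notin> B"
    by (rule AE_borel_affine[OF _ _ x(2)]) (use r in auto)
  then have "AE t in lborel. t > 0 \<longrightarrow> f\<^sub>0 t = g ((t / ?r) *\<^sub>R proj E x)"
  proof eventually_elim
    case (elim t)
    show ?case
    proof
      assume t: "t > 0"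
      have "(t / ?r) *\<^sub>R proj E x \<notin> B" using elim t r by simp
      moreover have "(t / ?r) *\<^sub>R proj E x \<in> E" by (intro subspace_scale[OF E] proj_in[OF E])
      moreover have "norm ((t / ?r) *\<^sub>R proj E x) = t" using t r by simp
      ultimately show "f\<^sub>0 t = g ((t / ?r) *\<^sub>R proj E x)" using fg by metis
    qed
  qed
  moreover have "(\<lambda>t. g ((t / ?r) *\<^sub>R proj E x)) \<in> borel_measurable borel" by measurable
  ultimately show thesis by (rule that[rotated])
qed

section \<open>Divergence\<close>

lemma radial_density_0: "t > 0 \<Longrightarrow> d > 0 \<Longrightarrow> radial_density d 0 t = unit_ball_vol d * d * t ^ (d - 1)"
  by (simp add: radial_density_def)

text \<open>For t \<ge> 2w one has t/2 \<le> sqrt(t^2 - w^2) \<le> t: the left inequality bounds the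
  power from below, the right one the factor t / sqrt(t^2 - w^2). The constant does not involve w,
  so divergence follows for every \<xi> alike.\<close>

lemma radial_density_ge:
  assumes "0 \<le> w" "2 * w \<le> t" "0 < t"
  shows "radial_density d w t \<ge> unit_ball_vol d * d * (1 / 2) ^ (d - 1) * t ^ (d - 1)"
proof -
  let ?r = "sqrt (t\<^sup>2 - w\<^sup>2)"
  have "w\<^sup>2 \<le> (t / 2)\<^sup>2" using assms by (intro power_mono) auto
  moreover have "(t / 2)\<^sup>2 = t\<^sup>2 / 4" by (simp add: power_divide)
  moreover have "0 \<le> t\<^sup>2" by simp
  ultimately have "(t / 2)\<^sup>2 \<le> t\<^sup>2 - w\<^sup>2" by linarith
  then have r1: "t / 2 \<le> ?r" by (rule real_le_rsqrt)
  have r2: "?r \<le> t" using assms by (intro real_le_lsqrt) auto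
  have rp: "?r > 0" using r1 assms(3) by linarith
  have "(t / 2) ^ (d - 1) * 1 \<le> ?r ^ (d - 1) * (t / ?r)"
    by (intro mult_mono power_mono) (use r1 r2 rp assms in auto)
  then have "unit_ball_vol d * d * ((t / 2) ^ (d - 1) * 1) \<le> unit_ball_vol d * d * (?r ^ (d - 1) * (t / ?r))"
    by (intro mult_left_mono) auto
  then show ?thesis by (simp add: radial_density_def power_divide mult_ac power_one_over)
qed

text \<open>The weight of the tail condition times the polar density t^(n-j-1) of the fibre
  \<open>\<xi>\<^sup>\<bottom>\<close> is t^(k-1), the polar density in dimension k. This links the
  condition to the inner integrals over the k-dimensional \<eta>.\<close>

lemma powi_times_power:
  assumes "t > 0" "k > 0" "j + k \<le> n" "j < n"
  shows "t powi (int k + int j - int n) * t ^ (n - j - 1) = (t :: real) ^ (k - 1)"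
proof -
  have "t powi (int k + int j - int n) * t ^ (n - j - 1) = t powi (int k + int j - int n) * t powi int (n - j - 1)"
    by simp
  also have "\<dots> = t powi (int k + int j - int n + int (n - j - 1))"
    by (rule power_int_add[symmetric]) (use assms in auto)
  also have "int k + int j - int n + int (n - j - 1) = int (k - 1)" using assms by simp
  finally show ?thesis by simp
qed

text \<open>Measurability of f says nothing immediate about \<open>f\<^sub>0\<close>. By Fubini f
  agrees with a Borel function almost everywhere on almost every fibre
  \<open>\<xi>\<^sup>\<bottom>\<close>, and one such fibre is enough, since there f at u is
  \<open>f\<^sub>0\<close> at |u|; its dimension is positive because
  \<open>j < DIM('a)\<close>.\<close>

lemma radial_profile:
  fixes f :: "'a::euclidean_space set \<Rightarrow> real"
  assumes j: "j < DIM('a)" and f: "f \<in> borel_measurable (plane_measure j)"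
    and rad: "\<And>\<tau>. \<tau> \<in> affine_grassmannian j \<Longrightarrow> f \<tau> = f\<^sub>0 (plane_norm \<tau>)"
  obtains f\<^sub>1 where "f\<^sub>1 \<in> borel_measurable borel" "AE t in lborel. t > 0 \<longrightarrow> f\<^sub>0 t = f\<^sub>1 t"
proof -
  have j': "j \<le> DIM('a)" "j \<le> dim (UNIV :: 'a set)" using j by simp_all
  let ?G = "grassmannian_measure j (UNIV :: 'a set)"
  interpret G: prob_space ?G by (rule prob_space_grassmannian_measure[OF subspace_UNIV j'(2)])
  obtain f' where f': "f' \<in> borel_measurable (plane_lborel j)" and AE: "AE \<tau> in plane_lborel j. f \<tau> = f' \<tau>"
    using completion_ex_borel_measurable_real[of f "plane_lborel j"] f unfolding plane_measure_eq[OF j'(1)] by blast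
  obtain N where N: "N \<in> null_sets (plane_lborel j)" "{\<tau> \<in> space (plane_lborel j). f \<tau> \<noteq> f' \<tau>} \<subseteq> N"
    using AE unfolding eventually_ae_filter by auto
  have Ns[measurable]: "N \<in> sets (plane_borel j)" using N(1) by auto
  have "(\<integral>\<^sup>+ \<xi>. \<integral>\<^sup>+ u. indicator N (plane \<xi> u) \<partial>subspace_lborel (\<xi>\<^sup>\<bottom>) \<partial>?G) = (\<integral>\<^sup>+ \<tau>. indicator N \<tau> \<partial>plane_lborel j)"
    by (rule nn_integral_plane_lborel[OF j'(1), symmetric]) simp
  also have "\<dots> = 0" using N(1) Ns by (simp add: null_sets_def)
  finally have z: "(\<integral>\<^sup>+ \<xi>. \<integral>\<^sup>+ u. indicator N (plane \<xi> u) \<partial>subspace_lborel (\<xi>\<^sup>\<bottom>) \<partial>?G) = 0" .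
  have "\<exists>\<xi>\<in>grassmannian j (UNIV :: 'a set). (\<integral>\<^sup>+ u. indicator N (plane \<xi> u) \<partial>subspace_lborel (\<xi>\<^sup>\<bottom>)) = 0"
  proof (rule ccontr)
    assume no: "\<not> ?thesis"
    \<comment> \<open>The fibre integral in a form measurable in \<xi>, so that the vanishing of its
      integral over the Grassmannian can be read off almost everywhere.\<close>
    let ?I = "\<lambda>\<xi>. \<integral>\<^sup>+ x. indicator (cball 0 1) (proj \<xi> x) * plane_ext j (indicator N) \<xi> x \<partial>lborel"
    have [measurable]: "cball (0::'a) 1 \<in> sets borel" by simp
    have "(indicator N :: 'a set \<Rightarrow> ennreal) \<in> borel_measurable (plane_borel j)" by simp
    note [measurable] = measurable_plane_ext[OF this]
    have I: "(\<integral>\<^sup>+ u. indicator N (plane \<xi> u) \<partial>subspace_lborel (\<xi>\<^sup>\<bottom>)) = ?I \<xi> / ennreal (unit_ball_vol j)" if \<xi>: "\<xi> \<in> space ?G" for \<xi>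
    proof -
      have \<xi>: "\<xi> \<in> grassmannian j UNIV" using that by (simp add: space_grassmannian_measure[OF subspace_UNIV j'(2)])
      note s = grassmannianD(1)[OF \<xi>]
      have "(\<lambda>u. plane \<xi> u) \<in> borel \<rightarrow>\<^sub>M plane_borel j" by (rule measurable_plane) (use \<xi> s in auto)
      then have "(\<lambda>u. indicator N (plane \<xi> u) :: ennreal) \<in> borel_measurable borel" by measurable
      from nn_integral_perp[OF j'(1) \<xi> measurable_restrict_space1[OF this]]
      show ?thesis by (simp add: plane_diff_proj[OF s] plane_ext_eq[OF \<xi>])
    qed
    have m: "(\<lambda>\<xi>. ?I \<xi> / ennreal (unit_ball_vol j)) \<in> borel_measurable ?G"
      by (rule measurable_grassmannian_measure[OF subspace_UNIV j'(2)]) measurable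
    have "(\<integral>\<^sup>+ \<xi>. ?I \<xi> / ennreal (unit_ball_vol j) \<partial>?G) = 0"
      using z by (subst (asm) nn_integral_cong[OF I])
    then have "AE \<xi> in ?G. ?I \<xi> / ennreal (unit_ball_vol j) = 0"
      by (subst (asm) nn_integral_0_iff_AE[OF m])
    then have "AE \<xi> in ?G. False"
      using AE_space
    proof eventually_elim
      case (elim \<xi>)
      then show ?case using no I[OF elim(2)] by (simp add: space_grassmannian_measure[OF subspace_UNIV j'(2)])
    qed
    then show False by (simp add: G.AE_False)
  qed
  then obtain \<xi> where \<xi>: "\<xi> \<in> grassmannian j UNIV" and z\<xi>: "(\<integral>\<^sup>+ u. indicator N (plane \<xi> u) \<partial>subspace_lborel (\<xi>\<^sup>\<bottom>)) = 0" by blast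
  note s = grassmannianD(1)[OF \<xi>] and E = subspace_orthogonal_comp[of \<xi>]
  have pm: "(\<lambda>u. plane \<xi> u) \<in> borel \<rightarrow>\<^sub>M plane_borel j" by (rule measurable_plane) (use \<xi> s in auto)
  then have pL: "(\<lambda>u. plane \<xi> u) \<in> subspace_lborel (\<xi>\<^sup>\<bottom>) \<rightarrow>\<^sub>M plane_borel j"
    by (rule measurable_compose[OF measurable_subspace_lborel_ident[OF E]])
  have "(\<lambda>u. indicator N (plane \<xi> u) :: ennreal) \<in> borel_measurable (subspace_lborel (\<xi>\<^sup>\<bottom>))"
    by (rule measurable_compose[OF pL]) simp
  from nn_integral_0_iff_AE[OF this] z\<xi> have "AE u in subspace_lborel (\<xi>\<^sup>\<bottom>). indicator N (plane \<xi> u) = (0::ennreal)" by simp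
  then have "AE u in subspace_lborel (\<xi>\<^sup>\<bottom>). f\<^sub>0 (norm u) = f' (plane \<xi> u)"
    using AE_space
  proof eventually_elim
    case (elim u)
    then have u: "u \<in> \<xi>\<^sup>\<bottom>" by (simp add: space_subspace_lborel[OF E])
    have p: "plane \<xi> u \<in> affine_grassmannian j" by (rule plane_in_affine_grassmannian[OF \<xi>])
    have "plane \<xi> u \<notin> N" using elim(1) by (simp add: indicator_def split: if_splits)
    then have "f (plane \<xi> u) = f' (plane \<xi> u)" using N(2) p by auto
    then show ?case using rad[OF p] plane_norm_plane[OF s u] by simp
  qed
  moreover have "(\<lambda>u. f' (plane \<xi> u)) \<in> borel_measurable borel"
    by (rule measurable_compose[OF pm]) (use f' in \<open>simp cong: measurable_cong_sets\<close>)
  moreover have "dim (\<xi>\<^sup>\<bottom>) > 0" using dim_orthogonal_comp[OF s] grassmannianD(3)[OF \<xi>] j by simp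
  ultimately show thesis using radial_profile_borel[OF E] that by blast
qed

text \<open>Polar coordinates in each fibre. The fibre integral is the same for all \<xi> and the
  Grassmannian has mass 1; the factor \<open>unit_ball_vol ?m * ?m\<close> is the area of the unit
  sphere in dimension n - j.\<close>

lemma nn_integral_tail_radial:
  fixes f :: "'a::euclidean_space set \<Rightarrow> real"
  assumes k: "k > 0" and jk: "j + k < DIM('a)" and a: "a > 0"
    and rad: "\<And>\<tau>. \<tau> \<in> affine_grassmannian j \<Longrightarrow> f \<tau> = f\<^sub>0 (plane_norm \<tau>)"
    and nonneg: "\<And>\<tau>. \<tau> \<in> affine_grassmannian j \<Longrightarrow> 0 \<le> f \<tau>"
    and f1[measurable]: "f\<^sub>1 \<in> borel_measurable borel" and AE: "AE t in lborel. t > 0 \<longrightarrow> f\<^sub>0 t = f\<^sub>1 t"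
    and no: "\<not> tail_condition j k f a"
  shows "(\<integral>\<^sup>+ t. ennreal (f\<^sub>1 t) * (ennreal (t ^ (k - 1)) * indicator {a<..} t) \<partial>lborel) = \<infinity>"
proof -
  have j': "j \<le> DIM('a)" "j \<le> dim (UNIV :: 'a set)" "j < DIM('a)" using jk by simp_all
  let ?G = "grassmannian_measure j (UNIV :: 'a set)" and ?m = "DIM('a) - j" and ?n = "DIM('a)"
  interpret G: prob_space ?G by (rule prob_space_grassmannian_measure[OF subspace_UNIV j'(2)])
  obtain Z where Z: "Z \<in> null_sets lborel" "{t \<in> space lborel. \<not> (t > 0 \<longrightarrow> f\<^sub>0 t = f\<^sub>1 t)} \<subseteq> Z"
    using AE unfolding eventually_ae_filter by auto
  have Zf: "f\<^sub>0 t = f\<^sub>1 t" if "t > 0" "t \<notin> Z" for t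
    using Z(2) that by (auto simp: subset_iff)
  have Zs[measurable]: "Z \<in> sets borel" using Z by auto
  have mpow: "(\<lambda>t::real. t powi n) \<in> borel_measurable borel" for n :: int
    unfolding power_int_def by measurable
  \<comment> \<open>Infinite on \<open>Z\<close>, so that f times the weight is dominated at every
    plane with |\<tau>| > a, also where |\<tau>| lies in \<open>Z\<close>; in the variable t the
    added term vanishes almost everywhere.\<close>
  define g where "g t = ennreal (f\<^sub>1 t) * ennreal (t powi (int k + int j - int ?n)) + \<infinity> * indicator Z t" for t
  have g[measurable]: "g \<in> borel_measurable borel" unfolding g_def using mpow[measurable] by measurable
  have "\<infinity> = (\<integral>\<^sup>+ \<tau>. ennreal (f \<tau> * plane_norm \<tau> powi (int k + int j - int ?n)) * indicator {\<tau>. plane_norm \<tau> > a} \<tau> \<partial>plane_lborel j)"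
  proof -
    have "(\<integral>\<^sup>+ \<tau>. ennreal (f \<tau> * plane_norm \<tau> powi (int k + int j - int ?n)) * indicator {\<tau>. plane_norm \<tau> > a} \<tau> \<partial>plane_lborel j) =
      (\<integral>\<^sup>+ \<tau>. ennreal (\<bar>f \<tau>\<bar> * plane_norm \<tau> powi (int k + int j - int ?n)) * indicator {\<tau>. plane_norm \<tau> > a} \<tau> \<partial>plane_lborel j)"
      by (intro nn_integral_cong) (simp add: nonneg)
    then show ?thesis using no by (simp add: tail_condition_def plane_measure_eq[OF j'(1)] nn_integral_completion less_top[symmetric])
  qed
  also have "\<dots> \<le> (\<integral>\<^sup>+ \<tau>. g (plane_norm \<tau>) * indicator {a<..} (plane_norm \<tau>) \<partial>(plane_lborel j :: 'a set measure))"
  proof (rule nn_integral_mono)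
    fix \<tau> :: "'a set" assume "\<tau> \<in> space (plane_lborel j)"
    then have \<tau>: "\<tau> \<in> affine_grassmannian j" by simp
    show "ennreal (f \<tau> * plane_norm \<tau> powi (int k + int j - int ?n)) * indicator {\<tau>. plane_norm \<tau> > a} \<tau> \<le> g (plane_norm \<tau>) * indicator {a<..} (plane_norm \<tau>)"
    proof (cases "plane_norm \<tau> > a")
      case True
      show ?thesis
      proof (cases "plane_norm \<tau> \<in> Z")
        case False
        then have "f \<tau> = f\<^sub>1 (plane_norm \<tau>)" using Zf[of "plane_norm \<tau>"] True a rad[OF \<tau>] by simp
        then show ?thesis using True False nonneg[OF \<tau>] a
          by (simp add: g_def ennreal_mult zero_le_power_int infdist_nonneg)
      qed (use True in \<open>simp add: g_def\<close>)
    qed simp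
  qed
  also have "\<dots> = (\<integral>\<^sup>+ \<xi>. \<integral>\<^sup>+ u. g (plane_norm (plane \<xi> u)) * indicator {a<..} (plane_norm (plane \<xi> u)) \<partial>subspace_lborel (\<xi>\<^sup>\<bottom>) \<partial>?G)"
    by (rule nn_integral_plane_lborel[OF j'(1)]) measurable
  also have "\<dots> = (\<integral>\<^sup>+ \<xi>. (\<integral>\<^sup>+ t. g t * (ennreal (radial_density ?m 0 t) * indicator {a<..} t) \<partial>lborel) \<partial>?G)"
  proof (rule nn_integral_cong)
    fix \<xi> assume "\<xi> \<in> space ?G"
    then have \<xi>: "\<xi> \<in> grassmannian j UNIV" by (simp add: space_grassmannian_measure[OF subspace_UNIV j'(2)])
    note s = grassmannianD(1)[OF \<xi>] and E = subspace_orthogonal_comp[of \<xi>]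
    have d: "dim (\<xi>\<^sup>\<bottom>) = ?m" using dim_orthogonal_comp[OF s] grassmannianD(3)[OF \<xi>] by simp
    have "(\<integral>\<^sup>+ u. g (plane_norm (plane \<xi> u)) * indicator {a<..} (plane_norm (plane \<xi> u)) \<partial>subspace_lborel (\<xi>\<^sup>\<bottom>)) =
      (\<integral>\<^sup>+ u. g (sqrt ((norm u)\<^sup>2 + 0\<^sup>2)) * indicator {a<..} (sqrt ((norm u)\<^sup>2 + 0\<^sup>2)) \<partial>subspace_lborel (\<xi>\<^sup>\<bottom>))"
      by (intro nn_integral_cong) (simp add: space_subspace_lborel[OF E] plane_norm_plane[OF s])
    also have "\<dots> = (\<integral>\<^sup>+ t. g t * (ennreal (radial_density ?m 0 t) * indicator {a<..} t) \<partial>lborel)"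
      unfolding d[symmetric] by (rule nn_integral_radial_tail[OF E order_refl a g])
    finally show "(\<integral>\<^sup>+ u. g (plane_norm (plane \<xi> u)) * indicator {a<..} (plane_norm (plane \<xi> u)) \<partial>subspace_lborel (\<xi>\<^sup>\<bottom>)) =
      (\<integral>\<^sup>+ t. g t * (ennreal (radial_density ?m 0 t) * indicator {a<..} t) \<partial>lborel)" .
  qed
  also have "\<dots> = (\<integral>\<^sup>+ t. g t * (ennreal (radial_density ?m 0 t) * indicator {a<..} t) \<partial>lborel)"
    by (simp add: G.emeasure_space_1)
  also have "\<dots> = (\<integral>\<^sup>+ t. ennreal (unit_ball_vol ?m * ?m) * (ennreal (f\<^sub>1 t) * (ennreal (t ^ (k - 1)) * indicator {a<..} t)) \<partial>lborel)"
  proof (rule nn_integral_cong_AE, use AE_not_in[OF Z(1)] in eventually_elim)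
    case (elim t)
    show ?case
    proof (cases "t > a")
      case True
      then have t: "t > 0" using a by simp
      have "ennreal (t powi (int k + int j - int ?n)) * ennreal (radial_density ?m 0 t) =
        ennreal (t powi (int k + int j - int ?n) * radial_density ?m 0 t)"
        using t j'(3) by (intro ennreal_mult[symmetric]) (auto simp: radial_density_0)
      also have "t powi (int k + int j - int ?n) * radial_density ?m 0 t = unit_ball_vol ?m * ?m * (t powi (int k + int j - int ?n) * t ^ (?m - 1))"
        using t j'(3) by (simp add: radial_density_0)
      also have "\<dots> = unit_ball_vol ?m * ?m * t ^ (k - 1)"
        using powi_times_power[OF t k less_imp_le[OF jk] j'(3)] by simp
      also have "ennreal \<dots> = ennreal (unit_ball_vol ?m * ?m) * ennreal (t ^ (k - 1))"
        using t by (intro ennreal_mult) auto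
      finally have e: "ennreal (t powi (int k + int j - int ?n)) * ennreal (radial_density ?m 0 t) = ennreal (unit_ball_vol ?m * ?m) * ennreal (t ^ (k - 1))" .
      have "g t * (ennreal (radial_density ?m 0 t) * indicator {a<..} t) = ennreal (f\<^sub>1 t) * (ennreal (t powi (int k + int j - int ?n)) * ennreal (radial_density ?m 0 t))"
        using True elim by (simp add: g_def mult.assoc)
      also have "\<dots> = ennreal (unit_ball_vol ?m * ?m) * (ennreal (f\<^sub>1 t) * (ennreal (t ^ (k - 1)) * indicator {a<..} t))"
        unfolding e using True by (simp add: mult.left_commute)
      finally show ?thesis .
    qed simp
  qed
  also have "\<dots> = ennreal (unit_ball_vol ?m * ?m) * (\<integral>\<^sup>+ t. ennreal (f\<^sub>1 t) * (ennreal (t ^ (k - 1)) * indicator {a<..} t) \<partial>lborel)"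
    by (rule nn_integral_cmult) measurable
  finally have top: "\<infinity> \<le> ennreal (unit_ball_vol ?m * ?m) * (\<integral>\<^sup>+ t. ennreal (f\<^sub>1 t) * (ennreal (t ^ (k - 1)) * indicator {a<..} t) \<partial>lborel)" .
  show ?thesis
  proof (rule ccontr)
    assume "\<not> ?thesis"
    then have "ennreal (unit_ball_vol ?m * ?m) * (\<integral>\<^sup>+ t. ennreal (f\<^sub>1 t) * (ennreal (t ^ (k - 1)) * indicator {a<..} t) \<partial>lborel) < \<infinity>"
      by (simp add: ennreal_mult_less_top less_top)
    with top show False by simp
  qed
qed

lemma has_lebesgue_integral_nonneg_infinite:
  assumes "g \<in> borel_measurable M" "\<And>x. x \<in> space M \<Longrightarrow> 0 \<le> g x" "(\<integral>\<^sup>+ x. ennreal (g x) \<partial>M) = \<infinity>"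
  shows "has_lebesgue_integral M (\<lambda>x. ereal (g x)) \<infinity>"
proof -
  have "(\<integral>\<^sup>+ x. e2ennreal (- ereal (g x)) \<partial>M) = (\<integral>\<^sup>+ x. 0 \<partial>M)"
    by (intro nn_integral_cong) (use assms(2) in \<open>auto simp: e2ennreal_neg ennreal_neg\<close>)
  moreover have "(\<integral>\<^sup>+ x. e2ennreal (ereal (g x)) \<partial>M) = \<infinity>"
    using assms(3) by simp
  ultimately show ?thesis
    using assms(1) by (simp add: has_lebesgue_integral_def)
qed

text \<open>u in \<eta> is orthogonal to \<xi> and to the part of v orthogonal to \<xi>, so |\<xi> +
  u + v|^2 = |u|^2 + w^2, with w the length of that part. The inner integral is infinite for every
  \<xi>, and the outer one integrates the constant \<infinity> over a probability measure.\<close>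

theorem mixed_radon_infinite:
  fixes f :: "'a::euclidean_space set \<Rightarrow> real"
  assumes k: "k > 0" and jk: "j + k < DIM('a)" and f: "locally_integrable j f"
    and nonneg: "\<forall>\<tau>\<in>affine_grassmannian j. 0 \<le> f \<tau>" and radial: "radial j f"
    and no: "\<not> (\<exists>a>0. tail_condition j k f a)" and \<zeta>: "\<zeta> \<in> affine_grassmannian k"
  shows "has_mixed_radon j f \<zeta> \<infinity>"
proof -
  obtain f\<^sub>0 where rad: "\<And>\<tau>. \<tau> \<in> affine_grassmannian j \<Longrightarrow> f \<tau> = f\<^sub>0 (plane_norm \<tau>)"
    using radial unfolding radial_def by blast
  have jk': "j + k \<le> DIM('a)" "j < DIM('a)" using jk by simp_all
  obtain f\<^sub>1 where f1[measurable]: "f\<^sub>1 \<in> borel_measurable borel" and AE: "AE t in lborel. t > 0 \<longrightarrow> f\<^sub>0 t = f\<^sub>1 t"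
    using radial_profile[OF jk'(2) locally_integrable_measurable[OF f] rad] jk'(2) by auto
  obtain Z where Z: "Z \<in> null_sets lborel" "{t \<in> space lborel. \<not> (t > 0 \<longrightarrow> f\<^sub>0 t = f\<^sub>1 t)} \<subseteq> Z"
    using AE unfolding eventually_ae_filter by auto
  have Zf: "f\<^sub>0 t = f\<^sub>1 t" if "t > 0" "t \<notin> Z" for t
    using Z(2) that by (auto simp: subset_iff)
  obtain \<eta> v where \<eta>: "\<eta> \<in> grassmannian k UNIV" "v \<in> \<eta>\<^sup>\<bottom>" "\<zeta> = plane \<eta> v"
    using \<zeta> by (auto elim: affine_grassmannianE)
  note s = grassmannianD(1)[OF \<eta>(1)] and E = subspace_orthogonal_comp[of \<eta>] and d = le_dim_perp[OF jk'(1) \<eta>(1)]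
  have dk: "dim \<eta> = k" "dim \<eta> > 0" using grassmannianD(3)[OF \<eta>(1)] k by simp_all
  let ?G = "grassmannian_measure j (\<eta>\<^sup>\<bottom>)" and ?L = "subspace_lborel \<eta>"
  interpret G: prob_space ?G by (rule prob_space_grassmannian_measure[OF E d])
  note [measurable] = measurable_subspace_lborel_ident[OF s]
  have inf: "has_lebesgue_integral (completion ?L) (\<lambda>u. ereal (f (plane \<xi> (u + v)))) \<infinity>" if \<xi>: "\<xi> \<in> grassmannian j (\<eta>\<^sup>\<bottom>)" for \<xi>
  proof -
    note sx = grassmannianD(1)[OF \<xi>]
    have \<xi>U: "\<xi> \<in> grassmannian j UNIV" using \<xi> by (simp add: grassmannian_def)
    define w where "w = norm (v - proj \<xi> v)"
    let ?q = "\<lambda>u::'a. sqrt ((norm u)\<^sup>2 + w\<^sup>2)"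
    have w: "0 \<le> w" by (simp add: w_def)
    have ag: "plane \<xi> (u + v) \<in> affine_grassmannian j" for u by (rule plane_in_affine_grassmannian[OF \<xi>U])
    have pn: "plane_norm (plane \<xi> (u + v)) = ?q u" if u: "u \<in> \<eta>" for u
    proof -
      have "proj \<xi> u = 0"
        by (rule proj_perp[OF sx]) (use orthogonal_comp_swap[OF grassmannianD(2)[OF \<xi>]] u in auto)
      then have "plane_norm (plane \<xi> (u + v)) = norm (u + (v - proj \<xi> v))"
        unfolding plane_norm_eq[OF sx] by (simp add: blinfun.add_right algebra_simps)
      moreover have "v - proj \<xi> v \<in> \<eta>\<^sup>\<bottom>"
        using proj_in[OF sx, of v] grassmannianD(2)[OF \<xi>] by (intro subspace_diff[OF E \<eta>(2)]) auto
      then have "orthogonal u (v - proj \<xi> v)" using u unfolding orthogonal_def by (rule orthogonal_compD(2))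
      ultimately show ?thesis using norm_add_Pythagorean[of u "v - proj \<xi> v"] by (simp add: w_def real_sqrt_unique)
    qed
    have spL: "space ?L = \<eta>" by (rule space_subspace_lborel[OF s])
    have AEf: "AE u in ?L. f (plane \<xi> (u + v)) = f\<^sub>1 (?q u)"
      using AE_radial_null[OF s dk(2) w Z(1)] AE_subspace_lborel_nonzero[OF s dk(2)] AE_space
    proof eventually_elim
      case (elim u)
      have "?q u > 0" using elim(2) by (simp add: add_pos_nonneg)
      then have "f\<^sub>0 (?q u) = f\<^sub>1 (?q u)" using elim(1) by (rule Zf)
      then show ?case using rad[OF ag] pn elim(3) by (simp add: spL)
    qed
    \<comment> \<open>Measurability of f is known only on G(n,j) as a whole; on this particular
      family of planes it comes from the Borel profile.\<close>
    have meas: "(\<lambda>u. f (plane \<xi> (u + v))) \<in> borel_measurable (completion ?L)"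
      by (rule measurable_completion_AE[OF _ AEf]) simp_all
    \<comment> \<open>The lower bound on the density starts at \<open>2 * w\<close>; adding 1 keeps
      \<open>?A\<close> positive and above \<open>w\<close> also when \<open>w = 0\<close>, so that
      failure of the tail condition can be used at \<open>?A\<close>.\<close>
    let ?A = "2 * w + 1"
    let ?c = "unit_ball_vol k * k * (1 / 2) ^ (k - 1)"
    have A: "w < ?A" "0 < ?A" using w by simp_all
    have "\<infinity> = ennreal ?c * (\<integral>\<^sup>+ t. ennreal (f\<^sub>1 t) * (ennreal (t ^ (k - 1)) * indicator {?A<..} t) \<partial>lborel)"
    proof -
      have "\<not> tail_condition j k f ?A" using no A(2) by blast
      then have "(\<integral>\<^sup>+ t. ennreal (f\<^sub>1 t) * (ennreal (t ^ (k - 1)) * indicator {?A<..} t) \<partial>lborel) = \<infinity>"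
        using nonneg by (intro nn_integral_tail_radial[OF k jk A(2) rad _ f1 AE]) auto
      moreover have "ennreal ?c \<noteq> 0" using k by (auto simp: ennreal_eq_0_iff not_le)
      ultimately show ?thesis by (simp add: ennreal_mult_top)
    qed
    also have "\<dots> = (\<integral>\<^sup>+ t. ennreal ?c * (ennreal (f\<^sub>1 t) * (ennreal (t ^ (k - 1)) * indicator {?A<..} t)) \<partial>lborel)"
      by (rule nn_integral_cmult[symmetric]) measurable
    also have "\<dots> \<le> (\<integral>\<^sup>+ t. ennreal (f\<^sub>1 t) * (ennreal (radial_density (dim \<eta>) w t) * indicator {?A<..} t) \<partial>lborel)"
    proof (rule nn_integral_mono)
      fix t
      show "ennreal ?c * (ennreal (f\<^sub>1 t) * (ennreal (t ^ (k - 1)) * indicator {?A<..} t)) \<le> ennreal (f\<^sub>1 t) * (ennreal (radial_density (dim \<eta>) w t) * indicator {?A<..} t)"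
      proof (cases "t > ?A")
        case True
        have "ennreal ?c * ennreal (t ^ (k - 1)) = ennreal (?c * t ^ (k - 1))"
          using True w by (intro ennreal_mult[symmetric]) auto
        also have "\<dots> \<le> ennreal (radial_density (dim \<eta>) w t)"
          unfolding dk(1) using True w by (intro ennreal_leI radial_density_ge) auto
        finally have "ennreal (f\<^sub>1 t) * (ennreal ?c * ennreal (t ^ (k - 1))) \<le> ennreal (f\<^sub>1 t) * ennreal (radial_density (dim \<eta>) w t)"
          by (rule mult_left_mono) simp
        then show ?thesis using True by (simp add: mult.left_commute)
      qed simp
    qed
    also have "\<dots> = (\<integral>\<^sup>+ u. ennreal (f\<^sub>1 (?q u)) * indicator {?A<..} (?q u) \<partial>?L)"
      by (rule nn_integral_radial_tail[OF s w A(1), symmetric]) measurable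
    also have "\<dots> \<le> (\<integral>\<^sup>+ u. ennreal (f (plane \<xi> (u + v))) \<partial>?L)"
      by (rule nn_integral_mono_AE, use AEf in eventually_elim) (simp add: indicator_def)
    finally have "(\<integral>\<^sup>+ u. ennreal (f (plane \<xi> (u + v))) \<partial>?L) = \<infinity>" by (simp add: top_unique)
    then show ?thesis
      using nonneg ag by (intro has_lebesgue_integral_nonneg_infinite[OF meas]) (auto simp: nn_integral_completion)
  qed
  have "AE \<xi> in completion ?G. has_lebesgue_integral (completion ?L) (\<lambda>u. ereal (f (plane \<xi> (u + v)))) \<infinity>"
    by (rule AE_completion, rule AE_I2) (simp add: inf space_grassmannian_measure[OF E d])
  moreover have "has_lebesgue_integral (completion ?G) (\<lambda>\<xi>. \<infinity>) \<infinity>"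
    by (simp add: has_lebesgue_integral_def nn_integral_completion G.emeasure_space_1 e2ennreal_neg)
  ultimately show ?thesis
    unfolding \<eta>(3) has_mixed_radon_plane[OF \<eta>(1,2)] by (intro exI[of _ "\<lambda>\<xi>. \<infinity>"]) auto
qed

theorem theorem5p2:
  fixes j k :: nat and f :: "'a::euclidean_space set \<Rightarrow> real"
  assumes "j > 0" and "k > 0" and "j + k < DIM('a)"
    and "locally_integrable j f"
  shows "((\<exists>a>0. tail_condition j k f a) \<longrightarrow>
            (AE \<zeta> in plane_measure k. \<exists>r::real. has_mixed_radon j f \<zeta> (ereal r))) \<and>
         ((\<forall>\<tau>\<in>affine_grassmannian j. 0 \<le> f \<tau>) \<and> radial j f \<and>
            \<not> (\<exists>a>0. tail_condition j k f a) \<longrightarrow>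
            (\<forall>\<zeta>\<in>affine_grassmannian k. has_mixed_radon j f \<zeta> \<infinity>))"
  using mixed_radon_finite[OF less_imp_le[OF assms(3)] assms(4)] mixed_radon_infinite[OF assms(2-4)] by blast

end
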